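(* Let $(X,\|\cdot\|)$ be a Banach space. Let $f: X \to \mathbb{R}\cup\{+\infty\}$ be lower semicontinuous, bounded below and such that $0\in \mathrm{dom}\, f=\{x\in X: f(x)<\infty\}$. For a norm $N$ on $X$ equivalent to $\|\cdot\|$, consider the optimization problem $$(P_{N})\qquad \inf\left\{ \int_0^1 \left(N(v(t))^2+f(u(t))\right) dt \;:\; v \in L_2([0,1],X),\ u(t)=\int_0^t v(s)\,ds \text{ for } t\in[0,1]\right\}.$$ Then for each $\varepsilon>0$ there is an equivalent norm $|\cdot|$ on $X$ such that $$\|x\| \le |x| \le (1+\varepsilon)\|x\| \quad\text{for all } x\in X,$$ and the corresponding problem $(P_{|\cdot|})$ has a solution, i.e. the infimum in $(P_{|\cdot|})$ is attained at some $\bar v\in L_2([0,1],X)$.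
   Context: Banach spaces are real. $L_2([0,1],X)$ is the Bochner space of (classes of) strongly measurable functions $v:[0,1]\to X$ with $\int_0^1\|v(t)\|^2\,dt<\infty$ (Lebesgue measure); $X$-valued integrals are Bochner integrals. A function $f:X\to\mathbb{R}\cup\{+\infty\}$ is lower semicontinuous if its epigraph is closed in $X\times\mathbb{R}$ (norm topology). The integral $\int_0^1 f(u(t))\,dt$ takes values in $\mathbb{R}\cup\{+\infty\}$. *)

theory Defs
  imports "HOL-Analysis.Analysis"
begin

text \<open>
  The library's \<^const>\<open>has_bochner_integral\<close> and \<^const>\<open>lebesgue_integral\<close> are confined to second
  countable, i.e. separable, target spaces. Here the target is an arbitrary normed space, so strong
  measurability and the Bochner integral are introduced on top of the library's
  \<^const>\<open>Bochner_Integration.simple_bochner_integral\<close>. The definitions are meant for complete measures, such as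
  \<^const>\<open>lebesgue_on\<close>, where an almost everywhere limit of simple functions is Borel measurable.
\<close>

definition strongly_measurable :: "'a measure \<Rightarrow> ('a \<Rightarrow> 'b::real_normed_vector) \<Rightarrow> bool" where
  "strongly_measurable M f \<longleftrightarrow>
    (\<exists>s. (\<forall>i::nat. simple_function M (s i)) \<and> (AE x in M. (\<lambda>i. s i x) \<longlonglongrightarrow> f x))"

definition has_strong_integral ::
    "'a measure \<Rightarrow> ('a \<Rightarrow> 'b::real_normed_vector) \<Rightarrow> 'b \<Rightarrow> bool" where
  "has_strong_integral M f y \<longleftrightarrow> strongly_measurable M f \<and>
    (\<exists>s. (\<forall>i::nat. Bochner_Integration.simple_bochner_integrable M (s i)) \<and>
      (\<lambda>i. \<integral>\<^sup>+x. ennreal (norm (f x - s i x)) \<partial>M) \<longlonglongrightarrow> 0 \<and>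
      (\<lambda>i. Bochner_Integration.simple_bochner_integral M (s i)) \<longlonglongrightarrow> y)"

definition strong_integral :: "'a measure \<Rightarrow> ('a \<Rightarrow> 'b::real_normed_vector) \<Rightarrow> 'b" where
  "strong_integral M f =
    (if \<exists>y. has_strong_integral M f y then THE y. has_strong_integral M f y else 0)"

lemma has_bochner_integral_imp_has_strong_integral:
  fixes f :: "'a \<Rightarrow> 'b::{real_normed_vector, second_countable_topology}"
  assumes "has_bochner_integral M f y"
  shows "has_strong_integral M f y"
  using assms
proof cases
  case (1 s)
  obtain F where "\<And>i. simple_function M (F i)"
      and "\<And>x. x \<in> space M \<Longrightarrow> (\<lambda>i. F i x) \<longlonglongrightarrow> f x"
    using borel_measurable_implies_sequence_metric[OF 1(1), of 0] by blast
  then have "strongly_measurable M f"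
    unfolding strongly_measurable_def by (intro exI[of _ F]) auto
  with 1 show ?thesis
    unfolding has_strong_integral_def by blast
qed

text \<open>Elements of \<open>L\<^sub>2\<close> are represented by functions; everything below depends only on their
  almost everywhere classes.\<close>

definition L2_space :: "'a measure \<Rightarrow> ('a \<Rightarrow> 'b::real_normed_vector) set" where
  "L2_space M = {v. strongly_measurable M v \<and> (\<integral>\<^sup>+t. ennreal ((norm (v t))\<^sup>2) \<partial>M) < \<infinity>}"

text \<open>Integral of an extended real valued function, as the integral of the positive part minus that of
  the negative part (\<^const>\<open>e2ennreal\<close> maps negative numbers to \<open>0\<close>). For functions bounded
  below on a finite measure space the subtrahend is finite.\<close>

definition ereal_integral :: "'a measure \<Rightarrow> ('a \<Rightarrow> ereal) \<Rightarrow> ereal" where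
  "ereal_integral M g =
    enn2ereal (\<integral>\<^sup>+x. e2ennreal (g x) \<partial>M) - enn2ereal (\<integral>\<^sup>+x. e2ennreal (- g x) \<partial>M)"

definition lower_semicontinuous :: "('a::topological_space \<Rightarrow> ereal) \<Rightarrow> bool" where
  "lower_semicontinuous f \<longleftrightarrow> closed {(x, r::real). f x \<le> ereal r}"

definition is_norm :: "('a::real_vector \<Rightarrow> real) \<Rightarrow> bool" where
  "is_norm N \<longleftrightarrow> (\<forall>x. 0 \<le> N x) \<and> (\<forall>x. N x = 0 \<longleftrightarrow> x = 0) \<and>
    (\<forall>c x. N (c *\<^sub>R x) = \<bar>c\<bar> * N x) \<and> (\<forall>x y. N (x + y) \<le> N x + N y)"

definition equivalent_norm :: "('a::real_normed_vector \<Rightarrow> real) \<Rightarrow> bool" where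
  "equivalent_norm N \<longleftrightarrow> is_norm N \<and>
    (\<exists>c>0. \<exists>C>0. \<forall>x. c * norm x \<le> N x \<and> N x \<le> C * norm x)"

definition primitive :: "(real \<Rightarrow> 'a::real_normed_vector) \<Rightarrow> real \<Rightarrow> 'a" where
  "primitive v t = strong_integral (lebesgue_on {0..t}) v"

definition cost ::
    "('a::real_normed_vector \<Rightarrow> real) \<Rightarrow> ('a \<Rightarrow> ereal) \<Rightarrow> (real \<Rightarrow> 'a) \<Rightarrow> ereal" where
  "cost N f v =
    ereal_integral (lebesgue_on {0..1}) (\<lambda>t. ereal ((N (v t))\<^sup>2) + f (primitive v t))"

definition is_solution ::
    "('a::real_normed_vector \<Rightarrow> real) \<Rightarrow> ('a \<Rightarrow> ereal) \<Rightarrow> (real \<Rightarrow> 'a) \<Rightarrow> bool" where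
  "is_solution N f v \<longleftrightarrow> v \<in> L2_space (lebesgue_on {0..1}) \<and>
    cost N f v = (INF w\<in>L2_space (lebesgue_on {0..1}). cost N f w)"

end

theory Submission
  imports Defs "HOL-Complex_Analysis.Great_Picard"
begin

text \<open>
  The integrand is convex in the velocity \<open>v\<close> but \<open>f\<close> is only lower semicontinuous in norm, so the
  direct method needs a minimizing sequence whose primitives converge in norm at every time. In an
  infinite-dimensional space nothing provides this; the freedom to change the norm is used to force
  it.

  Write \<open>p\<^sub>n(x)\<close> for the distance of \<open>x\<close> to the span of a finite set \<open>F\<^sub>n\<close> and put
  \<open>N(x)\<^sup>2 = \<parallel>x\<parallel>\<^sup>2 + \<Sum>\<^sub>n \<delta>\<^sub>n p\<^sub>n(x)\<^sup>2\<close> with \<open>\<Sum>\<^sub>n \<delta>\<^sub>n\<close> small. The sets are chosen one after the other: \<open>v\<^sub>n\<close>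
  minimizes up to \<open>\<tau>\<^sub>n\<close> the problem whose norm contains only the first \<open>n\<close> perturbations, and
  \<open>F\<^sub>n \<supseteq> F\<^sub>n\<^sub>-\<^sub>1\<close> is so large that the integral of \<open>p\<^sub>n(v\<^sub>n)\<^sup>2\<close> is at most \<open>\<tau>\<^sub>n\<close>; this is possible since
  \<open>v\<^sub>n\<close> is strongly measurable (lemma \<open>perturbation_sequence_exists\<close>). As the \<open>F\<^sub>n\<close> increase, all later
  perturbations cost \<open>v\<^sub>n\<close> at most \<open>\<tau>\<^sub>n\<close> as well, so with \<open>J\<close> the functional of the final norm
  \<open>J(v\<^sub>n) + \<delta>\<^sub>n \<integral> p\<^sub>n(w)\<^sup>2 \<le> J(w) + 2 \<tau>\<^sub>n\<close> for every \<open>w\<close>. Hence \<open>(v\<^sub>n)\<close> is a minimizing sequence for \<open>J\<close>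
  itself, and inserting \<open>w = v\<^sub>k\<close> gives \<open>\<integral> p\<^sub>n(v\<^sub>k)\<^sup>2 \<le> 4 \<tau>\<^sub>n / \<delta>\<^sub>n\<close> for \<open>k \<ge> n\<close>, which tends to \<open>0\<close> when
  \<open>\<tau>\<^sub>n\<close> decays faster than \<open>\<delta>\<^sub>n\<close>: the sequence is uniformly close to functions with values in
  finite-dimensional subspaces.

  Such sequences are compact in the sense needed (lemma
  \<open>compactness_of_nearly_finite_dimensional_sequence\<close>). Countably many functionals \<open>\<phi>\<^sub>i\<close> of norm at most
  one suffice to bound \<open>\<parallel>x\<parallel>\<close> by twice a finite sum of the \<open>\<bar>\<phi>\<^sub>i(x)\<bar>\<close> plus \<open>3 p\<^sub>n(x)\<close>. The factor \<open>3\<close>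
  does not depend on \<open>n\<close>; a bound by projections would bring in their norms, which are not under control
  when \<open>F\<^sub>n\<close> is chosen after \<open>\<tau>\<^sub>n\<close>. By a diagonal argument the primitives converge in norm along a
  subsequence, at rational times and then by equicontinuity at all times. The velocities need not
  converge strongly, but suitable iterated midpoints of their tails do: the quadratic form
  \<open>\<Sum>\<^sub>i 2\<^sup>-\<^sup>i \<phi>\<^sub>i(x)\<^sup>2\<close> obeys the parallelogram law, so midpoints that nearly minimize its integral form a
  Cauchy sequence, as in the proof that a closed convex set in a Hilbert space has an element of least
  norm. The limit of the midpoints has the limit of the primitives as its primitive, and its energy is
  no larger than the limit of the energies because \<open>N\<^sup>2\<close> is convex. Fatou's lemma treats the term
  with \<open>f\<close>.
\<close>

section \<open>The Bochner integral over a complete measure space\<close>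

text \<open>
  Norms and distances to subspaces are handled together; the bound by the norm makes such a seminorm
  Lipschitz with constant one.
\<close>

definition contractive_seminorm :: "('a::real_normed_vector \<Rightarrow> real) \<Rightarrow> bool" where
  "contractive_seminorm p \<longleftrightarrow> (\<forall>x y. p (x + y) \<le> p x + p y) \<and>
    (\<forall>c x. p (c *\<^sub>R x) = \<bar>c\<bar> * p x) \<and> (\<forall>x. p x \<le> norm x)"

lemma contractive_seminormD:
  assumes "contractive_seminorm p"
  shows "p (x + y) \<le> p x + p y" "p (c *\<^sub>R x) = \<bar>c\<bar> * p x" "p x \<le> norm x"
  using assms by (auto simp: contractive_seminorm_def)

lemma contractive_seminorm_simps:
  assumes "contractive_seminorm p"
  shows "p 0 = 0" "p (- x) = p x" "0 \<le> p x" "\<bar>p x - p y\<bar> \<le> p (x - y)"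
proof -
  note D = contractive_seminormD[OF assms]
  show z: "p 0 = 0"
    using D(2)[of 0 0] by simp
  show m: "p (- x) = p x" for x
    using D(2)[of "-1" x] by simp
  show "0 \<le> p x"
    using D(1)[of x "- x"] z m[of x] by simp
  show "\<bar>p x - p y\<bar> \<le> p (x - y)"
    using D(1)[of "x - y" y] D(1)[of "y - x" x] m[of "x - y"] by simp
qed

lemma contractive_seminorm_continuous:
  assumes "contractive_seminorm p"
  shows "continuous_on UNIV p"
proof (rule continuous_onI)
  fix x e :: real and y assume "0 < e"
  then show "\<exists>d>0. \<forall>x'\<in>UNIV. dist x' y < d \<longrightarrow> dist (p x') (p y) \<le> e"
    using contractive_seminorm_simps(4)[OF assms] contractive_seminormD(3)[OF assms]
    by (intro exI[of _ e]) (smt (verit) dist_norm real_norm_def)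
qed

lemma contractive_seminorm_norm: "contractive_seminorm norm"
  by (simp add: contractive_seminorm_def norm_triangle_ineq)

lemma contractive_seminorm_sum:
  assumes "contractive_seminorm p" "finite A"
  shows "p (\<Sum>i\<in>A. f i) \<le> (\<Sum>i\<in>A. p (f i))"
  using assms(2)
proof (induction rule: finite_induct)
  case empty
  then show ?case using contractive_seminorm_simps(1)[OF assms(1)] by simp
next
  case (insert a A)
  then show ?case using contractive_seminormD(1)[OF assms(1), of "f a" "sum f A"] by simp
qed

lemma (in complete_measure) borel_measurable_AE_limit:
  fixes f :: "'a \<Rightarrow> real"
  assumes [measurable]: "\<And>i. g i \<in> borel_measurable M"
    and lim: "AE x in M. (\<lambda>i. g i x) \<longlonglongrightarrow> f x"
  shows "f \<in> borel_measurable M"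
proof (rule measurableI)
  fix A :: "real set" assume [measurable]: "A \<in> sets borel"
  have [measurable]: "(\<lambda>x. lim (\<lambda>i. g i x)) \<in> borel_measurable M"
    by (rule borel_measurable_lim_metric) simp
  show "f -` A \<inter> space M \<in> sets M"
  proof (rule in_sets_AE)
    show "AE x in M. x \<in> (\<lambda>x. lim (\<lambda>i. g i x)) -` A \<inter> space M \<longleftrightarrow> x \<in> f -` A \<inter> space M"
      using lim by eventually_elim (auto simp: limI)
    show "(\<lambda>x. lim (\<lambda>i. g i x)) -` A \<inter> space M \<in> sets M" by measurable
  qed auto
qed simp

lemma (in complete_measure) strongly_measurable_continuous_compose:
  fixes g :: "'b::real_normed_vector \<Rightarrow> real"
  assumes f: "strongly_measurable M f" and g: "continuous_on UNIV g"
  shows "(\<lambda>x. g (f x)) \<in> borel_measurable M"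
proof -
  obtain s where s: "\<And>i::nat. simple_function M (s i)" "AE x in M. (\<lambda>i. s i x) \<longlonglongrightarrow> f x"
    using f unfolding strongly_measurable_def by blast
  show ?thesis
  proof (rule borel_measurable_AE_limit)
    show "(\<lambda>x. g (s i x)) \<in> borel_measurable M" for i
      by (rule borel_measurable_simple_function[OF simple_function_compose1[OF s(1)]])
    show "AE x in M. (\<lambda>i. g (s i x)) \<longlonglongrightarrow> g (f x)"
      using s(2) by eventually_elim (auto intro: continuous_on_tendsto_compose[OF g])
  qed
qed

lemma strongly_measurable_linear_combination:
  assumes "strongly_measurable M f" "strongly_measurable M g"
  shows "strongly_measurable M (\<lambda>x. a *\<^sub>R f x + b *\<^sub>R g x)"
proof -
  obtain s t where s: "\<And>i::nat. simple_function M (s i)" "AE x in M. (\<lambda>i. s i x) \<longlonglongrightarrow> f x"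
    and t: "\<And>i::nat. simple_function M (t i)" "AE x in M. (\<lambda>i. t i x) \<longlonglongrightarrow> g x"
    using assms unfolding strongly_measurable_def by blast
  show ?thesis
    unfolding strongly_measurable_def
  proof (intro exI conjI allI)
    show "simple_function M (\<lambda>x. a *\<^sub>R s i x + b *\<^sub>R t i x)" for i
      by (rule simple_function_compose2[OF s(1) t(1)])
    show "AE x in M. (\<lambda>i. a *\<^sub>R s i x + b *\<^sub>R t i x) \<longlonglongrightarrow> a *\<^sub>R f x + b *\<^sub>R g x"
      using s(2) t(2) by eventually_elim (intro tendsto_intros)
  qed
qed

lemma strongly_measurable_indicator_scaleR:
  assumes "strongly_measurable M f" and A: "A \<inter> space M \<in> sets M"
  shows "strongly_measurable M (\<lambda>x. indicator A x *\<^sub>R f x)"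
proof -
  obtain s where s: "\<And>i::nat. simple_function M (s i)" "AE x in M. (\<lambda>i. s i x) \<longlonglongrightarrow> f x"
    using assms unfolding strongly_measurable_def by blast
  have "simple_function M (indicator (A \<inter> space M) :: _ \<Rightarrow> real)"
    by (rule simple_function_indicator[OF A])
  then have ind: "simple_function M (indicator A :: _ \<Rightarrow> real)"
    by (rule simple_function_cong[THEN iffD1, rotated]) (auto split: split_indicator)
  show ?thesis
    unfolding strongly_measurable_def
  proof (intro exI conjI allI)
    show "simple_function M (\<lambda>x. (indicator A x :: real) *\<^sub>R s i x)" for i
      by (rule simple_function_compose2[OF ind s(1)])
    show "AE x in M. (\<lambda>i. indicator A x *\<^sub>R s i x) \<longlonglongrightarrow> indicator A x *\<^sub>R f x"
      using s(2) by eventually_elim (intro tendsto_intros)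
  qed
qed

lemma simple_function_imp_strongly_measurable:
  "simple_function M s \<Longrightarrow> strongly_measurable M s"
  unfolding strongly_measurable_def by (intro exI[of _ "\<lambda>_. s"]) auto

lemma simple_bochner_integrable_imp_strongly_measurable:
  "Bochner_Integration.simple_bochner_integrable M s \<Longrightarrow> strongly_measurable M s"
  by (simp add: Bochner_Integration.simple_bochner_integrable.simps simple_function_imp_strongly_measurable)

lemma (in complete_measure) borel_measurable_norm_diff_strongly:
  assumes "strongly_measurable M f" "strongly_measurable M g"
  shows "(\<lambda>x. norm (f x - g x)) \<in> borel_measurable M"
  using strongly_measurable_continuous_compose[OF
      strongly_measurable_linear_combination[OF assms, of 1 "-1"] continuous_on_norm_id]
  by simp

text \<open>
  Resetting the simple function to zero wherever it exceeds twice the norm of the limit does not spoil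
  convergence, and makes dominated convergence available.
\<close>

lemma (in complete_measure) strongly_measurable_dominated_approx:
  assumes "strongly_measurable M f"
  obtains s where "\<And>i::nat. simple_function M (s i)"
    "\<And>i x. norm (s i x) \<le> 2 * norm (f x)" "AE x in M. (\<lambda>i. s i x) \<longlonglongrightarrow> f x"
proof -
  obtain s where s: "\<And>i::nat. simple_function M (s i)" "AE x in M. (\<lambda>i. s i x) \<longlonglongrightarrow> f x"
    using assms unfolding strongly_measurable_def by blast
  define t where "t i x = (if norm (s i x) \<le> 2 * norm (f x) then s i x else 0)" for i x
  have [measurable]: "(\<lambda>x. norm (f x)) \<in> borel_measurable M"
    by (rule strongly_measurable_continuous_compose[OF assms]) (intro continuous_intros)
  have [measurable]: "(\<lambda>x. norm (s i x)) \<in> borel_measurable M" for i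
    by (rule borel_measurable_simple_function[OF simple_function_compose1[OF s(1)]])
  show thesis
  proof
    show "simple_function M (t i)" for i
      unfolding t_def
      by (intro simple_function_If s simple_function_const) measurable
    show "norm (t i x) \<le> 2 * norm (f x)" for i x
      by (auto simp: t_def)
    show "AE x in M. (\<lambda>i. t i x) \<longlonglongrightarrow> f x"
      using s(2)
    proof eventually_elim
      case (elim x)
      show ?case
      proof (cases "f x = 0")
        case True
        then have "t i x = 0" for i by (auto simp: t_def)
        then show ?thesis using True by simp
      next
        case False
        have "(\<lambda>i. norm (s i x)) \<longlonglongrightarrow> norm (f x)" using elim by (rule tendsto_norm)
        then have "eventually (\<lambda>i. norm (s i x) < 2 * norm (f x)) sequentially"
          by (rule order_tendstoD) (use False in simp)
        then have "eventually (\<lambda>i. s i x = t i x) sequentially"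
          by eventually_elim (simp add: t_def)
        with elim show ?thesis by (rule Lim_transform_eventually)
      qed
    qed
  qed
qed

lemma (in complete_measure) strongly_integrable_simple_approx:
  assumes f: "strongly_measurable M f" and fin: "(\<integral>\<^sup>+x. norm (f x) \<partial>M) < \<infinity>"
  obtains s where "\<And>i::nat. Bochner_Integration.simple_bochner_integrable M (s i)"
    "(\<lambda>i. \<integral>\<^sup>+x. ennreal (norm (f x - s i x)) \<partial>M) \<longlonglongrightarrow> 0"
proof -
  obtain s where s: "\<And>i::nat. simple_function M (s i)"
    "\<And>i x. norm (s i x) \<le> 2 * norm (f x)" "AE x in M. (\<lambda>i. s i x) \<longlonglongrightarrow> f x"
    using strongly_measurable_dominated_approx[OF f] by blast
  have sm: "strongly_measurable M (s i)" for i
    by (rule simple_function_imp_strongly_measurable[OF s(1)])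
  have nf: "(\<lambda>x. norm (f x)) \<in> borel_measurable M"
    by (rule strongly_measurable_continuous_compose[OF f]) (intro continuous_intros)
  have fin3: "(\<integral>\<^sup>+x. ennreal (3 * norm (f x)) \<partial>M) < \<infinity>"
    using fin nf by (simp add: ennreal_mult nn_integral_cmult ennreal_mult_less_top)
  show thesis
  proof
    show "Bochner_Integration.simple_bochner_integrable M (s i)" for i
    proof (rule Bochner_Integration.simple_bochner_integrableI_bounded[OF s(1)])
      have "(\<integral>\<^sup>+x. ennreal (norm (s i x)) \<partial>M) \<le> (\<integral>\<^sup>+x. ennreal (3 * norm (f x)) \<partial>M)"
        by (intro nn_integral_mono ennreal_leI order_trans[OF s(2)]) simp
      with fin3 show "(\<integral>\<^sup>+x. ennreal (norm (s i x)) \<partial>M) < \<infinity>" by (rule le_less_trans[rotated])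
    qed
    have "(\<lambda>i. \<integral>\<^sup>+x. ennreal (norm (f x - s i x)) \<partial>M) \<longlonglongrightarrow> (\<integral>\<^sup>+x. 0 \<partial>M)"
    proof (rule nn_integral_dominated_convergence[where w="\<lambda>x. ennreal (3 * norm (f x))"])
      show "(\<lambda>x. ennreal (norm (f x - s i x))) \<in> borel_measurable M" for i
        using borel_measurable_norm_diff_strongly[OF f sm, of i] by measurable
      show "(\<lambda>x. ennreal (3 * norm (f x))) \<in> borel_measurable M" using nf by measurable
      show "AE x in M. ennreal (norm (f x - s j x)) \<le> ennreal (3 * norm (f x))" for j
      proof (intro AE_I2 ennreal_leI)
        fix x show "norm (f x - s j x) \<le> 3 * norm (f x)"
          using s(2)[of j x] norm_triangle_ineq4[of "f x" "s j x"] by simp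
      qed
      show "AE x in M. (\<lambda>i. ennreal (norm (f x - s i x))) \<longlonglongrightarrow> 0"
        using s(3)
      proof eventually_elim
        case (elim x)
        then have "(\<lambda>i. norm (f x - s i x)) \<longlonglongrightarrow> norm (f x - f x)" by (intro tendsto_intros)
        then show ?case using tendsto_ennrealI by fastforce
      qed
    qed (use fin3 in auto)
    then show "(\<lambda>i. \<integral>\<^sup>+x. ennreal (norm (f x - s i x)) \<partial>M) \<longlonglongrightarrow> 0" by simp
  qed
qed

lemma simple_bochner_integral_seminorm_le:
  assumes p: "contractive_seminorm p" and s: "Bochner_Integration.simple_bochner_integrable M s"
  shows "ennreal (p (Bochner_Integration.simple_bochner_integral M s)) \<le> (\<integral>\<^sup>+x. p (s x) \<partial>M)"
proof -
  have fin: "finite (s ` space M)"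
    using s by (auto simp: simple_function_def elim: Bochner_Integration.simple_bochner_integrable.cases)
  have ps: "Bochner_Integration.simple_bochner_integrable M (\<lambda>x. p (s x))"
    using Bochner_Integration.simple_bochner_integrable_compose2[of "\<lambda>x y. p x", OF _ s s]
      contractive_seminorm_simps(1)[OF p] by simp
  have "p (Bochner_Integration.simple_bochner_integral M s) \<le>
      (\<Sum>y\<in>s ` space M. p (measure M {x \<in> space M. s x = y} *\<^sub>R y))"
    unfolding Bochner_Integration.simple_bochner_integral_def
    by (rule contractive_seminorm_sum[OF p fin])
  also have "\<dots> = (\<Sum>y\<in>s ` space M. measure M {x \<in> space M. s x = y} *\<^sub>R p y)"
    by (simp add: contractive_seminormD(2)[OF p])
  also have "\<dots> = Bochner_Integration.simple_bochner_integral M (\<lambda>x. p (s x))"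
    using s ps
    by (intro Bochner_Integration.simple_bochner_integral_partition[symmetric])
       (auto elim: Bochner_Integration.simple_bochner_integrable.cases)
  finally show ?thesis
    using Bochner_Integration.simple_bochner_integral_eq_nn_integral[OF ps] contractive_seminorm_simps(3)[OF p]
    by (metis ennreal_leI)
qed

text \<open>
  Jensen's inequality for a seminorm: it is the triangle inequality for simple functions, and both sides
  are continuous along approximating simple functions.
\<close>

lemma (in complete_measure) has_strong_integral_seminorm_le:
  assumes p: "contractive_seminorm p" and f: "has_strong_integral M f y"
  shows "ennreal (p y) \<le> (\<integral>\<^sup>+x. p (f x) \<partial>M)"
proof -
  obtain s where fm: "strongly_measurable M f"
    and s: "\<And>i::nat. Bochner_Integration.simple_bochner_integrable M (s i)"
    "(\<lambda>i. \<integral>\<^sup>+x. ennreal (norm (f x - s i x)) \<partial>M) \<longlonglongrightarrow> 0"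
    "(\<lambda>i. Bochner_Integration.simple_bochner_integral M (s i)) \<longlonglongrightarrow> y"
    using f unfolding has_strong_integral_def by blast
  have sm: "strongly_measurable M (s i)" for i
    by (rule simple_bochner_integrable_imp_strongly_measurable[OF s(1)])
  have [measurable]: "(\<lambda>x. p (f x)) \<in> borel_measurable M"
    by (rule strongly_measurable_continuous_compose[OF fm contractive_seminorm_continuous[OF p]])
  have [measurable]: "(\<lambda>x. norm (f x - s i x)) \<in> borel_measurable M" for i
    by (rule borel_measurable_norm_diff_strongly[OF fm sm])
  have "ennreal (p (Bochner_Integration.simple_bochner_integral M (s i))) \<le>
     (\<integral>\<^sup>+x. p (f x) \<partial>M) + (\<integral>\<^sup>+x. ennreal (norm (f x - s i x)) \<partial>M)" for i
  proof -
    have "p (s i x) \<le> p (f x) + norm (f x - s i x)" for x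
      using contractive_seminorm_simps(4)[OF p, of "f x" "s i x"]
        contractive_seminormD(3)[OF p, of "f x - s i x"] by simp
    then have "(\<integral>\<^sup>+x. p (s i x) \<partial>M) \<le> (\<integral>\<^sup>+x. ennreal (p (f x)) + ennreal (norm (f x - s i x)) \<partial>M)"
      by (intro nn_integral_mono)
         (simp add: ennreal_leI contractive_seminorm_simps(3)[OF p] flip: ennreal_plus)
    also have "\<dots> = (\<integral>\<^sup>+x. p (f x) \<partial>M) + (\<integral>\<^sup>+x. ennreal (norm (f x - s i x)) \<partial>M)"
      by (rule nn_integral_add) measurable
    finally show ?thesis
      using simple_bochner_integral_seminorm_le[OF p s(1)[of i]] by (rule order_trans[rotated])
  qed
  moreover have "(\<lambda>i. ennreal (p (Bochner_Integration.simple_bochner_integral M (s i)))) \<longlonglongrightarrow> ennreal (p y)"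
    by (intro tendsto_ennrealI continuous_on_tendsto_compose[OF contractive_seminorm_continuous[OF p] s(3)]) auto
  moreover have "(\<lambda>i. (\<integral>\<^sup>+x. p (f x) \<partial>M) + (\<integral>\<^sup>+x. ennreal (norm (f x - s i x)) \<partial>M))
     \<longlonglongrightarrow> (\<integral>\<^sup>+x. p (f x) \<partial>M) + 0"
    by (intro tendsto_intros s)
  ultimately show ?thesis
    by (intro LIMSEQ_le[where X="\<lambda>i. ennreal (p (Bochner_Integration.simple_bochner_integral M (s i)))"]) auto
qed

lemma (in complete_measure) has_strong_integral_linear_combination:
  assumes "has_strong_integral M f y" "has_strong_integral M g z"
  shows "has_strong_integral M (\<lambda>x. a *\<^sub>R f x + b *\<^sub>R g x) (a *\<^sub>R y + b *\<^sub>R z)"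
proof -
  let ?sb = "Bochner_Integration.simple_bochner_integral M"
  obtain s where fm: "strongly_measurable M f"
    and s: "\<And>i::nat. Bochner_Integration.simple_bochner_integrable M (s i)"
    "(\<lambda>i. \<integral>\<^sup>+x. ennreal (norm (f x - s i x)) \<partial>M) \<longlonglongrightarrow> 0" "(\<lambda>i. ?sb (s i)) \<longlonglongrightarrow> y"
    using assms unfolding has_strong_integral_def by blast
  obtain t where gm: "strongly_measurable M g"
    and t: "\<And>i::nat. Bochner_Integration.simple_bochner_integrable M (t i)"
    "(\<lambda>i. \<integral>\<^sup>+x. ennreal (norm (g x - t i x)) \<partial>M) \<longlonglongrightarrow> 0" "(\<lambda>i. ?sb (t i)) \<longlonglongrightarrow> z"
    using assms unfolding has_strong_integral_def by blast
  have sm: "strongly_measurable M (s i)" for i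
    by (rule simple_bochner_integrable_imp_strongly_measurable[OF s(1)])
  have tm: "strongly_measurable M (t i)" for i
    by (rule simple_bochner_integrable_imp_strongly_measurable[OF t(1)])
  have [measurable]: "(\<lambda>x. norm (f x - s i x)) \<in> borel_measurable M" for i
    by (rule borel_measurable_norm_diff_strongly[OF fm sm])
  have [measurable]: "(\<lambda>x. norm (g x - t i x)) \<in> borel_measurable M" for i
    by (rule borel_measurable_norm_diff_strongly[OF gm tm])
  show ?thesis
    unfolding has_strong_integral_def
  proof (intro conjI exI allI)
    show "strongly_measurable M (\<lambda>x. a *\<^sub>R f x + b *\<^sub>R g x)"
      by (rule strongly_measurable_linear_combination[OF fm gm])
    have as: "Bochner_Integration.simple_bochner_integrable M (\<lambda>x. a *\<^sub>R s i x)" for i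
      using Bochner_Integration.simple_bochner_integrable_compose2[of "\<lambda>x y. a *\<^sub>R x", OF _ s(1) s(1)] by simp
    have bt: "Bochner_Integration.simple_bochner_integrable M (\<lambda>x. b *\<^sub>R t i x)" for i
      using Bochner_Integration.simple_bochner_integrable_compose2[of "\<lambda>x y. b *\<^sub>R x", OF _ t(1) t(1)] by simp
    show "Bochner_Integration.simple_bochner_integrable M (\<lambda>x. a *\<^sub>R s i x + b *\<^sub>R t i x)" for i
      using Bochner_Integration.simple_bochner_integrable_compose2[of "(+)", OF _ as bt] by simp
    have "?sb (\<lambda>x. a *\<^sub>R s i x + b *\<^sub>R t i x) = a *\<^sub>R ?sb (s i) + b *\<^sub>R ?sb (t i)" for i
      using Bochner_Integration.simple_bochner_integral_add[OF as bt]
        Bochner_Integration.simple_bochner_integral_linear[OF linear_scale_self s(1)]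
        Bochner_Integration.simple_bochner_integral_linear[OF linear_scale_self t(1)] by metis
    then show "(\<lambda>i. ?sb (\<lambda>x. a *\<^sub>R s i x + b *\<^sub>R t i x)) \<longlonglongrightarrow> a *\<^sub>R y + b *\<^sub>R z"
      by (simp only:) (intro tendsto_intros s t)
    define D where "D i = (\<integral>\<^sup>+x. ennreal (norm (a *\<^sub>R f x + b *\<^sub>R g x - (a *\<^sub>R s i x + b *\<^sub>R t i x))) \<partial>M)" for i
    define B where "B i = ennreal \<bar>a\<bar> * (\<integral>\<^sup>+x. ennreal (norm (f x - s i x)) \<partial>M) + ennreal \<bar>b\<bar> * (\<integral>\<^sup>+x. ennreal (norm (g x - t i x)) \<partial>M)" for i
    have DB: "D i \<le> B i" for i
    proof -
      have "norm (a *\<^sub>R f x + b *\<^sub>R g x - (a *\<^sub>R s i x + b *\<^sub>R t i x)) \<le> \<bar>a\<bar> * norm (f x - s i x) + \<bar>b\<bar> * norm (g x - t i x)" for x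
      proof -
        have "a *\<^sub>R f x + b *\<^sub>R g x - (a *\<^sub>R s i x + b *\<^sub>R t i x) =
            a *\<^sub>R (f x - s i x) + b *\<^sub>R (g x - t i x)"
          by (simp add: algebra_simps)
        then show ?thesis
          using norm_triangle_ineq[of "a *\<^sub>R (f x - s i x)" "b *\<^sub>R (g x - t i x)"] by simp
      qed
      then have "(\<integral>\<^sup>+x. ennreal (norm (a *\<^sub>R f x + b *\<^sub>R g x - (a *\<^sub>R s i x + b *\<^sub>R t i x))) \<partial>M) \<le>
        (\<integral>\<^sup>+x. ennreal \<bar>a\<bar> * ennreal (norm (f x - s i x)) + ennreal \<bar>b\<bar> * ennreal (norm (g x - t i x)) \<partial>M)"
        by (intro nn_integral_mono) (simp add: ennreal_leI flip: ennreal_plus ennreal_mult)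
      then show ?thesis
        by (simp add: D_def B_def nn_integral_add nn_integral_cmult)
    qed
    have "(\<lambda>i. ennreal \<bar>a\<bar> * (\<integral>\<^sup>+x. ennreal (norm (f x - s i x)) \<partial>M) +
        ennreal \<bar>b\<bar> * (\<integral>\<^sup>+x. ennreal (norm (g x - t i x)) \<partial>M)) \<longlonglongrightarrow> ennreal \<bar>a\<bar> * 0 + ennreal \<bar>b\<bar> * 0"
      by (rule tendsto_add[OF ennreal_tendsto_cmult[OF _ s(2)] ennreal_tendsto_cmult[OF _ t(2)]]) simp_all
    then have "B \<longlonglongrightarrow> 0" by (simp add: B_def[abs_def])
    then have "D \<longlonglongrightarrow> 0"
      by (rule tendsto_sandwich[OF _ _ tendsto_const, rotated 2]) (simp_all add: DB)
    then show "(\<lambda>i. \<integral>\<^sup>+x. ennreal (norm (a *\<^sub>R f x + b *\<^sub>R g x - (a *\<^sub>R s i x + b *\<^sub>R t i x))) \<partial>M) \<longlonglongrightarrow> 0"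
      by (simp add: D_def[abs_def])
  qed
qed

text \<open>
  The integral of \<open>f - f\<close> can only be zero, by the norm bound.
\<close>

lemma (in complete_measure) has_strong_integral_unique:
  assumes "has_strong_integral M f y" "has_strong_integral M f z"
  shows "y = z"
proof -
  have "has_strong_integral M (\<lambda>x. 1 *\<^sub>R f x + (-1) *\<^sub>R f x) (1 *\<^sub>R y + (-1) *\<^sub>R z)"
    using has_strong_integral_linear_combination[OF assms] .
  from has_strong_integral_seminorm_le[OF contractive_seminorm_norm this] show ?thesis by simp
qed

lemma (in complete_measure) strong_integral_eqI:
  "has_strong_integral M f y \<Longrightarrow> strong_integral M f = y"
  unfolding strong_integral_def using has_strong_integral_unique by (metis the_equality)

lemma (in complete_measure) has_strong_integral_exists:
  fixes f :: "'a \<Rightarrow> 'b::banach"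
  assumes f: "strongly_measurable M f" and fin: "(\<integral>\<^sup>+x. norm (f x) \<partial>M) < \<infinity>"
  shows "\<exists>y. has_strong_integral M f y"
proof -
  let ?sb = "Bochner_Integration.simple_bochner_integral M"
  obtain s where s: "\<And>i::nat. Bochner_Integration.simple_bochner_integrable M (s i)"
    "(\<lambda>i. \<integral>\<^sup>+x. ennreal (norm (f x - s i x)) \<partial>M) \<longlonglongrightarrow> 0"
    using strongly_integrable_simple_approx[OF assms] by blast
  have sm: "strongly_measurable M (s i)" for i
    by (rule simple_bochner_integrable_imp_strongly_measurable[OF s(1)])
  have [measurable]: "(\<lambda>x. norm (f x - s i x)) \<in> borel_measurable M" for i
    by (rule borel_measurable_norm_diff_strongly[OF f sm])
  have bd: "ennreal (norm (?sb (s i) - ?sb (s j))) \<le>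
      (\<integral>\<^sup>+x. ennreal (norm (f x - s i x)) \<partial>M) + (\<integral>\<^sup>+x. ennreal (norm (f x - s j x)) \<partial>M)" for i j
  proof -
    have ij: "Bochner_Integration.simple_bochner_integrable M (\<lambda>x. s i x - s j x)"
      using Bochner_Integration.simple_bochner_integrable_compose2[of "(-)", OF _ s(1) s(1)] by simp
    have "ennreal (norm (?sb (s i) - ?sb (s j))) \<le> (\<integral>\<^sup>+x. ennreal (norm (s i x - s j x)) \<partial>M)"
      using simple_bochner_integral_seminorm_le[OF contractive_seminorm_norm ij]
        Bochner_Integration.simple_bochner_integral_diff[OF s(1) s(1)] by metis
    also have "\<dots> \<le> (\<integral>\<^sup>+x. ennreal (norm (f x - s i x)) + ennreal (norm (f x - s j x)) \<partial>M)"
    proof (intro nn_integral_mono)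
      fix x show "ennreal (norm (s i x - s j x)) \<le> ennreal (norm (f x - s i x)) + ennreal (norm (f x - s j x))"
        using norm_triangle_ineq4[of "f x - s j x" "f x - s i x"]
        by (simp add: ennreal_leI flip: ennreal_plus)
    qed
    also have "\<dots> = (\<integral>\<^sup>+x. ennreal (norm (f x - s i x)) \<partial>M) + (\<integral>\<^sup>+x. ennreal (norm (f x - s j x)) \<partial>M)"
      by (rule nn_integral_add) measurable
    finally show ?thesis .
  qed
  have "Cauchy (\<lambda>i. ?sb (s i))"
  proof (rule metric_CauchyI)
    fix e :: real assume "0 < e"
    then have "eventually (\<lambda>i. (\<integral>\<^sup>+x. ennreal (norm (f x - s i x)) \<partial>M) < ennreal (e/2)) sequentially"
      using order_tendstoD(2)[OF s(2)] by simp
    then obtain n where n: "\<And>i. i \<ge> n \<Longrightarrow> (\<integral>\<^sup>+x. ennreal (norm (f x - s i x)) \<partial>M) < ennreal (e/2)"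
      unfolding eventually_sequentially by blast
    have "dist (?sb (s i)) (?sb (s j)) < e" if "i \<ge> n" "j \<ge> n" for i j
    proof -
      have "ennreal (norm (?sb (s i) - ?sb (s j))) < ennreal (e/2) + ennreal (e/2)"
        using bd n[OF that(1)] n[OF that(2)] by (meson add_strict_mono le_less_trans)
      also have "\<dots> = ennreal e" using \<open>0 < e\<close> by (simp flip: ennreal_plus)
      finally show ?thesis using \<open>0 < e\<close> by (simp add: dist_norm ennreal_less_iff)
    qed
    then show "\<exists>n. \<forall>i\<ge>n. \<forall>j\<ge>n. dist (?sb (s i)) (?sb (s j)) < e" by blast
  qed
  then obtain y where "(\<lambda>i. ?sb (s i)) \<longlonglongrightarrow> y"
    using Cauchy_convergent convergent_def by blast
  with f s show ?thesis unfolding has_strong_integral_def by blast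
qed


lemma has_strong_integral_restrict_space:
  assumes O: "\<Omega> \<inter> space M \<in> sets M" and f: "strongly_measurable M f"
    and h: "has_strong_integral (restrict_space M \<Omega>) f y"
  shows "has_strong_integral M (\<lambda>x. indicator \<Omega> x *\<^sub>R f x) y"
proof -
  obtain s where s: "\<And>i::nat. Bochner_Integration.simple_bochner_integrable (restrict_space M \<Omega>) (s i)"
    "(\<lambda>i. \<integral>\<^sup>+x. ennreal (norm (f x - s i x)) \<partial>restrict_space M \<Omega>) \<longlonglongrightarrow> 0"
    "(\<lambda>i. Bochner_Integration.simple_bochner_integral (restrict_space M \<Omega>) (s i)) \<longlonglongrightarrow> y"
    using h unfolding has_strong_integral_def by blast
  have eq: "(\<integral>\<^sup>+x. ennreal (norm (f x - s i x)) \<partial>restrict_space M \<Omega>) =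
      (\<integral>\<^sup>+x. ennreal (norm (indicator \<Omega> x *\<^sub>R f x - indicator \<Omega> x *\<^sub>R s i x)) \<partial>M)" for i
    by (subst nn_integral_restrict_space[OF O])
       (auto intro!: nn_integral_cong split: split_indicator)
  let ?s = "\<lambda>i x. (indicator \<Omega> x :: real) *\<^sub>R s i x"
  show ?thesis
    unfolding has_strong_integral_def
  proof (intro conjI exI[of _ ?s] allI)
    show "strongly_measurable M (\<lambda>x. indicator \<Omega> x *\<^sub>R f x)"
      by (rule strongly_measurable_indicator_scaleR[OF f O])
    show "Bochner_Integration.simple_bochner_integrable M (?s i)" for i
      using s(1)[of i] unfolding Bochner_Integration.simple_bochner_integrable_restrict_space[OF O] .
    show "(\<lambda>i. \<integral>\<^sup>+x. ennreal (norm (indicator \<Omega> x *\<^sub>R f x - ?s i x)) \<partial>M) \<longlonglongrightarrow> 0"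
      using s(2) unfolding eq .
    show "(\<lambda>i. Bochner_Integration.simple_bochner_integral M (?s i)) \<longlonglongrightarrow> y"
      using s(3) unfolding Bochner_Integration.simple_bochner_integral_restrict_space[OF O s(1)] .
  qed
qed

lemma strongly_measurable_restrict_space:
  assumes "strongly_measurable M f" and O: "\<Omega> \<inter> space M \<in> sets M"
  shows "strongly_measurable (restrict_space M \<Omega>) f"
proof -
  obtain s where s: "\<And>i::nat. simple_function M (s i)" "AE x in M. (\<lambda>i. s i x) \<longlonglongrightarrow> f x"
    using assms unfolding strongly_measurable_def by blast
  have "simple_function M (indicator (\<Omega> \<inter> space M) :: _ \<Rightarrow> real)"
    by (rule simple_function_indicator[OF O])
  then have ind: "simple_function M (indicator \<Omega> :: _ \<Rightarrow> real)"
    by (rule simple_function_cong[THEN iffD1, rotated]) (auto split: split_indicator)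
  have "simple_function (restrict_space M \<Omega>) (s i)" for i
    unfolding simple_function_restrict_space[OF O]
    by (rule simple_function_compose2[OF ind s(1)])
  then show ?thesis
    unfolding strongly_measurable_def using s(2)
    by (intro exI[of _ s] conjI allI) (auto simp: AE_restrict_space_iff[OF O])
qed

section \<open>Norming functionals on finite-dimensional subspaces\<close>

text \<open>
  The Hahn-Banach theorem is obtained from minimal elements among the sublinear functionals, which turn
  out to be linear.
\<close>

definition sublinear :: "('a::real_vector \<Rightarrow> real) \<Rightarrow> bool" where
  "sublinear p \<longleftrightarrow> (\<forall>x y. p (x + y) \<le> p x + p y) \<and> (\<forall>c>0. \<forall>x. p (c *\<^sub>R x) = c * p x)"

lemma sublinearD:
  assumes "sublinear p"
  shows "p (x + y) \<le> p x + p y" "c > 0 \<Longrightarrow> p (c *\<^sub>R x) = c * p x" "p 0 = 0" "- p (- x) \<le> p x"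
proof -
  show A: "p (x + y) \<le> p x + p y" for x y
    using assms by (simp add: sublinear_def)
  show S: "c > 0 \<Longrightarrow> p (c *\<^sub>R x) = c * p x" for c x
    using assms by (simp add: sublinear_def)
  show Z: "p 0 = 0"
    using S[of 2 0] by simp
  show "- p (- x) \<le> p x"
    using A[of x "- x"] Z by simp
qed

lemma sublinearI:
  assumes "\<And>x y. p (x + y) \<le> p x + p y" and le: "\<And>c x. c > 0 \<Longrightarrow> p (c *\<^sub>R x) \<le> c * p x"
  shows "sublinear p"
  unfolding sublinear_def
proof (intro conjI allI impI)
  fix c :: real and x assume c: "c > 0"
  have "p x \<le> (1 / c) * p (c *\<^sub>R x)"
    using le[of "1 / c" "c *\<^sub>R x"] c by simp
  then have "c * p x \<le> p (c *\<^sub>R x)"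
    using c by (simp add: field_simps)
  with le[OF c, of x] show "p (c *\<^sub>R x) = c * p x" by simp
qed fact

lemma sublinear_chain_Inf:
  assumes ne: "C \<noteq> {}" and sub: "\<And>q. q \<in> C \<Longrightarrow> sublinear q" and le: "\<And>q. q \<in> C \<Longrightarrow> q \<le> p"
    and chain: "\<And>q r. q \<in> C \<Longrightarrow> r \<in> C \<Longrightarrow> q \<le> r \<or> r \<le> q"
  defines "u \<equiv> \<lambda>x. INF q\<in>C. q x"
  shows "sublinear u" and "\<And>q. q \<in> C \<Longrightarrow> u \<le> q"
proof -
  have "- p (- x) \<le> q x" if "q \<in> C" for q x
    using sublinearD(4)[OF sub[OF that], of x] le[OF that] by (metis le_funD minus_le_iff order_trans)
  then have bdd: "bdd_below ((\<lambda>q. q x) ` C)" for x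
    by (intro bdd_belowI2)
  then have lower: "u x \<le> q x" if "q \<in> C" for q x
    unfolding u_def using that by (intro cINF_lower)
  then show "\<And>q. q \<in> C \<Longrightarrow> u \<le> q" by (auto simp: le_fun_def)
  have greatest: "a \<le> u x" if "\<And>q. q \<in> C \<Longrightarrow> a \<le> q x" for a x
    unfolding u_def using that ne by (intro cINF_greatest)
  show "sublinear u"
  proof (rule sublinearI)
    fix x y
    have *: "u (x + y) \<le> q x + r y" if "q \<in> C" "r \<in> C" for q r
      using chain[OF that]
    proof
      assume "q \<le> r"
      then show ?thesis
        using lower[OF that(1), of "x + y"] sublinearD(1)[OF sub[OF that(1)], of x y] le_funD[of q r y] by linarith
    next
      assume "r \<le> q"
      then show ?thesis
        using lower[OF that(2), of "x + y"] sublinearD(1)[OF sub[OF that(2)], of x y] le_funD[of r q x] by linarith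
    qed
    have "u (x + y) - u x \<le> r y" if "r \<in> C" for r
    proof -
      have "u (x + y) - r y \<le> u x"
        by (rule greatest) (use *[OF _ that] in \<open>simp add: algebra_simps\<close>)
      then show ?thesis by simp
    qed
    then have "u (x + y) - u x \<le> u y" by (rule greatest)
    then show "u (x + y) \<le> u x + u y" by simp
  next
    fix c :: real and x assume c: "c > 0"
    have "u (c *\<^sub>R x) / c \<le> u x"
    proof (rule greatest)
      fix q assume q: "q \<in> C"
      then show "u (c *\<^sub>R x) / c \<le> q x"
        using lower[OF q, of "c *\<^sub>R x"] sublinearD(2)[OF sub[OF q] c, of x] c by (simp add: field_simps)
    qed
    then show "u (c *\<^sub>R x) \<le> c * u x" using c by (simp add: field_simps)
  qed
qed

lemma sublinear_minimal_exists:
  assumes p: "sublinear p"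
  obtains q where "sublinear q" "q \<le> p" "\<And>r. sublinear r \<Longrightarrow> r \<le> q \<Longrightarrow> r = q"
proof -
  define A where "A = {q. sublinear q \<and> q \<le> p}"
  have "\<exists>m\<in>A. \<forall>a\<in>A. m \<ge> a \<longrightarrow> a = m"
  proof (rule predicate_Zorn)
    show "partial_order_on A (relation_of (\<ge>) A)"
      by (auto simp: partial_order_on_def preorder_on_def relation_of_def refl_on_def trans_def antisym_def)
    fix C assume "C \<in> Chains (relation_of (\<ge>) A)"
    then have C: "C \<subseteq> A" "\<And>q r. q \<in> C \<Longrightarrow> r \<in> C \<Longrightarrow> q \<le> r \<or> r \<le> q"
      by (auto simp: Chains_def relation_of_def)
    show "\<exists>u\<in>A. \<forall>a\<in>C. a \<ge> u"
    proof (cases "C = {}")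
      case True
      then show ?thesis using p by (intro bexI[of _ p]) (auto simp: A_def)
    next
      case False
      let ?u = "\<lambda>x. INF q\<in>C. q x"
      have sub: "sublinear q" "q \<le> p" if "q \<in> C" for q
        using that C(1) by (auto simp: A_def)
      note u = sublinear_chain_Inf[OF False sub C(2)]
      obtain q where "q \<in> C" using False by blast
      then have "?u \<le> p" using u(2) sub(2) by (meson order_trans)
      with u show ?thesis
        by (intro bexI[of _ ?u]) (auto simp: A_def)
    qed
  qed
  then obtain m where "m \<in> A" "\<And>a. a \<in> A \<Longrightarrow> a \<le> m \<Longrightarrow> a = m" by blast
  then show thesis
    by (intro that[of m]) (auto simp: A_def)
qed

text \<open>
  The witness is the largest sublinear functional below \<open>p\<close> that is at most \<open>- p
  y\<close> at \<open>- y\<close>. It serves twice: to show that a minimal functional is additive, and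
  to prescribe the value of a linear functional at one vector.
\<close>

lemma sublinear_directional_reduction:
  assumes p: "sublinear p"
  obtains q where "sublinear q" "q \<le> p" "\<And>x t. t \<ge> 0 \<Longrightarrow> q x \<le> p (x + t *\<^sub>R y) - t * p y"
proof -
  define q where "q x = (INF t\<in>{0..}. p (x + t *\<^sub>R y) - t * p y)" for x
  have ty: "p (t *\<^sub>R y) = t * p y" if "t \<ge> 0" for t
    using sublinearD(2,3)[OF p] that by (cases "t = 0") auto
  have "- p (- x) \<le> p (x + t *\<^sub>R y) - t * p y" if "t \<ge> 0" for x t
    using sublinearD(1)[OF p, of "x + t *\<^sub>R y" "- x"] ty[OF that] by simp
  then have bdd: "bdd_below ((\<lambda>t. p (x + t *\<^sub>R y) - t * p y) ` {0..})" for x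
    by (intro bdd_belowI2[where m="- p (- x)"]) auto
  have lower: "q x \<le> p (x + t *\<^sub>R y) - t * p y" if "t \<ge> 0" for x t
    unfolding q_def using bdd that by (intro cINF_lower) auto
  have greatest: "a \<le> q x" if "\<And>t. t \<ge> 0 \<Longrightarrow> a \<le> p (x + t *\<^sub>R y) - t * p y" for a x
    unfolding q_def using that by (intro cINF_greatest) auto
  have "sublinear q"
  proof (rule sublinearI)
    fix x z
    have *: "q (x + z) \<le> (p (x + t *\<^sub>R y) - t * p y) + (p (z + s *\<^sub>R y) - s * p y)"
      if "t \<ge> 0" "s \<ge> 0" for s t
    proof -
      have "q (x + z) \<le> p ((x + z) + (t + s) *\<^sub>R y) - (t + s) * p y"
        using that by (intro lower) simp
      also have "(x + z) + (t + s) *\<^sub>R y = (x + t *\<^sub>R y) + (z + s *\<^sub>R y)"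
        by (simp add: algebra_simps)
      finally show ?thesis
        using sublinearD(1)[OF p, of "x + t *\<^sub>R y" "z + s *\<^sub>R y"] by (simp add: algebra_simps)
    qed
    have "q (x + z) - q x \<le> p (z + s *\<^sub>R y) - s * p y" if "s \<ge> 0" for s
    proof -
      have "q (x + z) - (p (z + s *\<^sub>R y) - s * p y) \<le> q x"
        by (rule greatest) (use *[OF _ that] in \<open>simp add: algebra_simps\<close>)
      then show ?thesis by simp
    qed
    then have "q (x + z) - q x \<le> q z" by (rule greatest)
    then show "q (x + z) \<le> q x + q z" by simp
  next
    fix c :: real and x assume c: "c > 0"
    have "q (c *\<^sub>R x) / c \<le> q x"
    proof (rule greatest)
      fix t :: real assume t: "t \<ge> 0"
      have "q (c *\<^sub>R x) \<le> p (c *\<^sub>R (x + t *\<^sub>R y)) - (c * t) * p y"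
        using lower[of "c * t" "c *\<^sub>R x"] c t by (simp add: scaleR_add_right)
      also have "\<dots> = c * (p (x + t *\<^sub>R y) - t * p y)"
        by (simp only: sublinearD(2)[OF p c]) (simp add: algebra_simps)
      finally show "q (c *\<^sub>R x) / c \<le> p (x + t *\<^sub>R y) - t * p y"
        using c by (simp add: field_simps)
    qed
    then show "q (c *\<^sub>R x) \<le> c * q x" using c by (simp add: field_simps)
  qed
  moreover have "q \<le> p" using lower[of 0] by (auto simp: le_fun_def)
  ultimately show thesis using lower that by blast
qed

text \<open>
  By minimality the reduction along \<open>y\<close> changes nothing, which says that \<open>q x + q y
  \<le> q (x + y)\<close>.
\<close>

lemma sublinear_minimal_linear:
  assumes q: "sublinear q" and min: "\<And>r. sublinear r \<Longrightarrow> r \<le> q \<Longrightarrow> r = q"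
  shows "linear q"
proof -
  have add: "q (x + y) = q x + q y" for x y
  proof -
    obtain r where "sublinear r" "r \<le> q" and r: "\<And>x t. t \<ge> 0 \<Longrightarrow> r x \<le> q (x + t *\<^sub>R y) - t * q y"
      using sublinear_directional_reduction[OF q, of y] by blast
    then have "r = q" using min by blast
    with r[of 1 x] sublinearD(1)[OF q, of x y] show ?thesis by simp
  qed
  have neg: "q (- x) = - q x" for x
    using add[of x "- x"] sublinearD(3)[OF q] by simp
  show ?thesis
  proof (rule linearI[OF add])
    fix c :: real and x
    consider "c > 0" | "c = 0" | "- c > 0" by linarith
    then show "q (c *\<^sub>R x) = c *\<^sub>R q x"
    proof cases
      case 3
      then show ?thesis using sublinearD(2)[OF q 3, of "- x"] neg by simp
    qed (use sublinearD(2,3)[OF q] in auto)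
  qed
qed

definition contractive_functional :: "('a::real_normed_vector \<Rightarrow> real) \<Rightarrow> bool" where
  "contractive_functional \<phi> \<longleftrightarrow> linear \<phi> \<and> (\<forall>x. \<bar>\<phi> x\<bar> \<le> norm x)"

lemma contractive_functionalD:
  assumes "contractive_functional \<phi>"
  shows "linear \<phi>" "\<bar>\<phi> x\<bar> \<le> norm x" "\<phi> (x + y) = \<phi> x + \<phi> y" "\<phi> (x - y) = \<phi> x - \<phi> y" "\<phi> (c *\<^sub>R x) = c * \<phi> x"
proof -
  show lin: "linear \<phi>" and "\<bar>\<phi> x\<bar> \<le> norm x"
    using assms by (simp_all add: contractive_functional_def)
  show "\<phi> (x + y) = \<phi> x + \<phi> y" "\<phi> (x - y) = \<phi> x - \<phi> y" "\<phi> (c *\<^sub>R x) = c * \<phi> x"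
    using linear_add[OF lin] linear_diff[OF lin] linear_scale[OF lin] by simp_all
qed

text \<open>
  A linear functional below the reduction of the norm along \<open>z\<close> takes at \<open>- z\<close>
  a value of at most \<open>- norm z\<close>.
\<close>

lemma norming_functional_exists:
  fixes z :: "'a::real_normed_vector"
  obtains \<phi> where "contractive_functional \<phi>" "\<phi> z = norm z"
proof -
  have "sublinear (norm :: 'a \<Rightarrow> real)"
    by (intro sublinearI) (auto simp: norm_triangle_ineq)
  then obtain p where p: "sublinear p" "p \<le> norm" and
    pz: "\<And>x t. t \<ge> 0 \<Longrightarrow> p x \<le> norm (x + t *\<^sub>R z) - t * norm z"
    using sublinear_directional_reduction[of norm z] by blast
  obtain q where q: "sublinear q" "q \<le> p" "\<And>r. sublinear r \<Longrightarrow> r \<le> q \<Longrightarrow> r = q"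
    using sublinear_minimal_exists[OF p(1)] by blast
  have lin: "linear q" by (rule sublinear_minimal_linear[OF q(1,3)])
  have le: "q x \<le> norm x" for x
    using q(2) p(2) by (metis le_funD order_trans)
  have ab: "\<bar>q x\<bar> \<le> norm x" for x
    using le[of x] le[of "- x"] linear_neg[OF lin, of x] by simp
  have "q (- z) \<le> p (- z)" using q(2) by (rule le_funD)
  also have "\<dots> \<le> - norm z" using pz[of 1 "- z"] by simp
  finally have "q z = norm z" using linear_neg[OF lin, of z] le[of z] by simp
  then show thesis using that[of q] lin ab by (simp add: contractive_functional_def)
qed

text \<open>
  An operator of finite rank that is the identity on the span of \<open>F\<close>; it is what makes the
  unit ball of that span totally bounded. To fix one more vector \<open>a\<close>, one adds a multiple
  of \<open>a - P a\<close> whose coefficient depends only on \<open>x - P x\<close>, so that vectors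
  already fixed stay fixed.
\<close>

lemma compact_operator_fixing_finite_set:
  fixes F :: "'a::real_normed_vector set"
  assumes "finite F"
  shows "\<exists>P::'a \<Rightarrow> 'a. bounded_linear P \<and> (\<forall>x\<in>F. P x = x) \<and>
    (\<exists>K. compact K \<and> (\<forall>x. norm x \<le> 1 \<longrightarrow> P x \<in> K))"
  using assms
proof (induction rule: finite_induct)
  case empty
  then show ?case
    by (intro exI[of _ "\<lambda>_. 0"]) (auto intro!: exI[of _ "{0}"] bounded_linear_zero)
next
  case (insert a F)
  then obtain P :: "'a \<Rightarrow> 'a" and K where P: "bounded_linear P" "\<And>x. x \<in> F \<Longrightarrow> P x = x"
    and K: "compact K" "\<And>x. norm x \<le> 1 \<Longrightarrow> P x \<in> K" by blast
  define z where "z = a - P a"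
  show ?case
  proof (cases "z = 0")
    case True
    then show ?thesis using P K by (intro exI[of _ P]) (auto simp: z_def)
  next
    case False
    obtain \<phi> where \<phi>: "contractive_functional \<phi>" "\<phi> z = norm z"
      using norming_functional_exists by blast
    note D = contractive_functionalD[OF \<phi>(1)]
    have blp: "bounded_linear \<phi>"
      by (rule bounded_linear_intro[where K=1]) (use D in auto)
    define c where "c x = \<phi> (x - P x) / norm z" for x
    have "bounded_linear (\<lambda>x. \<phi> (x - P x))"
      by (rule bounded_linear_compose[OF blp bounded_linear_sub[OF bounded_linear_ident P(1)]])
    then have blc: "bounded_linear c"
      unfolding c_def by (rule bounded_linear_compose[OF bounded_linear_divide])
    then obtain B where B: "\<And>x. norm (c x) \<le> norm x * B" "B \<ge> 0"
      using bounded_linear.nonneg_bounded by blast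
    define K' where "K' = {x + y |x y. x \<in> K \<and> y \<in> (\<lambda>r. r *\<^sub>R z) ` {-B..B}}"
    show ?thesis
    proof (intro exI conjI ballI allI impI)
      show "bounded_linear (\<lambda>x. P x + c x *\<^sub>R z)"
        by (rule bounded_linear_add[OF P(1) bounded_linear_compose[OF bounded_linear_scaleR_left blc]])
      show "P x + c x *\<^sub>R z = x" if "x \<in> insert a F" for x
      proof (cases "x = a")
        case True
        then show ?thesis using \<phi>(2) False by (simp add: c_def z_def)
      next
        case False
        then have "P x = x" using that P(2) by blast
        then show ?thesis using linear_0[OF D(1)] by (simp add: c_def)
      qed
      show "compact K'"
        unfolding K'_def by (intro compact_sums K(1) compact_continuous_image continuous_intros) auto
      show "P x + c x *\<^sub>R z \<in> K'" if "norm x \<le> 1" for x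
      proof -
        have "\<bar>c x\<bar> \<le> B"
          using B(1)[of x] mult_right_mono[OF that B(2)] by simp
        then show ?thesis
          unfolding K'_def using K(2)[OF that] by (fastforce simp: abs_le_iff)
      qed
    qed
  qed
qed

lemma infdist_greatest:
  "S \<noteq> {} \<Longrightarrow> (\<And>y. y \<in> S \<Longrightarrow> a \<le> dist x y) \<Longrightarrow> a \<le> infdist x S"
  by (simp add: infdist_notempty cINF_greatest)

text \<open>
  The unit sphere of the span lies in a compact set, and norming functionals of a finite
  \<open>1/4\<close>-net of that set recover at least half of the norm on the sphere. A general
  \<open>x\<close> is compared with a nearby element of the span; since the functionals have norm at
  most one, the error is a universal multiple of the distance.
\<close>

lemma finite_norming_on_span:
  fixes F :: "'a::real_normed_vector set"
  assumes "finite F"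
  obtains \<Phi> where "finite \<Phi>" "\<And>\<phi>. \<phi> \<in> \<Phi> \<Longrightarrow> contractive_functional \<phi>"
    "\<And>x. norm x \<le> 2 * (\<Sum>\<phi>\<in>\<Phi>. \<bar>\<phi> x\<bar>) + 3 * infdist x (span F)"
proof -
  obtain P :: "'a \<Rightarrow> 'a" and K where P: "bounded_linear P" "\<And>x. x \<in> F \<Longrightarrow> P x = x"
    and K: "compact K" "\<And>x. norm x \<le> 1 \<Longrightarrow> P x \<in> K"
    using compact_operator_fixing_finite_set[OF assms] by blast
  have fixP: "P x = x" if "x \<in> span F" for x
    by (rule linear_eq_on_span[OF bounded_linear.linear[OF P(1)] linear_ident _ that]) (rule P(2))
  obtain k where k: "finite k" "K \<subseteq> (\<Union>x\<in>k. ball x (1/4))"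
    using K(1) unfolding compact_eq_totally_bounded by (meson zero_less_divide_1_iff zero_less_numeral)
  obtain \<phi> where \<phi>: "\<And>x::'a. contractive_functional (\<phi> x)" "\<And>x. \<phi> x x = norm x"
    using norming_functional_exists by metis
  note D = contractive_functionalD[OF \<phi>(1)]
  have unit: "\<exists>x\<in>k. 1 \<le> 2 * \<bar>\<phi> x y\<bar>" if "y \<in> span F" "norm y = 1" for y
  proof -
    have "y \<in> K" using K(2)[of y] fixP that by simp
    then obtain x where x: "x \<in> k" "dist x y < 1/4" using k by auto
    have "norm x \<ge> 3/4"
      using norm_triangle_sub[of y x] x(2) that(2) by (simp add: dist_norm norm_minus_commute)
    moreover have "\<bar>\<phi> x (x - y)\<bar> \<le> 1/4"
      using D(2)[of x "x - y"] x(2) by (simp add: dist_norm)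
    ultimately have "1/2 \<le> \<phi> x y" using D(4)[of x x y] \<phi>(2)[of x] by linarith
    with x(1) show ?thesis by (intro bexI[of _ x]) auto
  qed
  have le: "\<exists>x\<in>insert 0 k. norm y \<le> 2 * \<bar>\<phi> x y\<bar>" if y: "y \<in> span F" for y
  proof -
    show "\<exists>x\<in>insert 0 k. norm y \<le> 2 * \<bar>\<phi> x y\<bar>"
    proof (cases "y = 0")
      case False
      have "(1 / norm y) *\<^sub>R y \<in> span F" using y by (rule span_scale)
      then obtain x where "x \<in> k" "1 \<le> 2 * \<bar>\<phi> x ((1 / norm y) *\<^sub>R y)\<bar>"
        using unit[of "(1 / norm y) *\<^sub>R y"] False by auto
      then show ?thesis using False D(5)[of x "1 / norm y" y]
        by (intro bexI[of _ x]) (auto simp: field_simps abs_mult)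
    qed auto
  qed
  show thesis
  proof (rule that[of "\<phi> ` insert 0 k"])
    show "finite (\<phi> ` insert 0 k)" using k(1) by simp
    show "contractive_functional \<psi>" if "\<psi> \<in> \<phi> ` insert 0 k" for \<psi> using that \<phi>(1) by blast
    fix x
    define S where "S = (\<Sum>\<psi>\<in>\<phi> ` insert 0 k. \<bar>\<psi> x\<bar>)"
    have "(norm x - 2 * S) / 3 \<le> dist x y" if y: "y \<in> span F" for y
    proof -
      obtain w where w: "w \<in> insert 0 k" "norm y \<le> 2 * \<bar>\<phi> w y\<bar>" using le[OF y] by blast
      have "\<bar>\<phi> w x\<bar> \<le> S"
        unfolding S_def using k(1) w(1) by (intro member_le_sum[of "\<phi> w" _ "\<lambda>\<psi>. \<bar>\<psi> x\<bar>"]) auto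
      \<comment> \<open>Here the bound by one of the functionals enters.\<close>
      moreover have "\<bar>\<phi> w y\<bar> \<le> \<bar>\<phi> w x\<bar> + dist x y"
        using D(2)[of w "x - y"] D(4)[of w x y] by (simp add: dist_norm)
      moreover have "norm x \<le> norm y + dist x y"
        using norm_triangle_sub[of x y] by (simp add: dist_norm)
      ultimately show ?thesis using w(2) by simp
    qed
    then have "(norm x - 2 * S) / 3 \<le> infdist x (span F)"
      using span_zero[of F] by (intro infdist_greatest) auto
    then show "norm x \<le> 2 * (\<Sum>\<psi>\<in>\<phi> ` insert 0 k. \<bar>\<psi> x\<bar>) + 3 * infdist x (span F)" by (simp add: S_def)
  qed
qed

lemma contractive_seminorm_infdist_subspace:
  fixes S :: "'a::real_normed_vector set"
  assumes S: "subspace S"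
  shows "contractive_seminorm (\<lambda>x. infdist x S)"
proof -
  have ne: "S \<noteq> {}" using subspace_0[OF S] by blast
  have greatest: "a \<le> infdist x S" if "\<And>y. y \<in> S \<Longrightarrow> a \<le> norm (x - y)" for a x
    using that ne by (intro infdist_greatest) (auto simp: dist_norm)
  have lower: "infdist x S \<le> norm (x - y)" if "y \<in> S" for x y
    using infdist_le[OF that] by (simp add: dist_norm)
  have scale_le: "infdist (c *\<^sub>R x) S \<le> \<bar>c\<bar> * infdist x S" if "c \<noteq> 0" for c x
  proof -
    have "infdist (c *\<^sub>R x) S / \<bar>c\<bar> \<le> infdist x S"
    proof (rule greatest)
      fix y assume "y \<in> S"
      then have "infdist (c *\<^sub>R x) S \<le> norm (c *\<^sub>R x - c *\<^sub>R y)"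
        using S by (intro lower) (simp add: subspace_scale)
      also have "\<dots> = \<bar>c\<bar> * norm (x - y)" by (metis norm_scaleR scaleR_diff_right)
      finally show "infdist (c *\<^sub>R x) S / \<bar>c\<bar> \<le> norm (x - y)"
        using that by (simp add: field_simps)
    qed
    then show ?thesis using that by (simp add: field_simps)
  qed
  show ?thesis
    unfolding contractive_seminorm_def
  proof (intro conjI allI)
    fix x y :: 'a
    have *: "infdist (x + y) S \<le> norm (x - a) + norm (y - b)" if "a \<in> S" "b \<in> S" for a b
    proof -
      have "infdist (x + y) S \<le> norm ((x + y) - (a + b))"
        using S that by (intro lower) (simp add: subspace_add)
      also have "\<dots> \<le> norm (x - a) + norm (y - b)" by (rule norm_diff_triangle_ineq)
      finally show ?thesis .
    qed
    have "infdist (x + y) S - infdist x S \<le> norm (y - b)" if "b \<in> S" for b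
    proof -
      have "infdist (x + y) S - norm (y - b) \<le> infdist x S"
        by (rule greatest) (use *[OF _ that] in \<open>simp add: algebra_simps\<close>)
      then show ?thesis by simp
    qed
    then have "infdist (x + y) S - infdist x S \<le> infdist y S" by (rule greatest)
    then show "infdist (x + y) S \<le> infdist x S + infdist y S" by simp
  next
    fix c :: real and x :: 'a
    show "infdist (c *\<^sub>R x) S = \<bar>c\<bar> * infdist x S"
    proof (cases "c = 0")
      case True
      then show ?thesis using subspace_0[OF S] by simp
    next
      case False
      have "infdist x S \<le> \<bar>1 / c\<bar> * infdist (c *\<^sub>R x) S"
        using scale_le[of "1 / c" "c *\<^sub>R x"] False by simp
      then show ?thesis using scale_le[OF False, of x] False by (simp add: field_simps)
    qed
  next
    fix x :: 'a
    show "infdist x S \<le> norm x" using lower[OF subspace_0[OF S], of x] by simp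
  qed
qed

lemma norming_sequence_exists:
  fixes F :: "nat \<Rightarrow> 'a::real_normed_vector set"
  assumes "\<And>n. finite (F n)"
  obtains \<phi> :: "nat \<Rightarrow> 'a \<Rightarrow> real" and m :: "nat \<Rightarrow> nat"
  where "\<And>i. contractive_functional (\<phi> i)"
    "\<And>n x. norm x \<le> 2 * (\<Sum>i<m n. \<bar>\<phi> i x\<bar>) + 3 * infdist x (span (F n))"
proof -
  have "\<exists>\<Phi>. finite \<Phi> \<and> (\<forall>\<phi>\<in>\<Phi>. contractive_functional \<phi>) \<and>
      (\<forall>x. norm x \<le> 2 * (\<Sum>\<phi>\<in>\<Phi>. \<bar>\<phi> x\<bar>) + 3 * infdist x (span (F n)))" for n
    by (rule finite_norming_on_span[OF assms[of n]]) blast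
  then have "\<exists>\<Phi>. \<forall>n. finite (\<Phi> n) \<and> (\<forall>\<phi>\<in>\<Phi> n. contractive_functional \<phi>) \<and>
      (\<forall>x. norm x \<le> 2 * (\<Sum>\<phi>\<in>\<Phi> n. \<bar>\<phi> x\<bar>) + 3 * infdist x (span (F n)))"
    by (intro choice allI)
  then obtain \<Phi> where \<Phi>: "\<And>n. finite (\<Phi> n)" "\<And>n \<phi>. \<phi> \<in> \<Phi> n \<Longrightarrow> contractive_functional \<phi>"
    "\<And>n x. norm x \<le> 2 * (\<Sum>\<phi>\<in>\<Phi> n. \<bar>\<phi> x\<bar>) + 3 * infdist x (span (F n))"
    by blast
  define U where "U = insert (\<lambda>_. 0) (\<Union>n. \<Phi> n)"
  have U: "countable U" "U \<noteq> {}"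
    unfolding U_def using \<Phi>(1) by (auto intro: countable_finite)
  define \<phi> where "\<phi> = from_nat_into U"
  have "\<exists>m. \<Phi> n \<subseteq> \<phi> ` {..<m}" for n
  proof -
    have "\<Phi> n \<subseteq> range \<phi>"
      using range_from_nat_into[OF U(2,1)] by (auto simp: \<phi>_def U_def)
    from finite_subset_image[OF \<Phi>(1) this] obtain I where "finite I" "\<Phi> n = \<phi> ` I"
      by auto
    moreover then obtain m where "I \<subseteq> {..<m}"
      using finite_nat_iff_bounded by blast
    ultimately show ?thesis by blast
  qed
  then obtain m where m: "\<And>n. \<Phi> n \<subseteq> \<phi> ` {..<m n}" by metis
  show thesis
  proof (rule that[of \<phi> m])
    show "contractive_functional (\<phi> i)" for i
      using from_nat_into[OF U(2), of i] \<Phi>(2)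
      by (auto simp: \<phi>_def U_def contractive_functional_def intro: linear_zero)
    fix n x
    have "(\<Sum>\<psi>\<in>\<Phi> n. \<bar>\<psi> x\<bar>) \<le> (\<Sum>\<psi>\<in>\<phi> ` {..<m n}. \<bar>\<psi> x\<bar>)"
      by (rule sum_mono2) (use m in auto)
    also have "\<dots> \<le> (\<Sum>i<m n. \<bar>\<phi> i x\<bar>)"
      using sum_image_le[of "{..<m n}" "\<lambda>\<psi>. \<bar>\<psi> x\<bar>" \<phi>] by (simp add: o_def)
    finally show "norm x \<le> 2 * (\<Sum>i<m n. \<bar>\<phi> i x\<bar>) + 3 * infdist x (span (F n))"
      using \<Phi>(3)[of x n] by linarith
  qed
qed

text \<open>
  A Hilbertian substitute for the norm: \<open>\<psi> x = \<Sum>\<^sub>i 2\<^sup>-\<^sup>i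
  (\<phi>\<^sub>i x)\<^sup>2\<close>. It satisfies the parallelogram law, and up to the seminorm
  \<open>p n\<close> it controls the norm, with a constant \<open>K\<close> that may depend on
  \<open>n\<close>.
\<close>

lemma quadratic_control_exists:
  fixes \<phi> :: "nat \<Rightarrow> 'a::real_normed_vector \<Rightarrow> real"
  assumes \<phi>: "\<And>i. contractive_functional (\<phi> i)"
    and ctl: "\<And>n x. norm x \<le> 2 * (\<Sum>i<m n. \<bar>\<phi> i x\<bar>) + 3 * p n x" and p: "\<And>n x. 0 \<le> p n x"
  obtains \<psi> :: "'a \<Rightarrow> real" where "continuous_on UNIV \<psi>" "\<And>x. 0 \<le> \<psi> x" "\<And>x. \<psi> x \<le> 2 * (norm x)\<^sup>2"
    "\<And>x y. \<psi> ((1/2) *\<^sub>R x + (1/2) *\<^sub>R y) + \<psi> (x - y) / 4 = \<psi> x / 2 + \<psi> y / 2"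
    "\<And>n. \<exists>K\<ge>0. \<forall>x. (norm x)\<^sup>2 \<le> K * \<psi> x + 18 * (p n x)\<^sup>2"
proof -
  note D = contractive_functionalD[OF \<phi>]
  define \<psi> where "\<psi> x = (\<Sum>i. (1/2)^i * (\<phi> i x)\<^sup>2)" for x
  have sq: "(\<phi> i x)\<^sup>2 \<le> (norm x)\<^sup>2" for i x
    using D(2)[of i x] by (metis abs_norm_cancel abs_le_square_iff)
  have gs: "(\<lambda>i. (1/2)^i * c) sums (2 * c)" for c :: real
    using sums_mult2[OF geometric_sums[of "1/2::real"]] by simp
  have summ: "summable (\<lambda>i. (1/2)^i * (\<phi> i x)\<^sup>2)" for x
    by (rule summable_comparison_test'[OF sums_summable[OF gs[of "(norm x)\<^sup>2"]], of 0])
       (simp add: sq)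
  have nn: "0 \<le> \<psi> x" for x
    unfolding \<psi>_def by (intro suminf_nonneg summ) simp
  have up: "\<psi> x \<le> 2 * (norm x)\<^sup>2" for x
    unfolding \<psi>_def sums_unique[OF gs] by (intro suminf_le summ sums_summable[OF gs] mult_left_mono sq) simp
  have trm: "(\<phi> i x)\<^sup>2 \<le> 2^i * \<psi> x" for i x
  proof -
    have "(\<Sum>j\<in>{i}. (1/2)^j * (\<phi> j x)\<^sup>2) \<le> \<psi> x"
      unfolding \<psi>_def by (intro sum_le_suminf summ) auto
    then show ?thesis by (simp add: field_simps)
  qed
  have par: "\<psi> ((1/2) *\<^sub>R x + (1/2) *\<^sub>R y) + \<psi> (x - y) / 4 = \<psi> x / 2 + \<psi> y / 2" for x y
  proof -
    have "(\<lambda>i. (1/2)^i * (\<phi> i x)\<^sup>2) sums \<psi> x" for x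
      unfolding \<psi>_def using summ by (rule summable_sums)
    note s = this
    have "(1/2)^i * (\<phi> i ((1/2) *\<^sub>R x + (1/2) *\<^sub>R y))\<^sup>2 + ((1/2)^i * (\<phi> i (x - y))\<^sup>2) / 4 =
        ((1/2)^i * (\<phi> i x)\<^sup>2) / 2 + ((1/2)^i * (\<phi> i y)\<^sup>2) / 2" for i
      by (simp add: D field_simps power2_eq_square)
    then show ?thesis
      using sums_add[OF s[of "(1/2) *\<^sub>R x + (1/2) *\<^sub>R y"] sums_divide[OF s[of "x - y"], of 4]]
        sums_add[OF sums_divide[OF s[of x], of 2] sums_divide[OF s[of y], of 2]]
      by (simp add: sums_unique2)
  qed
  have diff: "\<bar>\<psi> x - \<psi> y\<bar> \<le> 2 * (norm (x - y) * norm (x + y))" for x y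
  proof -
    have "\<bar>(1/2)^i * (\<phi> i x)\<^sup>2 - (1/2)^i * (\<phi> i y)\<^sup>2\<bar> \<le> (1/2)^i * (norm (x - y) * norm (x + y))" for i
    proof -
      have "(\<phi> i x)\<^sup>2 - (\<phi> i y)\<^sup>2 = \<phi> i (x - y) * \<phi> i (x + y)"
        by (simp add: D algebra_simps power2_eq_square)
      then have "\<bar>(\<phi> i x)\<^sup>2 - (\<phi> i y)\<^sup>2\<bar> \<le> norm (x - y) * norm (x + y)"
        by (auto simp: abs_mult intro!: mult_mono D)
      then show ?thesis by (simp add: abs_mult flip: right_diff_distrib)
    qed
    note le = this
    have sm: "summable (\<lambda>i. \<bar>(1/2)^i * (\<phi> i x)\<^sup>2 - (1/2)^i * (\<phi> i y)\<^sup>2\<bar>)"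
      by (rule summable_comparison_test'[OF sums_summable[OF gs], of 0]) (use le in auto)
    have "\<bar>\<psi> x - \<psi> y\<bar> = \<bar>\<Sum>i. (1/2)^i * (\<phi> i x)\<^sup>2 - (1/2)^i * (\<phi> i y)\<^sup>2\<bar>"
      unfolding \<psi>_def using suminf_diff[OF summ summ] by simp
    also have "\<dots> \<le> (\<Sum>i. \<bar>(1/2)^i * (\<phi> i x)\<^sup>2 - (1/2)^i * (\<phi> i y)\<^sup>2\<bar>)"
      by (rule summable_rabs[OF sm])
    also have "\<dots> \<le> 2 * (norm (x - y) * norm (x + y))"
      unfolding sums_unique[OF gs] by (intro suminf_le le sm sums_summable[OF gs])
    finally show ?thesis .
  qed
  have cont: "continuous_on UNIV \<psi>"
    unfolding continuous_on_eq_continuous_at[OF open_UNIV] isCont_def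
  proof
    fix y :: 'a
    have "((\<lambda>x. 2 * (norm (x - y) * norm (x + y))) \<longlongrightarrow> 2 * (norm (y - y) * norm (y + y))) (at y)"
      by (intro tendsto_intros)
    then have "((\<lambda>x. 2 * (norm (x - y) * norm (x + y))) \<longlongrightarrow> 0) (at y)" by simp
    then have "((\<lambda>x. \<psi> x - \<psi> y) \<longlongrightarrow> 0) (at y)"
      by (rule Lim_null_comparison[rotated]) (use diff in \<open>auto intro!: always_eventually\<close>)
    then show "\<psi> \<midarrow>y\<rightarrow> \<psi> y" by (simp add: LIM_zero_iff)
  qed
  have ctl2: "\<exists>K\<ge>0. \<forall>x. (norm x)\<^sup>2 \<le> K * \<psi> x + 18 * (p n x)\<^sup>2" for n
  proof (intro exI[of _ "8 * (real (m n) * (\<Sum>i<m n. 2^i))"] conjI allI)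
    fix x
    let ?S = "\<Sum>i<m n. \<bar>\<phi> i x\<bar>"
    have "?S\<^sup>2 \<le> real (m n) * (\<Sum>i<m n. (\<bar>\<phi> i x\<bar>)\<^sup>2)"
      using sum_squared_le_sum_of_squares[of "\<lambda>i. \<bar>\<phi> i x\<bar>" "{..<m n}"] by (simp add: mult.commute)
    also have "\<dots> \<le> real (m n) * (\<Sum>i<m n. 2^i * \<psi> x)"
      by (intro mult_left_mono sum_mono) (use trm in auto)
    finally have S: "?S\<^sup>2 \<le> real (m n) * (\<Sum>i<m n. 2^i) * \<psi> x"
      by (simp only: sum_distrib_right mult.assoc)
    have "(norm x)\<^sup>2 \<le> (2 * ?S + 3 * p n x)\<^sup>2"
      by (intro power_mono ctl) simp
    also have "\<dots> \<le> 8 * ?S\<^sup>2 + 18 * (p n x)\<^sup>2"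
      using zero_le_power2[of "2 * ?S - 3 * p n x"] by (simp add: power2_eq_square algebra_simps)
    also have "\<dots> \<le> 8 * (real (m n) * (\<Sum>i<m n. 2^i)) * \<psi> x + 18 * (p n x)\<^sup>2"
      using S by simp
    finally show "(norm x)\<^sup>2 \<le> 8 * (real (m n) * (\<Sum>i<m n. 2^i)) * \<psi> x + 18 * (p n x)\<^sup>2" .
  qed (auto intro!: mult_nonneg_nonneg sum_nonneg)
  show thesis using that[OF cont nn up par ctl2] .
qed

section \<open>Square-integrable functions on the unit interval and their primitives\<close>

lemma (in complete_measure) complete_measure_restrict_space:
  assumes O: "\<Omega> \<in> sets M"
  shows "complete_measure (restrict_space M \<Omega>)"
proof
  fix A B assume AB: "B \<subseteq> A" "A \<in> null_sets (restrict_space M \<Omega>)"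
  have O': "\<Omega> \<inter> space M \<in> sets M" using O by blast
  have "A \<in> null_sets M" "A \<subseteq> \<Omega>"
    using AB(2) by (simp_all add: null_sets_restrict_space[OF O])
  then have "B \<in> sets M" "B \<subseteq> \<Omega>"
    using AB(1) complete by blast+
  then show "B \<in> sets (restrict_space M \<Omega>)"
    by (simp add: sets_restrict_space_iff[OF O'])
qed

abbreviation unit_lebesgue :: "real measure" where
  "unit_lebesgue \<equiv> lebesgue_on {0..1}"

interpretation unit_lebesgue: complete_measure unit_lebesgue
  by (rule completion.complete_measure_restrict_space) simp

lemma emeasure_unit_lebesgue_interval:
  assumes "0 \<le> s" "s \<le> t" "t \<le> 1"
  shows "emeasure unit_lebesgue {s<..t} = ennreal (t - s)"
proof -
  have "emeasure unit_lebesgue {s<..t} = emeasure lebesgue {s<..t}"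
    using assms by (intro emeasure_restrict_space) auto
  then show ?thesis using assms by simp
qed

lemma emeasure_space_unit_lebesgue: "emeasure unit_lebesgue {0..1} = 1"
proof -
  have "emeasure unit_lebesgue {0..1} = emeasure lebesgue {0..1::real}"
    by (intro emeasure_restrict_space) auto
  then show ?thesis by simp
qed

text \<open>
  Defined for arbitrary real integrands, since it is applied to squares of several seminorms and to the
  perturbed squared norms; negative values count as zero.
\<close>

definition energy :: "('a::real_normed_vector \<Rightarrow> real) \<Rightarrow> (real \<Rightarrow> 'a) \<Rightarrow> ennreal" where
  "energy Q v = (\<integral>\<^sup>+t. ennreal (Q (v t)) \<partial>unit_lebesgue)"

abbreviation L2 :: "(real \<Rightarrow> 'a::real_normed_vector) set" where
  "L2 \<equiv> L2_space unit_lebesgue"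

lemma L2D:
  assumes "v \<in> L2"
  shows "strongly_measurable unit_lebesgue v" "energy (\<lambda>x. (norm x)\<^sup>2) v < \<infinity>"
  using assms by (simp_all add: L2_space_def energy_def)

lemma borel_measurable_compose_L2:
  fixes Q :: "'a::real_normed_vector \<Rightarrow> real"
  assumes "v \<in> L2" "continuous_on UNIV Q"
  shows "(\<lambda>t. Q (v t)) \<in> borel_measurable unit_lebesgue"
  by (rule unit_lebesgue.strongly_measurable_continuous_compose[OF L2D(1)[OF assms(1)] assms(2)])

lemma nn_integral_square_le:
  assumes f: "f \<in> borel_measurable unit_lebesgue" and A: "A \<in> sets unit_lebesgue"
  shows "(\<integral>\<^sup>+t. ennreal (f t) * indicator A t \<partial>unit_lebesgue)\<^sup>2 \<le>
    emeasure unit_lebesgue A * (\<integral>\<^sup>+t. ennreal ((f t)\<^sup>2) \<partial>unit_lebesgue)"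
proof -
  have "(\<integral>\<^sup>+t. ennreal (f t) * indicator A t \<partial>unit_lebesgue)\<^sup>2 \<le>
      (\<integral>\<^sup>+t. (ennreal (f t))\<^sup>2 \<partial>unit_lebesgue) * (\<integral>\<^sup>+t. (indicator A t)\<^sup>2 \<partial>unit_lebesgue)"
    by (rule Cauchy_Schwarz_nn_integral) (use f A in measurable)
  also have "(\<integral>\<^sup>+t. (indicator A t :: ennreal)\<^sup>2 \<partial>unit_lebesgue) = (\<integral>\<^sup>+t. indicator A t \<partial>unit_lebesgue)"
    by (intro nn_integral_cong) (simp split: split_indicator)
  also have "\<dots> = emeasure unit_lebesgue A" using A by simp
  also have "(\<integral>\<^sup>+t. (ennreal (f t))\<^sup>2 \<partial>unit_lebesgue) \<le> (\<integral>\<^sup>+t. ennreal ((f t)\<^sup>2) \<partial>unit_lebesgue)"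
  proof (intro nn_integral_mono)
    fix t show "(ennreal (f t))\<^sup>2 \<le> ennreal ((f t)\<^sup>2)"
      by (cases "f t \<ge> 0") (auto simp: ennreal_power ennreal_neg)
  qed
  finally show ?thesis by (simp add: mult.commute mult_right_mono)
qed

lemma L2_norm_integrable:
  assumes "v \<in> L2"
  shows "(\<integral>\<^sup>+t. norm (v t) \<partial>unit_lebesgue) < \<infinity>"
proof -
  have [measurable]: "(\<lambda>t. norm (v t)) \<in> borel_measurable unit_lebesgue"
    by (rule borel_measurable_compose_L2[OF assms]) (intro continuous_intros)
  have "(\<integral>\<^sup>+t. norm (v t) \<partial>unit_lebesgue) \<le> (\<integral>\<^sup>+t. ennreal ((norm (v t))\<^sup>2) + 1 \<partial>unit_lebesgue)"
  proof (intro nn_integral_mono)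
    fix t
    have "norm (v t) \<le> (norm (v t))\<^sup>2 + 1"
      using zero_le_power2[of "norm (v t) - 1"] by (simp add: power2_eq_square algebra_simps) (smt (verit) norm_ge_zero)
    then show "ennreal (norm (v t)) \<le> ennreal ((norm (v t))\<^sup>2) + 1"
      by (simp add: ennreal_leI flip: ennreal_plus ennreal_1)
  qed
  also have "\<dots> = energy (\<lambda>x. (norm x)\<^sup>2) v + 1"
    unfolding energy_def using emeasure_space_unit_lebesgue by (subst nn_integral_add) simp_all
  also have "\<dots> < \<infinity>" using L2D(2)[OF assms] by (simp add: ennreal_add_less_top)
  finally show ?thesis .
qed

lemma power2_add_le: "(x + y)\<^sup>2 \<le> 2 * x\<^sup>2 + 2 * (y::real)\<^sup>2"
  using zero_le_power2[of "x - y"] by (simp add: power2_eq_square algebra_simps)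

lemma L2_linear_combination:
  assumes v: "v \<in> L2" and w: "w \<in> L2"
  shows "(\<lambda>t. a *\<^sub>R v t + b *\<^sub>R w t) \<in> L2"
proof -
  have [measurable]: "(\<lambda>t. norm (v t)) \<in> borel_measurable unit_lebesgue" "(\<lambda>t. norm (w t)) \<in> borel_measurable unit_lebesgue"
    by (rule borel_measurable_compose_L2[OF v] borel_measurable_compose_L2[OF w], intro continuous_intros)+
  have "(\<integral>\<^sup>+t. ennreal ((norm (a *\<^sub>R v t + b *\<^sub>R w t))\<^sup>2) \<partial>unit_lebesgue) \<le>
    (\<integral>\<^sup>+t. ennreal (2 * a\<^sup>2) * ennreal ((norm (v t))\<^sup>2) + ennreal (2 * b\<^sup>2) * ennreal ((norm (w t))\<^sup>2) \<partial>unit_lebesgue)"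
  proof (intro nn_integral_mono)
    fix t
    have "(norm (a *\<^sub>R v t + b *\<^sub>R w t))\<^sup>2 \<le> (\<bar>a\<bar> * norm (v t) + \<bar>b\<bar> * norm (w t))\<^sup>2"
      using norm_triangle_ineq[of "a *\<^sub>R v t" "b *\<^sub>R w t"] by (intro power_mono) auto
    also have "\<dots> \<le> 2 * a\<^sup>2 * (norm (v t))\<^sup>2 + 2 * b\<^sup>2 * (norm (w t))\<^sup>2"
      using power2_add_le[of "\<bar>a\<bar> * norm (v t)" "\<bar>b\<bar> * norm (w t)"] by (simp add: power_mult_distrib)
    finally show "ennreal ((norm (a *\<^sub>R v t + b *\<^sub>R w t))\<^sup>2) \<le>
        ennreal (2 * a\<^sup>2) * ennreal ((norm (v t))\<^sup>2) + ennreal (2 * b\<^sup>2) * ennreal ((norm (w t))\<^sup>2)"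
      by (simp add: ennreal_leI flip: ennreal_plus ennreal_mult)
  qed
  also have "\<dots> = ennreal (2 * a\<^sup>2) * energy (\<lambda>x. (norm x)\<^sup>2) v + ennreal (2 * b\<^sup>2) * energy (\<lambda>x. (norm x)\<^sup>2) w"
    unfolding energy_def by (simp add: nn_integral_add nn_integral_cmult)
  also have "\<dots> < \<infinity>"
    using L2D(2)[OF v] L2D(2)[OF w] by (simp add: ennreal_mult_less_top)
  finally show ?thesis
    using strongly_measurable_linear_combination[OF L2D(1)[OF v] L2D(1)[OF w]] by (simp add: L2_space_def)
qed

lemma L2_diff: "v \<in> L2 \<Longrightarrow> w \<in> L2 \<Longrightarrow> (\<lambda>t. v t - w t) \<in> L2"
  using L2_linear_combination[of v w 1 "-1"] by simp

lemma has_strong_integral_primitive: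
  fixes v :: "real \<Rightarrow> 'a::banach"
  assumes v: "v \<in> L2" and t: "t \<in> {0..1}"
  shows "has_strong_integral unit_lebesgue (\<lambda>x. indicator {0..t} x *\<^sub>R v x) (primitive v t)"
proof -
  have O: "{0..t} \<inter> space unit_lebesgue \<in> sets unit_lebesgue"
    using t by (auto simp: sets_restrict_space)
  have eq: "restrict_space unit_lebesgue {0..t} = lebesgue_on {0..t}"
    using t by (subst restrict_restrict_space) (auto simp: Int_absorb1)
  have sm: "strongly_measurable (lebesgue_on {0..t}) v"
    using strongly_measurable_restrict_space[OF L2D(1)[OF v] O] by (simp add: eq)
  have "(\<integral>\<^sup>+x. norm (v x) \<partial>restrict_space unit_lebesgue {0..t}) \<le> (\<integral>\<^sup>+x. norm (v x) \<partial>unit_lebesgue)"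
    by (subst nn_integral_restrict_space[OF O]) (auto intro!: nn_integral_mono split: split_indicator)
  then have fin: "(\<integral>\<^sup>+x. norm (v x) \<partial>lebesgue_on {0..t}) < \<infinity>"
    using L2_norm_integrable[OF v] by (simp add: eq)
  interpret t: complete_measure "lebesgue_on {0..t}"
    by (rule completion.complete_measure_restrict_space) simp
  obtain y where y: "has_strong_integral (lebesgue_on {0..t}) v y"
    using t.has_strong_integral_exists[OF sm fin] by blast
  then have "primitive v t = y"
    unfolding primitive_def by (rule t.strong_integral_eqI)
  with y show ?thesis
    by (auto intro!: has_strong_integral_restrict_space[OF O L2D(1)[OF v]] simp: eq)
qed

lemma primitive_linear_combination:
  fixes v w :: "real \<Rightarrow> 'a::banach"
  assumes v: "v \<in> L2" and w: "w \<in> L2" and t: "t \<in> {0..1}"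
  shows "primitive (\<lambda>x. a *\<^sub>R v x + b *\<^sub>R w x) t = a *\<^sub>R primitive v t + b *\<^sub>R primitive w t"
proof -
  have "(\<lambda>x. indicator {0..t} x *\<^sub>R (a *\<^sub>R v x + b *\<^sub>R w x)) =
      (\<lambda>x. a *\<^sub>R (indicator {0..t} x *\<^sub>R v x) + b *\<^sub>R (indicator {0..t} x *\<^sub>R w x))"
    by (auto simp: scaleR_add_right mult.commute)
  with has_strong_integral_primitive[OF L2_linear_combination[OF v w] t, of a b]
  have "has_strong_integral unit_lebesgue (\<lambda>x. a *\<^sub>R (indicator {0..t} x *\<^sub>R v x) + b *\<^sub>R (indicator {0..t} x *\<^sub>R w x))
      (primitive (\<lambda>x. a *\<^sub>R v x + b *\<^sub>R w x) t)"
    by simp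
  then show ?thesis
    using unit_lebesgue.has_strong_integral_linear_combination[OF has_strong_integral_primitive[OF v t]
        has_strong_integral_primitive[OF w t], of a b]
    by (rule unit_lebesgue.has_strong_integral_unique)
qed

text \<open>
  Jensen's inequality followed by the Cauchy-Schwarz inequality with the indicator of the support.
\<close>

lemma has_strong_integral_supported_le:
  fixes g :: "real \<Rightarrow> 'a::real_normed_vector"
  assumes p: "contractive_seminorm p" and v: "v \<in> L2" and A: "A \<in> sets unit_lebesgue"
    and g: "has_strong_integral unit_lebesgue g y" "\<And>x. x \<in> {0..1} \<Longrightarrow> g x = indicator A x *\<^sub>R v x"
  shows "ennreal ((p y)\<^sup>2) \<le> emeasure unit_lebesgue A * energy (\<lambda>x. (p x)\<^sup>2) v"
proof -
  have "ennreal (p y) \<le> (\<integral>\<^sup>+x. p (g x) \<partial>unit_lebesgue)"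
    by (rule unit_lebesgue.has_strong_integral_seminorm_le[OF p g(1)])
  also have "\<dots> = (\<integral>\<^sup>+x. ennreal (p (v x)) * indicator A x \<partial>unit_lebesgue)"
    using g(2) contractive_seminorm_simps(1)[OF p]
    by (intro nn_integral_cong) (simp split: split_indicator)
  finally have "(ennreal (p y))\<^sup>2 \<le> (\<integral>\<^sup>+x. ennreal (p (v x)) * indicator A x \<partial>unit_lebesgue)\<^sup>2"
    by (rule power_mono) simp
  also have "\<dots> \<le> emeasure unit_lebesgue A * energy (\<lambda>x. (p x)\<^sup>2) v"
    unfolding energy_def
    by (intro nn_integral_square_le A borel_measurable_compose_L2[OF v] contractive_seminorm_continuous p)
  finally show ?thesis
    using contractive_seminorm_simps(3)[OF p] by (simp add: ennreal_power)
qed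

lemma primitive_seminorm_le:
  fixes v :: "real \<Rightarrow> 'a::banach"
  assumes p: "contractive_seminorm p" and v: "v \<in> L2" and t: "t \<in> {0..1}"
  shows "ennreal ((p (primitive v t))\<^sup>2) \<le> energy (\<lambda>x. (p x)\<^sup>2) v"
proof -
  have A: "{0..t} \<in> sets unit_lebesgue" using t by (auto simp: sets_restrict_space)
  have "ennreal ((p (primitive v t))\<^sup>2) \<le> emeasure unit_lebesgue {0..t} * energy (\<lambda>x. (p x)\<^sup>2) v"
    by (rule has_strong_integral_supported_le[OF p v A has_strong_integral_primitive[OF v t]]) simp
  also have "\<dots> \<le> 1 * energy (\<lambda>x. (p x)\<^sup>2) v"
    using emeasure_space[of unit_lebesgue "{0..t}"] emeasure_space_unit_lebesgue
    by (intro mult_right_mono) simp_all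
  finally show ?thesis by simp
qed

text \<open>
  Only the part of \<open>v\<close> between \<open>s\<close> and \<open>t\<close> contributes to the
  difference of the primitives.
\<close>

lemma primitive_Hoelder:
  fixes v :: "real \<Rightarrow> 'a::banach"
  assumes v: "v \<in> L2" and st: "0 \<le> s" "s \<le> t" "t \<le> 1"
  shows "ennreal ((norm (primitive v t - primitive v s))\<^sup>2) \<le> ennreal (t - s) * energy (\<lambda>x. (norm x)\<^sup>2) v"
proof -
  have A: "{s<..t} \<in> sets unit_lebesgue" using st by (auto simp: sets_restrict_space)
  have "has_strong_integral unit_lebesgue
      (\<lambda>x. 1 *\<^sub>R (indicator {0..t} x *\<^sub>R v x) + (-1) *\<^sub>R (indicator {0..s} x *\<^sub>R v x))
      (1 *\<^sub>R primitive v t + (-1) *\<^sub>R primitive v s)"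
    using st by (intro unit_lebesgue.has_strong_integral_linear_combination has_strong_integral_primitive v) auto
  from has_strong_integral_supported_le[OF contractive_seminorm_norm v A this]
  show ?thesis
    using st by (simp add: emeasure_unit_lebesgue_interval split: split_indicator)
qed

lemma primitive_equicontinuous:
  fixes v :: "real \<Rightarrow> 'a::banach"
  assumes v: "v \<in> L2" "energy (\<lambda>x. (norm x)\<^sup>2) v \<le> ennreal R" and R: "0 \<le> R"
    and st: "s \<in> {0..1}" "t \<in> {0..1}"
  shows "(norm (primitive v t - primitive v s))\<^sup>2 \<le> \<bar>t - s\<bar> * R"
proof -
  have *: "(norm (primitive v t - primitive v s))\<^sup>2 \<le> (t - s) * R" if "0 \<le> s" "s \<le> t" "t \<le> 1" for s t
  proof -
    have "ennreal ((norm (primitive v t - primitive v s))\<^sup>2) \<le> ennreal (t - s) * ennreal R"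
      using primitive_Hoelder[OF v(1) that] v(2) by (meson mult_left_mono order_trans zero_le)
    also have "\<dots> = ennreal ((t - s) * R)" using that R by (simp add: ennreal_mult)
    finally show ?thesis using that R by (simp add: ennreal_le_iff)
  qed
  show ?thesis
    using *[of s t] *[of t s] st by (cases "s \<le> t") (auto simp: norm_minus_commute)
qed

lemma continuous_on_primitive:
  fixes v :: "real \<Rightarrow> 'a::banach"
  assumes v: "v \<in> L2"
  shows "continuous_on {0..1} (primitive v)"
proof -
  obtain R where R: "0 \<le> R" "energy (\<lambda>x. (norm x)\<^sup>2) v \<le> ennreal R"
    using L2D(2)[OF v] that[of "enn2real (energy (\<lambda>x. (norm x)\<^sup>2) v)"] by simp
  show ?thesis
    unfolding continuous_on_def
  proof
    fix s :: real assume s: "s \<in> {0..1}"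
    have "((\<lambda>t. \<bar>t - s\<bar> * R) \<longlongrightarrow> \<bar>s - s\<bar> * R) (at s within {0..1})"
      by (intro tendsto_intros)
    then have lim: "((\<lambda>t. \<bar>t - s\<bar> * R) \<longlongrightarrow> 0) (at s within {0..1})" by simp
    have "((\<lambda>t. (norm (primitive v t - primitive v s))\<^sup>2) \<longlongrightarrow> 0) (at s within {0..1})"
    proof (rule tendsto_sandwich[OF _ _ tendsto_const lim])
      show "\<forall>\<^sub>F t in at s within {0..1}. (norm (primitive v t - primitive v s))\<^sup>2 \<le> \<bar>t - s\<bar> * R"
        using primitive_equicontinuous[OF v R(2,1) s] by (auto simp: eventually_at_filter)
    qed simp
    then have "((\<lambda>t. sqrt ((norm (primitive v t - primitive v s))\<^sup>2)) \<longlongrightarrow> sqrt 0) (at s within {0..1})"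
      by (rule tendsto_real_sqrt)
    then show "(primitive v \<longlongrightarrow> primitive v s) (at s within {0..1})"
      by (simp add: tendsto_norm_zero_iff LIM_zero_iff)
  qed
qed

text \<open>
  The argument of the projection theorem. The infima of \<open>\<Psi>\<close> over the decreasing sets
  \<open>H k\<close> increase to a limit; two near-minimizers have a midpoint whose value is not much
  below theirs, and by the parallelogram law this bounds \<open>\<Delta>\<close> between them.
\<close>

lemma near_minimizers_Cauchy:
  fixes H :: "nat \<Rightarrow> 'b set" and \<Psi> :: "'b \<Rightarrow> real" and mid :: "'b \<Rightarrow> 'b \<Rightarrow> 'b" and \<Delta> :: "'b \<Rightarrow> 'b \<Rightarrow> real"
  assumes dec: "\<And>k l. k \<le> l \<Longrightarrow> H l \<subseteq> H k" and ne: "\<And>k. H k \<noteq> {}"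
    and bd: "\<And>x. x \<in> H 0 \<Longrightarrow> 0 \<le> \<Psi> x" "\<And>x. x \<in> H 0 \<Longrightarrow> \<Psi> x \<le> C"
    and mid: "\<And>k x y. x \<in> H k \<Longrightarrow> y \<in> H k \<Longrightarrow> mid x y \<in> H k"
    and par: "\<And>x y. x \<in> H 0 \<Longrightarrow> y \<in> H 0 \<Longrightarrow> \<Psi> (mid x y) + \<Delta> x y / 4 = \<Psi> x / 2 + \<Psi> y / 2"
  obtains w where "\<And>k. w k \<in> H k" "\<And>e. e > 0 \<Longrightarrow> \<exists>K. \<forall>k\<ge>K. \<forall>l\<ge>k. \<Delta> (w k) (w l) \<le> e"
proof -
  have H0: "x \<in> H 0" if "x \<in> H k" for k x using dec[of 0 k] that by blast
  define d where "d k = (INF x\<in>H k. \<Psi> x)" for k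
  have bdd: "bdd_below (\<Psi> ` H k)" for k
    using bd(1) H0 by (intro bdd_belowI2[where m=0]) blast
  have lower: "d k \<le> \<Psi> x" if "x \<in> H k" for k x
    unfolding d_def using that bdd by (rule cINF_lower[rotated])
  have "\<exists>x\<in>H k. \<Psi> x < d k + 1 / real (Suc k)" for k
  proof -
    have "(INF x\<in>H k. \<Psi> x) < d k + 1 / real (Suc k)" by (simp add: d_def)
    then show ?thesis using cINF_less_iff[OF ne bdd] by blast
  qed
  then obtain w where w: "\<And>k. w k \<in> H k" "\<And>k. \<Psi> (w k) < d k + 1 / real (Suc k)" by metis
  have inc: "d k \<le> d l" if "k \<le> l" for k l
    unfolding d_def using dec[OF that] by (intro cINF_superset_mono ne bdd) auto
  have "d k \<le> C" for k using lower[OF w(1)] bd(2)[OF H0[OF w(1)]] by (meson order_trans)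
  moreover have "incseq d" using inc by (simp add: incseq_def)
  ultimately obtain L where "d \<longlonglongrightarrow> L" using incseq_convergent by blast
  then have Cd: "Cauchy d" by (rule LIMSEQ_imp_Cauchy)
  show thesis
  proof (rule that[OF w(1)])
    fix e :: real assume e: "e > 0"
    obtain K1 where K1: "\<And>k l. k \<ge> K1 \<Longrightarrow> l \<ge> K1 \<Longrightarrow> \<bar>d k - d l\<bar> < e / 4"
      using CauchyD[OF Cd, of "e / 4"] e by auto
    obtain K2 where K2: "1 / real (Suc K2) < e / 8"
      using reals_Archimedean[of "e / 8"] e by (auto simp: inverse_eq_divide)
    show "\<exists>K. \<forall>k\<ge>K. \<forall>l\<ge>k. \<Delta> (w k) (w l) \<le> e"
    proof (intro exI allI impI)
      fix k l assume k: "max K1 K2 \<le> k" and l: "k \<le> l"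
      have wl: "w l \<in> H k" using w(1) dec[OF l] by blast
      have "d k \<le> \<Psi> (mid (w k) (w l))" by (intro lower mid w wl)
      moreover have "\<Psi> (mid (w k) (w l)) + \<Delta> (w k) (w l) / 4 = \<Psi> (w k) / 2 + \<Psi> (w l) / 2"
        by (intro par H0[OF w(1)])
      moreover have "\<bar>d k - d l\<bar> < e / 4" using K1 k l by simp
      moreover have "1 / real (Suc k) \<le> 1 / real (Suc K2)" "1 / real (Suc l) \<le> 1 / real (Suc K2)"
        using k l by (auto intro!: divide_left_mono)
      ultimately show "\<Delta> (w k) (w l) \<le> e"
        using w(2)[of k] w(2)[of l] K2 by linarith
    qed
  qed
qed

section \<open>Completeness and strong limits of iterated midpoints\<close>

lemma L1_le_sqrt_energy:
  assumes v: "v \<in> L2" and le: "energy (\<lambda>x. (norm x)\<^sup>2) v \<le> ennreal (c\<^sup>2)" and c: "0 \<le> c"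
  shows "(\<integral>\<^sup>+t. norm (v t) \<partial>unit_lebesgue) \<le> ennreal c"
proof -
  have "(\<integral>\<^sup>+t. norm (v t) \<partial>unit_lebesgue) = (\<integral>\<^sup>+t. ennreal (norm (v t)) * indicator {0..1} t \<partial>unit_lebesgue)"
    by (intro nn_integral_cong) simp
  also have "\<dots>\<^sup>2 \<le> emeasure unit_lebesgue {0..1} * energy (\<lambda>x. (norm x)\<^sup>2) v"
    unfolding energy_def
    by (intro nn_integral_square_le borel_measurable_compose_L2[OF v] continuous_intros) (auto simp: sets_restrict_space)
  also have "\<dots> \<le> (ennreal c)\<^sup>2"
    using le c by (simp add: emeasure_space_unit_lebesgue ennreal_power)
  finally have "(\<integral>\<^sup>+t. norm (v t) \<partial>unit_lebesgue)\<^sup>2 \<le> (ennreal c)\<^sup>2" .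
  moreover obtain x where x: "0 \<le> x" "(\<integral>\<^sup>+t. norm (v t) \<partial>unit_lebesgue) = ennreal x"
    using L2_norm_integrable[OF v] that[of "enn2real (\<integral>\<^sup>+t. norm (v t) \<partial>unit_lebesgue)"] by simp
  ultimately have "x\<^sup>2 \<le> c\<^sup>2" using c by (simp add: ennreal_power ennreal_le_iff)
  then have "x \<le> c" using c by (rule power2_le_imp_le)
  then show ?thesis by (simp add: x(2) ennreal_leI)
qed

lemma energy_mono: "(\<And>x. Q x \<le> P x) \<Longrightarrow> energy Q v \<le> energy P v"
  unfolding energy_def by (intro nn_integral_mono ennreal_leI)

text \<open>
  Fatou's lemma: energies are lower semicontinuous under convergence almost everywhere.
\<close>

lemma energy_le_of_AE_limit:
  fixes w :: "nat \<Rightarrow> real \<Rightarrow> 'a::real_normed_vector"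
  assumes w: "\<And>k. w k \<in> L2" and lim: "AE t in unit_lebesgue. (\<lambda>k. w k t) \<longlonglongrightarrow> v t"
    and Q: "continuous_on UNIV Q" and le: "\<forall>\<^sub>F k in sequentially. energy Q (w k) \<le> c"
  shows "energy Q v \<le> c"
proof -
  have "energy Q v = (\<integral>\<^sup>+t. liminf (\<lambda>k. ennreal (Q (w k t))) \<partial>unit_lebesgue)"
    unfolding energy_def
  proof (rule nn_integral_cong_AE)
    show "AE t in unit_lebesgue. ennreal (Q (v t)) = liminf (\<lambda>k. ennreal (Q (w k t)))"
      using lim
    proof eventually_elim
      case (elim t)
      have "(\<lambda>k. ennreal (Q (w k t))) \<longlonglongrightarrow> ennreal (Q (v t))"
        by (intro tendsto_ennrealI continuous_on_tendsto_compose[OF Q elim]) auto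
      then show ?case by (simp add: lim_imp_Liminf)
    qed
  qed
  also have "\<dots> \<le> liminf (\<lambda>k. energy Q (w k))"
    unfolding energy_def
    using borel_measurable_compose_L2[OF w Q] by (intro nn_integral_liminf) measurable
  also have "\<dots> \<le> c"
    using le by (intro Liminf_le) simp_all
  finally show ?thesis .
qed

lemma AE_summable_of_geometric:
  fixes g :: "nat \<Rightarrow> 'b \<Rightarrow> real"
  assumes [measurable]: "\<And>k. g k \<in> borel_measurable M" and nn: "\<And>k x. 0 \<le> g k x"
    and le: "\<And>k. (\<integral>\<^sup>+x. g k x \<partial>M) \<le> ennreal ((1/2)^k)"
  shows "AE x in M. summable (\<lambda>k. g k x)"
proof -
  have "(\<integral>\<^sup>+x. (\<Sum>k. ennreal (g k x)) \<partial>M) = (\<Sum>k. \<integral>\<^sup>+x. g k x \<partial>M)"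
    by (rule nn_integral_suminf) measurable
  also have "\<dots> \<le> (\<Sum>k. ennreal ((1/2)^k))"
    by (intro suminf_le le) auto
  also have "\<dots> = ennreal 2"
    using geometric_sums[of "1/2::real"] by (intro suminf_ennreal_eq) auto
  finally have "(\<integral>\<^sup>+x. (\<Sum>k. ennreal (g k x)) \<partial>M) \<noteq> \<infinity>"
    by (auto simp: top_unique)
  then have "AE x in M. (\<Sum>k. ennreal (g k x)) \<noteq> \<infinity>"
    by (intro nn_integral_noteq_infinite) measurable
  then show ?thesis
    by eventually_elim (rule summable_suminf_not_top, use nn in auto)
qed

text \<open>
  The limit is taken almost everywhere along a rapidly converging subsequence. It is strongly measurable
  because simple functions close to the members of the subsequence in mean converge to the same limit.
\<close>

lemma L2_complete:
  fixes w :: "nat \<Rightarrow> real \<Rightarrow> 'a::banach"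
  assumes w: "\<And>k. w k \<in> L2"
    and Cauchy: "\<And>e. e > 0 \<Longrightarrow> \<exists>K. \<forall>k\<ge>K. \<forall>l\<ge>k. energy (\<lambda>x. (norm x)\<^sup>2) (\<lambda>t. w k t - w l t) \<le> ennreal e"
  obtains v s where "v \<in> L2" "strict_mono (s::nat\<Rightarrow>nat)" "AE t in unit_lebesgue. (\<lambda>k. w (s k) t) \<longlonglongrightarrow> v t"
    "\<And>e. e > 0 \<Longrightarrow> \<forall>\<^sub>F k in sequentially. energy (\<lambda>x. (norm x)\<^sup>2) (\<lambda>t. v t - w k t) \<le> ennreal e"
proof -
  have "\<exists>K. \<forall>n. \<forall>k\<ge>K n. \<forall>l\<ge>k. energy (\<lambda>x. (norm x)\<^sup>2) (\<lambda>t. w k t - w l t) \<le> ennreal (((1/2)^n)\<^sup>2)"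
    by (intro choice allI Cauchy) simp
  then obtain K where K: "\<And>n k l. K n \<le> k \<Longrightarrow> k \<le> l \<Longrightarrow>
      energy (\<lambda>x. (norm x)\<^sup>2) (\<lambda>t. w k t - w l t) \<le> ennreal (((1/2)^n)\<^sup>2)" by blast
  define s where "s n = n + (\<Sum>i\<le>n. K i)" for n
  have s: "strict_mono s" by (rule strict_mono_Suc_iff[THEN iffD2]) (simp add: s_def)
  have sK: "K n \<le> s n" for n
    unfolding s_def using member_le_sum[of n "{..n}" K] by simp
  have "\<exists>g. \<forall>n. simple_function unit_lebesgue (g n) \<and> (\<integral>\<^sup>+t. norm (w (s n) t - g n t) \<partial>unit_lebesgue) \<le> ennreal ((1/2)^n)"
  proof (intro choice allI)
    fix n
    obtain h where h: "\<And>i::nat. Bochner_Integration.simple_bochner_integrable unit_lebesgue (h i)"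
      "(\<lambda>i. \<integral>\<^sup>+t. ennreal (norm (w (s n) t - h i t)) \<partial>unit_lebesgue) \<longlonglongrightarrow> 0"
      using unit_lebesgue.strongly_integrable_simple_approx[OF L2D(1)[OF w] L2_norm_integrable[OF w]] by blast
    have "eventually (\<lambda>i. (\<integral>\<^sup>+t. ennreal (norm (w (s n) t - h i t)) \<partial>unit_lebesgue) < ennreal ((1/2)^n)) sequentially"
      using order_tendstoD(2)[OF h(2)] by simp
    then obtain i where "(\<integral>\<^sup>+t. ennreal (norm (w (s n) t - h i t)) \<partial>unit_lebesgue) < ennreal ((1/2)^n)"
      using eventually_happens'[OF sequentially_bot] by blast
    then show "\<exists>g. simple_function unit_lebesgue g \<and> (\<integral>\<^sup>+t. norm (w (s n) t - g t) \<partial>unit_lebesgue) \<le> ennreal ((1/2)^n)"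
      using h(1)[of i] by (intro exI[of _ "h i"]) (simp add: Bochner_Integration.simple_bochner_integrable.simps)
  qed
  then obtain g where g: "\<And>n. simple_function unit_lebesgue (g n)"
    "\<And>n. (\<integral>\<^sup>+t. norm (w (s n) t - g n t) \<partial>unit_lebesgue) \<le> ennreal ((1/2)^n)" by blast
  have sum1: "AE t in unit_lebesgue. summable (\<lambda>n. norm (w (s n) t - g n t))"
    by (rule AE_summable_of_geometric[OF _ _ g(2)])
       (simp_all add: unit_lebesgue.borel_measurable_norm_diff_strongly[OF L2D(1)[OF w] simple_function_imp_strongly_measurable[OF g(1)]])
  have sum2: "AE t in unit_lebesgue. summable (\<lambda>n. norm (w (s n) t - w (s (Suc n)) t))"
  proof (rule AE_summable_of_geometric)
    fix n
    show "(\<integral>\<^sup>+t. norm (w (s n) t - w (s (Suc n)) t) \<partial>unit_lebesgue) \<le> ennreal ((1/2)^n)"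
      using s by (intro L1_le_sqrt_energy L2_diff w K[OF sK]) (simp_all add: strict_mono_less_eq)
  qed (simp_all add: unit_lebesgue.borel_measurable_norm_diff_strongly[OF L2D(1)[OF w] L2D(1)[OF w]])
  define v where "v t = lim (\<lambda>n. w (s n) t)" for t
  have lim: "AE t in unit_lebesgue. (\<lambda>n. w (s n) t) \<longlonglongrightarrow> v t"
    using sum2
  proof eventually_elim
    case (elim t)
    have "summable (\<lambda>n. w (s n) t - w (s (Suc n)) t)" using elim by (rule summable_norm_cancel)
    then have "convergent (\<lambda>m. \<Sum>n<m. w (s n) t - w (s (Suc n)) t)" by (simp add: summable_iff_convergent)
    then have "convergent (\<lambda>m. w (s 0) t - (\<Sum>n<m. w (s n) t - w (s (Suc n)) t))"
      by (intro convergent_diff convergent_const)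
    moreover have "w (s 0) t - (\<Sum>n<m. w (s n) t - w (s (Suc n)) t) = w (s m) t" for m
      using sum_lessThan_telescope'[of "\<lambda>n. w (s n) t" m] by simp
    ultimately show ?case by (simp add: v_def convergent_LIMSEQ_iff)
  qed
  have limg: "AE t in unit_lebesgue. (\<lambda>n. g n t) \<longlonglongrightarrow> v t"
    using sum1 lim
  proof eventually_elim
    case (elim t)
    have "(\<lambda>n. w (s n) t - g n t) \<longlonglongrightarrow> 0"
      using summable_LIMSEQ_zero[OF elim(1)] by (simp add: tendsto_norm_zero_iff)
    from tendsto_diff[OF elim(2) this] show ?case by simp
  qed
  have sm: "strongly_measurable unit_lebesgue v"
    unfolding strongly_measurable_def using g(1) limg by blast
  have close: "\<forall>\<^sub>F k in sequentially. energy (\<lambda>x. (norm x)\<^sup>2) (\<lambda>t. v t - w k t) \<le> ennreal e" if e: "e > 0" for e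
  proof -
    obtain K0 where K0: "\<And>k l. K0 \<le> k \<Longrightarrow> k \<le> l \<Longrightarrow> energy (\<lambda>x. (norm x)\<^sup>2) (\<lambda>t. w k t - w l t) \<le> ennreal e"
      using Cauchy[OF e] by blast
    have "energy (\<lambda>x. (norm x)\<^sup>2) (\<lambda>t. v t - w k t) \<le> ennreal e" if k: "K0 \<le> k" for k
    proof (rule energy_le_of_AE_limit[where w="\<lambda>n t. w (s n) t - w k t"])
      show "(\<lambda>t. w (s n) t - w k t) \<in> L2" for n by (intro L2_diff w)
      show "AE t in unit_lebesgue. (\<lambda>n. w (s n) t - w k t) \<longlonglongrightarrow> v t - w k t"
        using lim by eventually_elim (intro tendsto_intros)
      show "continuous_on UNIV (\<lambda>x::'a. (norm x)\<^sup>2)" by (intro continuous_intros)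
      have "energy (\<lambda>x. (norm x)\<^sup>2) (\<lambda>t. w (s n) t - w k t) \<le> ennreal e" if n: "k \<le> n" for n
      proof -
        have "k \<le> s n" using n seq_suble[OF s, of n] by simp
        from K0[OF k this] show ?thesis by (simp add: energy_def norm_minus_commute)
      qed
      then show "\<forall>\<^sub>F n in sequentially. energy (\<lambda>x. (norm x)\<^sup>2) (\<lambda>t. w (s n) t - w k t) \<le> ennreal e"
        unfolding eventually_sequentially by blast
    qed
    then show ?thesis unfolding eventually_sequentially by blast
  qed
  obtain k where k: "energy (\<lambda>x. (norm x)\<^sup>2) (\<lambda>t. v t - w k t) \<le> ennreal 1"
    using eventually_happens'[OF sequentially_bot close[of 1]] by auto
  have "(\<lambda>t. v t - w k t) \<in> L2"
    using strongly_measurable_linear_combination[OF sm L2D(1)[OF w], of 1 "-1"] k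
    by (auto simp: L2_space_def energy_def intro: le_less_trans)
  from L2_linear_combination[OF this w[of k], of 1 1] have "v \<in> L2" by simp
  with s lim close show thesis using that by blast
qed

text \<open>
  Midpoints replace general convex combinations: they are all that the parallelogram law uses.
\<close>

inductive_set midpoint_hull :: "('b \<Rightarrow> 'a::real_vector) set \<Rightarrow> ('b \<Rightarrow> 'a) set" for S where
  base: "v \<in> S \<Longrightarrow> v \<in> midpoint_hull S"
| midpoint: "v \<in> midpoint_hull S \<Longrightarrow> w \<in> midpoint_hull S \<Longrightarrow>
    (\<lambda>t. (1/2) *\<^sub>R v t + (1/2) *\<^sub>R w t) \<in> midpoint_hull S"

lemma midpoint_hull_mono: "S \<subseteq> T \<Longrightarrow> midpoint_hull S \<subseteq> midpoint_hull T"
proof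
  fix x assume "S \<subseteq> T" "x \<in> midpoint_hull S"
  then show "x \<in> midpoint_hull T"
    by (induction rule: midpoint_hull.induct[OF \<open>x \<in> midpoint_hull S\<close>]) (auto intro: midpoint_hull.intros)
qed

lemma midpoint_hull_L2:
  assumes "S \<subseteq> L2" "w \<in> midpoint_hull S"
  shows "w \<in> L2"
  using assms(2) by induction (use assms(1) in \<open>auto intro!: L2_linear_combination\<close>)

definition midconvex :: "('a::real_vector \<Rightarrow> real) \<Rightarrow> bool" where
  "midconvex Q \<longleftrightarrow> (\<forall>x y. Q ((1/2) *\<^sub>R x + (1/2) *\<^sub>R y) \<le> Q x / 2 + Q y / 2)"

lemma energy_half:
  assumes "v \<in> L2" "continuous_on UNIV Q" "\<And>x. 0 \<le> Q x"
  shows "energy (\<lambda>x. Q x / 2) v = ennreal (1/2) * energy Q v"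
proof -
  have [measurable]: "(\<lambda>t. Q (v t)) \<in> borel_measurable unit_lebesgue"
    by (rule borel_measurable_compose_L2[OF assms(1,2)])
  have "energy (\<lambda>x. Q x / 2) v = (\<integral>\<^sup>+t. ennreal (1/2) * ennreal (Q (v t)) \<partial>unit_lebesgue)"
    unfolding energy_def
    by (intro nn_integral_cong, subst ennreal_mult[symmetric]) (simp_all add: assms(3))
  also have "\<dots> = ennreal (1/2) * energy Q v"
    unfolding energy_def by (rule nn_integral_cmult) measurable
  finally show ?thesis .
qed

lemma energy_midpoint_le:
  assumes Q: "continuous_on UNIV Q" "\<And>x. 0 \<le> Q x" "midconvex Q" and v: "v \<in> L2" and w: "w \<in> L2"
    and le: "energy Q v \<le> c" "energy Q w \<le> c"
  shows "energy Q (\<lambda>t. (1/2) *\<^sub>R v t + (1/2) *\<^sub>R w t) \<le> c"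
proof -
  have [measurable]: "(\<lambda>t. Q (v t)) \<in> borel_measurable unit_lebesgue" "(\<lambda>t. Q (w t)) \<in> borel_measurable unit_lebesgue"
    by (rule borel_measurable_compose_L2[OF v Q(1)] borel_measurable_compose_L2[OF w Q(1)])+
  have "energy Q (\<lambda>t. (1/2) *\<^sub>R v t + (1/2) *\<^sub>R w t) \<le>
      (\<integral>\<^sup>+t. ennreal (Q (v t) / 2) + ennreal (Q (w t) / 2) \<partial>unit_lebesgue)"
    unfolding energy_def
    using Q(2,3) by (intro nn_integral_mono) (auto simp: midconvex_def ennreal_leI simp flip: ennreal_plus)
  also have "\<dots> = energy (\<lambda>x. Q x / 2) v + energy (\<lambda>x. Q x / 2) w"
    unfolding energy_def by (rule nn_integral_add) measurable
  also have "\<dots> = ennreal (1/2) * (energy Q v + energy Q w)"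
    using energy_half[OF v Q(1,2)] energy_half[OF w Q(1,2)] by (simp add: distrib_left)
  also have "\<dots> \<le> ennreal (1/2) * (c + c)"
    by (intro mult_left_mono add_mono le) simp
  also have "\<dots> = c"
  proof -
    have half: "ennreal (1/2) * ennreal 2 = 1"
      by (subst ennreal_mult[symmetric]) simp_all
    have "c + c = ennreal 2 * c" by (simp add: mult_2)
    then have "ennreal (1/2) * (c + c) = (ennreal (1/2) * ennreal 2) * c"
      by (simp only: mult.assoc)
    then show ?thesis by (simp only: half mult_1)
  qed
  finally show ?thesis .
qed

lemma energy_midpoint_hull_le:
  assumes Q: "continuous_on UNIV Q" "\<And>x. 0 \<le> Q x" "midconvex Q" and S: "S \<subseteq> L2"
    and le: "\<And>v. v \<in> S \<Longrightarrow> energy Q v \<le> c" and w: "w \<in> midpoint_hull S"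
  shows "energy Q w \<le> c"
  using w by induction (use le in \<open>auto intro!: energy_midpoint_le[OF Q] midpoint_hull_L2[OF S]\<close>)

lemma primitive_midpoint_hull:
  fixes S :: "(real \<Rightarrow> 'a::banach) set"
  assumes S: "S \<subseteq> L2" and t: "t \<in> {0..1}" and le: "\<And>v. v \<in> S \<Longrightarrow> norm (primitive v t - x) \<le> e"
    and w: "w \<in> midpoint_hull S"
  shows "norm (primitive w t - x) \<le> e"
  using w
proof induction
  case (midpoint v w)
  have "primitive (\<lambda>t. (1/2) *\<^sub>R v t + (1/2) *\<^sub>R w t) t - x =
      (1/2) *\<^sub>R (primitive v t - x) + (1/2) *\<^sub>R (primitive w t - x)"
    using primitive_linear_combination[OF midpoint_hull_L2[OF S midpoint(1)] midpoint_hull_L2[OF S midpoint(2)] t, of "1/2" "1/2"]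
    by (simp add: algebra_simps flip: scaleR_add_left)
  also have "norm \<dots> \<le> (1/2) * norm (primitive v t - x) + (1/2) * norm (primitive w t - x)"
    using norm_triangle_ineq[of "(1/2) *\<^sub>R (primitive v t - x)" "(1/2) *\<^sub>R (primitive w t - x)"] by simp
  finally show ?case using midpoint(3,4) by simp
qed (use le in auto)

lemma midconvex_seminorm_square:
  assumes p: "contractive_seminorm p"
  shows "midconvex (\<lambda>x. (p x)\<^sup>2)" "continuous_on UNIV (\<lambda>x. (p x)\<^sup>2)"
proof -
  show "continuous_on UNIV (\<lambda>x. (p x)\<^sup>2)"
    by (intro continuous_intros contractive_seminorm_continuous p)
  show "midconvex (\<lambda>x. (p x)\<^sup>2)"
    unfolding midconvex_def
  proof (intro allI)
    fix x y
    have "p ((1/2) *\<^sub>R x + (1/2) *\<^sub>R y) \<le> p x / 2 + p y / 2"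
      using contractive_seminormD(1)[OF p, of "(1/2) *\<^sub>R x" "(1/2) *\<^sub>R y"]
      by (simp add: contractive_seminormD(2)[OF p])
    then have "(p ((1/2) *\<^sub>R x + (1/2) *\<^sub>R y))\<^sup>2 \<le> (p x / 2 + p y / 2)\<^sup>2"
      by (intro power_mono contractive_seminorm_simps(3)[OF p])
    also have "\<dots> \<le> 2 * (p x / 2)\<^sup>2 + 2 * (p y / 2)\<^sup>2" by (rule power2_add_le)
    finally show "(p ((1/2) *\<^sub>R x + (1/2) *\<^sub>R y))\<^sup>2 \<le> (p x)\<^sup>2 / 2 + (p y)\<^sup>2 / 2"
      by (simp add: power_divide)
  qed
qed

lemma seminorm_square_diff_le:
  assumes p: "contractive_seminorm p"
  shows "(p (x - y))\<^sup>2 \<le> 2 * (p x)\<^sup>2 + 2 * (p y)\<^sup>2"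
proof -
  have "p (x - y) \<le> p x + p y"
    using contractive_seminormD(1)[OF p, of x "- y"] contractive_seminorm_simps(2)[OF p, of y] by simp
  then have "(p (x - y))\<^sup>2 \<le> (p x + p y)\<^sup>2"
    by (intro power_mono contractive_seminorm_simps(3)[OF p])
  then show ?thesis using power2_add_le[of "p x" "p y"] by linarith
qed

text \<open>
  Near-minimizers of the integral of \<open>\<psi>\<close> over the hulls of the tails are Cauchy for
  \<open>\<psi>\<close>. As midpoints inherit the bound on the integral of \<open>(p n)\<^sup>2\<close>,
  they are Cauchy in norm: choose \<open>n\<close> first to make the seminorm part small, then the index
  to make \<open>K\<close> times the \<open>\<psi>\<close> part small.
\<close>

lemma L2_Cauchy_midpoints:
  fixes v :: "nat \<Rightarrow> real \<Rightarrow> 'a::banach"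
  assumes v: "\<And>k. v k \<in> L2" and R: "\<And>k. energy (\<lambda>x. (norm x)\<^sup>2) (v k) \<le> ennreal R" "0 \<le> R"
    and p: "\<And>n. contractive_seminorm (p n)"
    and small: "\<And>n k. n \<le> k \<Longrightarrow> energy (\<lambda>x. (p n x)\<^sup>2) (v k) \<le> ennreal (\<theta> n)"
    and \<theta>: "\<And>n. 0 \<le> \<theta> n" "\<theta> \<longlonglongrightarrow> 0"
    and \<psi>: "continuous_on UNIV \<psi>" "\<And>x. 0 \<le> \<psi> x" "\<And>x. \<psi> x \<le> 2 * (norm x)\<^sup>2"
    "\<And>x y. \<psi> ((1/2) *\<^sub>R x + (1/2) *\<^sub>R y) + \<psi> (x - y) / 4 = \<psi> x / 2 + \<psi> y / 2"
    "\<And>n. \<exists>K\<ge>0. \<forall>x. (norm x)\<^sup>2 \<le> K * \<psi> x + 18 * (p n x)\<^sup>2"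
  obtains w where "\<And>k. w k \<in> midpoint_hull (v ` {k..})"
    "\<And>e. e > 0 \<Longrightarrow> \<exists>K. \<forall>k\<ge>K. \<forall>l\<ge>k. energy (\<lambda>x. (norm x)\<^sup>2) (\<lambda>t. w k t - w l t) \<le> ennreal e"
proof -
  define H where "H k = midpoint_hull (v ` {k..})" for k
  have HL: "w \<in> L2" if "w \<in> H k" for w k
    using that v unfolding H_def by (intro midpoint_hull_L2[of "v ` {k..}" w]) auto
  have hull_le: "energy (\<lambda>x. (q x)\<^sup>2) w \<le> c"
    if q: "contractive_seminorm q" and le: "\<And>j. k \<le> j \<Longrightarrow> energy (\<lambda>x. (q x)\<^sup>2) (v j) \<le> c"
      and w: "w \<in> H k" for q c w k
  proof (rule energy_midpoint_hull_le)
    show "w \<in> midpoint_hull (v ` {k..})" using w by (simp add: H_def)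
    show "v ` {k..} \<subseteq> L2" using v by blast
    show "energy (\<lambda>x. (q x)\<^sup>2) u \<le> c" if "u \<in> v ` {k..}" for u using that le by auto
  qed (simp_all add: midconvex_seminorm_square[OF q])
  define \<Psi> where "\<Psi> w = enn2real (energy \<psi> w)" for w
  have fin: "energy \<psi> w = ennreal (\<Psi> w)" if w: "w \<in> L2" for w
  proof -
    have "energy \<psi> w \<le> energy (\<lambda>x. 2 * (norm x)\<^sup>2) w" by (intro energy_mono \<psi>)
    also have "\<dots> = ennreal 2 * energy (\<lambda>x. (norm x)\<^sup>2) w"
      unfolding energy_def using borel_measurable_compose_L2[OF w, of "\<lambda>x. (norm x)\<^sup>2"]
      by (simp add: ennreal_mult continuous_intros nn_integral_cmult)
    also have "\<dots> < \<infinity>" using L2D(2)[OF w] by (simp add: ennreal_mult_less_top)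
    finally show ?thesis by (simp add: \<Psi>_def)
  qed
  have nn: "0 \<le> \<Psi> w" for w by (simp add: \<Psi>_def)
  have up: "\<Psi> w \<le> 2 * R" if "w \<in> H 0" for w
  proof -
    have "energy (\<lambda>x. (norm x)\<^sup>2) w \<le> ennreal R"
      by (rule hull_le[OF contractive_seminorm_norm R(1) that])
    have "energy \<psi> w \<le> energy (\<lambda>x. 2 * (norm x)\<^sup>2) w" by (intro energy_mono \<psi>)
    also have "\<dots> = ennreal 2 * energy (\<lambda>x. (norm x)\<^sup>2) w"
      unfolding energy_def using borel_measurable_compose_L2[OF HL[OF that], of "\<lambda>x. (norm x)\<^sup>2"]
      by (simp add: ennreal_mult continuous_intros nn_integral_cmult)
    also have "\<dots> \<le> ennreal 2 * ennreal R"
      by (intro mult_left_mono \<open>energy (\<lambda>x. (norm x)\<^sup>2) w \<le> ennreal R\<close>) simp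
    also have "\<dots> = ennreal (2 * R)" using R(2) by (simp add: ennreal_mult)
    finally show ?thesis using fin[OF HL[OF that]] R(2) by (simp add: ennreal_le_iff)
  qed
  have par: "\<Psi> (\<lambda>t. (1/2) *\<^sub>R x t + (1/2) *\<^sub>R y t) + \<Psi> (\<lambda>t. x t - y t) / 4 = \<Psi> x / 2 + \<Psi> y / 2"
    if x: "x \<in> L2" and y: "y \<in> L2" for x y
  proof -
    let ?m = "\<lambda>t. (1/2) *\<^sub>R x t + (1/2) *\<^sub>R y t" and ?d = "\<lambda>t. x t - y t"
    have m: "?m \<in> L2" and d: "?d \<in> L2"
      using x y by (auto intro!: L2_linear_combination L2_diff)
    note meas = borel_measurable_compose_L2[OF _ \<psi>(1)]
    note [measurable] = meas[OF x] meas[OF y] meas[OF m] meas[OF d]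
    have "(\<integral>\<^sup>+t. ennreal (4 * \<psi> (?m t)) + ennreal (\<psi> (?d t)) \<partial>unit_lebesgue) =
        (\<integral>\<^sup>+t. ennreal (2 * \<psi> (x t)) + ennreal (2 * \<psi> (y t)) \<partial>unit_lebesgue)"
    proof (intro nn_integral_cong)
      fix t
      have "4 * \<psi> (?m t) + \<psi> (?d t) = 2 * \<psi> (x t) + 2 * \<psi> (y t)"
        using \<psi>(4)[of "x t" "y t"] by simp
      then show "ennreal (4 * \<psi> (?m t)) + ennreal (\<psi> (?d t)) = ennreal (2 * \<psi> (x t)) + ennreal (2 * \<psi> (y t))"
        using \<psi>(2) by (simp flip: ennreal_plus)
    qed
    then have "ennreal 4 * energy \<psi> ?m + energy \<psi> ?d = ennreal 2 * energy \<psi> x + ennreal 2 * energy \<psi> y"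
      unfolding energy_def using \<psi>(2) by (simp add: nn_integral_add nn_integral_cmult ennreal_mult)
    then have "ennreal (4 * \<Psi> ?m + \<Psi> ?d) = ennreal (2 * \<Psi> x + 2 * \<Psi> y)"
      using nn by (simp add: fin[OF x] fin[OF y] fin[OF m] fin[OF d] ennreal_mult)
    then have "4 * \<Psi> ?m + \<Psi> ?d = 2 * \<Psi> x + 2 * \<Psi> y"
      using nn by (subst (asm) ennreal_inj) (auto intro!: add_nonneg_nonneg)
    then show ?thesis by simp
  qed
  obtain w where w: "\<And>k. w k \<in> H k"
    and Cw: "\<And>e. e > 0 \<Longrightarrow> \<exists>K. \<forall>k\<ge>K. \<forall>l\<ge>k. \<Psi> (\<lambda>t. w k t - w l t) \<le> e"
  proof (rule near_minimizers_Cauchy[where H=H and \<Psi>=\<Psi> and C="2 * R"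
        and mid="\<lambda>x y t. (1/2) *\<^sub>R x t + (1/2) *\<^sub>R y t" and \<Delta>="\<lambda>x y. \<Psi> (\<lambda>t. x t - y t)"])
    show "H l \<subseteq> H k" if "k \<le> l" for k l
      unfolding H_def using that by (intro midpoint_hull_mono) auto
    show "H k \<noteq> {}" for k
      unfolding H_def using midpoint_hull.base[of "v k" "v ` {k..}"] by auto
    show "(\<lambda>t. (1/2) *\<^sub>R x t + (1/2) *\<^sub>R y t) \<in> H k" if "x \<in> H k" "y \<in> H k" for k x y
      using that unfolding H_def by (rule midpoint_hull.midpoint)
    show "\<Psi> (\<lambda>t. (1/2) *\<^sub>R x t + (1/2) *\<^sub>R y t) + \<Psi> (\<lambda>t. x t - y t) / 4 = \<Psi> x / 2 + \<Psi> y / 2"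
      if "x \<in> H 0" "y \<in> H 0" for x y
      using that HL by (intro par)
  qed (use nn up in auto)
  have small_w: "energy (\<lambda>x. (p n x)\<^sup>2) (w k) \<le> ennreal (\<theta> n)" if "n \<le> k" for n k
    using that by (intro hull_le[OF p _ w[of k]] small) simp
  have "\<exists>K. \<forall>k\<ge>K. \<forall>l\<ge>k. energy (\<lambda>x. (norm x)\<^sup>2) (\<lambda>t. w k t - w l t) \<le> ennreal e" if e: "e > 0" for e
  proof -
    have "\<forall>\<^sub>F n in sequentially. \<theta> n < e / 144"
      by (rule order_tendstoD(2)[OF \<theta>(2)]) (use e in simp)
    then obtain n where n: "\<theta> n < e / 144"
      using eventually_happens'[OF sequentially_bot] by blast
    obtain K where K: "K \<ge> 0" "\<And>x. (norm x)\<^sup>2 \<le> K * \<psi> x + 18 * (p n x)\<^sup>2"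
      using \<psi>(5)[of n] by blast
    obtain k0 where k0: "\<And>k l. k0 \<le> k \<Longrightarrow> k \<le> l \<Longrightarrow> \<Psi> (\<lambda>t. w k t - w l t) \<le> e / (2 * (K + 1))"
      using Cw[of "e / (2 * (K + 1))"] e K(1) by auto
    have "energy (\<lambda>x. (norm x)\<^sup>2) (\<lambda>t. w k t - w l t) \<le> ennreal e" if kl: "max k0 n \<le> k" "k \<le> l" for k l
    proof -
      have wk: "w k \<in> L2" and wl: "w l \<in> L2" using HL[OF w] by auto
      note d = L2_diff[OF wk wl]
      note cp = midconvex_seminorm_square(2)[OF p, of n]
      note [measurable] = borel_measurable_compose_L2[OF d \<psi>(1)] borel_measurable_compose_L2[OF wk cp]
        borel_measurable_compose_L2[OF wl cp]
      have "energy (\<lambda>x. (norm x)\<^sup>2) (\<lambda>t. w k t - w l t) \<le>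
        (\<integral>\<^sup>+t. ennreal (K * \<psi> (w k t - w l t)) + (ennreal (36 * (p n (w k t))\<^sup>2)
            + ennreal (36 * (p n (w l t))\<^sup>2)) \<partial>unit_lebesgue)"
        unfolding energy_def
      proof (intro nn_integral_mono)
        fix t
        have "(norm (w k t - w l t))\<^sup>2 \<le> K * \<psi> (w k t - w l t) + (36 * (p n (w k t))\<^sup>2 + 36 * (p n (w l t))\<^sup>2)"
          using K(2)[of "w k t - w l t"] seminorm_square_diff_le[OF p, of n "w k t" "w l t"] by linarith
        then show "ennreal ((norm (w k t - w l t))\<^sup>2) \<le> ennreal (K * \<psi> (w k t - w l t)) +
            (ennreal (36 * (p n (w k t))\<^sup>2) + ennreal (36 * (p n (w l t))\<^sup>2))"
          using K(1) \<psi>(2) by (simp add: ennreal_leI flip: ennreal_plus)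
      qed
      also have "\<dots> = ennreal K * energy \<psi> (\<lambda>t. w k t - w l t) +
          (ennreal 36 * energy (\<lambda>x. (p n x)\<^sup>2) (w k) + ennreal 36 * energy (\<lambda>x. (p n x)\<^sup>2) (w l))"
        unfolding energy_def using K(1) \<psi>(2) by (simp add: nn_integral_add nn_integral_cmult ennreal_mult)
      also have "\<dots> \<le> ennreal K * ennreal (e / (2 * (K + 1))) + (ennreal 36 * ennreal (\<theta> n) + ennreal 36 * ennreal (\<theta> n))"
        using kl k0[of k l] by (intro add_mono mult_left_mono small_w) (auto simp: fin[OF d] ennreal_leI)
      also have "\<dots> = ennreal (K * (e / (2 * (K + 1))) + (36 * \<theta> n + 36 * \<theta> n))"
      proof -
        have a: "ennreal K * ennreal (e / (2 * (K + 1))) = ennreal (K * (e / (2 * (K + 1))))"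
          by (rule ennreal_mult'[OF K(1), symmetric])
        have b: "ennreal 36 * ennreal (\<theta> n) = ennreal (36 * \<theta> n)"
          by (rule ennreal_mult'[symmetric]) simp
        have nonneg: "0 \<le> K * (e / (2 * (K + 1)))" "0 \<le> 36 * \<theta> n"
          using K(1) e \<theta>(1)[of n] by auto
        show ?thesis
          by (simp only: a b ennreal_plus nonneg add_nonneg_nonneg)
      qed
      also have "\<dots> \<le> ennreal e"
      proof (rule ennreal_leI)
        have "K * (e / (2 * (K + 1))) \<le> e / 2" using K(1) e by (simp add: field_simps)
        then show "K * (e / (2 * (K + 1))) + (36 * \<theta> n + 36 * \<theta> n) \<le> e" using n by linarith
      qed
      finally show ?thesis .
    qed
    then show ?thesis by blast
  qed
  with w show thesis using that unfolding H_def by blast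
qed

section \<open>Compactness of nearly finite-dimensional sequences\<close>

lemma primitive_energy_le:
  fixes v :: "real \<Rightarrow> 'a::banach"
  assumes p: "contractive_seminorm p" and v: "v \<in> L2" and t: "t \<in> {0..1}"
    and le: "energy (\<lambda>x. (p x)\<^sup>2) v \<le> ennreal c" and c: "0 \<le> c"
  shows "(p (primitive v t))\<^sup>2 \<le> c"
  using order_trans[OF primitive_seminorm_le[OF p v t] le] c by (simp add: ennreal_le_iff)

lemma Cauchy_of_norming_functionals:
  fixes x :: "nat \<Rightarrow> 'a::real_normed_vector" and \<phi> :: "nat \<Rightarrow> 'a \<Rightarrow> real"
  assumes \<phi>: "\<And>i. contractive_functional (\<phi> i)"
    and ctl: "\<And>n x. norm x \<le> 2 * (\<Sum>i<m n. \<bar>\<phi> i x\<bar>) + 3 * p n x"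
    and p: "\<And>n. contractive_seminorm (p n)"
    and small: "\<And>n k. n \<le> k \<Longrightarrow> (p n (x k))\<^sup>2 \<le> \<theta> n" and \<theta>: "\<theta> \<longlonglongrightarrow> 0"
    and conv: "\<And>i. convergent (\<lambda>k. \<phi> i (x k))"
  shows "Cauchy x"
proof (rule metric_CauchyI)
  fix e :: real assume e: "0 < e"
  have "\<forall>\<^sub>F n in sequentially. \<theta> n < (e / 16)\<^sup>2"
    by (rule order_tendstoD(2)[OF \<theta>]) (use e in simp)
  then obtain n where n: "\<theta> n < (e / 16)\<^sup>2"
    using eventually_happens'[OF sequentially_bot] by blast
  have pk: "p n (x k) \<le> e / 16" if "n \<le> k" for k
  proof (rule power2_le_imp_le)
    show "(p n (x k))\<^sup>2 \<le> (e / 16)\<^sup>2" using small[OF that] n by linarith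
    show "0 \<le> e / 16" using e by simp
  qed
  obtain l where l: "\<And>i. (\<lambda>k. \<phi> i (x k)) \<longlonglongrightarrow> l i"
    using conv unfolding convergent_def by metis
  have "(\<lambda>k. \<Sum>i<m n. \<bar>\<phi> i (x k) - l i\<bar>) \<longlonglongrightarrow> (\<Sum>i<m n. \<bar>l i - l i\<bar>)"
    by (intro tendsto_intros l)
  then have "(\<lambda>k. \<Sum>i<m n. \<bar>\<phi> i (x k) - l i\<bar>) \<longlonglongrightarrow> 0" by simp
  then have "\<forall>\<^sub>F k in sequentially. (\<Sum>i<m n. \<bar>\<phi> i (x k) - l i\<bar>) < e / 8"
    by (rule order_tendstoD(2)) (use e in simp)
  then obtain k0 where k0: "\<And>k. k0 \<le> k \<Longrightarrow> (\<Sum>i<m n. \<bar>\<phi> i (x k) - l i\<bar>) < e / 8"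
    unfolding eventually_sequentially by blast
  have "dist (x k) (x j) < e" if "max k0 n \<le> k" "max k0 n \<le> j" for k j
  proof -
    have "(\<Sum>i<m n. \<bar>\<phi> i (x k - x j)\<bar>) \<le> (\<Sum>i<m n. \<bar>\<phi> i (x k) - l i\<bar> + \<bar>\<phi> i (x j) - l i\<bar>)"
      by (intro sum_mono) (simp add: contractive_functionalD(4)[OF \<phi>])
    also have "\<dots> < e / 8 + e / 8"
      unfolding sum.distrib using that by (intro add_strict_mono k0) auto
    finally have 1: "(\<Sum>i<m n. \<bar>\<phi> i (x k - x j)\<bar>) < e / 8 + e / 8" .
    have 2: "p n (x k - x j) \<le> e / 16 + e / 16"
      using contractive_seminormD(1)[OF p, of n "x k" "- x j"] contractive_seminorm_simps(2)[OF p, of n "x j"]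
        pk[of k] pk[of j] that by simp
    have "norm (x k - x j) < e"
      using ctl[of "x k - x j" n] 1 2 e by linarith
    then show ?thesis by (simp add: dist_norm)
  qed
  then show "\<exists>K. \<forall>k\<ge>K. \<forall>j\<ge>K. dist (x k) (x j) < e" by blast
qed

text \<open>
  The scalars \<open>\<phi> i (primitive (v k) q)\<close> with rational \<open>q\<close> are countably
  many bounded sequences, so a diagonal subsequence makes all of them converge. The smallness of the
  seminorms upgrades this to convergence in norm at rational times, and equicontinuity extends it to all
  times.
\<close>

lemma primitives_convergent_subsequence:
  fixes v :: "nat \<Rightarrow> real \<Rightarrow> 'a::banach" and \<phi> :: "nat \<Rightarrow> 'a \<Rightarrow> real"
  assumes v: "\<And>k. v k \<in> L2" and R: "\<And>k. energy (\<lambda>x. (norm x)\<^sup>2) (v k) \<le> ennreal R" "0 \<le> R"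
    and p: "\<And>n. contractive_seminorm (p n)"
    and small: "\<And>n k. n \<le> k \<Longrightarrow> energy (\<lambda>x. (p n x)\<^sup>2) (v k) \<le> ennreal (\<theta> n)"
    and \<theta>: "\<And>n. 0 \<le> \<theta> n" "\<theta> \<longlonglongrightarrow> 0"
    and \<phi>: "\<And>i. contractive_functional (\<phi> i)"
    and ctl: "\<And>n x. norm x \<le> 2 * (\<Sum>i<m n. \<bar>\<phi> i x\<bar>) + 3 * p n x"
  obtains r u where "strict_mono (r::nat\<Rightarrow>nat)"
    "\<And>t. t \<in> {0..1} \<Longrightarrow> (\<lambda>k. primitive (v (r k)) t) \<longlonglongrightarrow> u t"
proof -
  define f where "f k = (\<lambda>(i, q). \<phi> i (primitive (v k) q))" for k
  define S where "S = (UNIV :: nat set) \<times> (\<rat> \<inter> {0..1::real})"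
  have "countable S" unfolding S_def by (intro countable_SIGMA countable_Int1 countable_rat) auto
  moreover have "norm (f k x) \<le> sqrt R" if x: "x \<in> S" for k x
  proof -
    obtain i q where iq: "x = (i, q)" by (cases x)
    then have q: "q \<in> {0..1}" using x by (simp add: S_def)
    have "norm (f k x) \<le> norm (primitive (v k) q)"
      using contractive_functionalD(2)[OF \<phi>] by (simp add: f_def iq)
    also have "\<dots> \<le> sqrt R"
      by (rule real_le_rsqrt[OF primitive_energy_le[OF contractive_seminorm_norm v q R]])
    finally show ?thesis .
  qed
  ultimately obtain r where r: "strict_mono (r::nat\<Rightarrow>nat)" "\<And>x. x \<in> S \<Longrightarrow> \<exists>l. (\<lambda>k. f (r k) x) \<longlonglongrightarrow> l"
    using function_convergent_subsequence[of S f "sqrt R"] by blast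
  have rat: "Cauchy (\<lambda>k. primitive (v (r k)) q)" if q: "q \<in> \<rat> \<inter> {0..1}" for q
  proof (rule Cauchy_of_norming_functionals[OF \<phi> ctl p _ \<theta>(2)])
    show "(p n (primitive (v (r k)) q))\<^sup>2 \<le> \<theta> n" if "n \<le> k" for n k
      using q that seq_suble[OF r(1), of k] by (intro primitive_energy_le p v small \<theta>) auto
    show "convergent (\<lambda>k. \<phi> i (primitive (v (r k)) q))" for i
      using r(2)[of "(i, q)"] q by (auto simp: f_def S_def convergent_def)
  qed
  have "\<exists>l. (\<lambda>k. primitive (v (r k)) t) \<longlonglongrightarrow> l" if t: "t \<in> {0..1}" for t
  proof -
    have "Cauchy (\<lambda>k. primitive (v (r k)) t)"
    proof (rule metric_CauchyI)
      fix e :: real assume e: "0 < e"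
      \<comment> \<open>The summand \<open>1\<close> avoids a division by zero.\<close>
      define \<delta> where "\<delta> = (e / 3)\<^sup>2 / (R + 1)"
      have \<delta>: "0 < \<delta>" using e R(2) by (simp add: \<delta>_def)
      have "max 0 (t - \<delta>) < min 1 (t + \<delta>)" using t \<delta> by auto
      then obtain q where q: "q \<in> \<rat>" "max 0 (t - \<delta>) < q" "q < min 1 (t + \<delta>)"
        using Rats_dense_in_real by blast
      then have q01: "q \<in> {0..1}" by auto
      have near: "norm (primitive (v k) t - primitive (v k) q) \<le> e / 3" for k
      proof -
        have "(norm (primitive (v k) t - primitive (v k) q))\<^sup>2 \<le> \<bar>t - q\<bar> * R"
          by (rule primitive_equicontinuous[OF v R q01 t])
        also have "\<dots> \<le> \<delta> * (R + 1)" using q R(2) \<delta> by (intro mult_mono) auto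
        also have "\<dots> = (e / 3)\<^sup>2" using R(2) by (simp add: \<delta>_def)
        finally show ?thesis by (rule power2_le_imp_le) (use e in simp)
      qed
      obtain K where K: "\<And>k j. K \<le> k \<Longrightarrow> K \<le> j \<Longrightarrow> dist (primitive (v (r k)) q) (primitive (v (r j)) q) < e / 3"
        using metric_CauchyD[OF rat[of q], of "e / 3"] q(1) q01 e by auto
      have "dist (primitive (v (r k)) t) (primitive (v (r j)) t) < e" if "K \<le> k" "K \<le> j" for k j
      proof -
        have "dist (primitive (v (r k)) t) (primitive (v (r k)) q) \<le> e / 3"
          "dist (primitive (v (r j)) q) (primitive (v (r j)) t) \<le> e / 3"
          using near[of "r k"] near[of "r j"] by (simp_all add: dist_norm norm_minus_commute)
        with K[OF that] show ?thesis
          using dist_triangle[of "primitive (v (r k)) t" "primitive (v (r j)) t" "primitive (v (r k)) q"]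
            dist_triangle[of "primitive (v (r k)) q" "primitive (v (r j)) t" "primitive (v (r j)) q"]
          by linarith
      qed
      then show "\<exists>K. \<forall>k\<ge>K. \<forall>j\<ge>K. dist (primitive (v (r k)) t) (primitive (v (r j)) t) < e" by blast
    qed
    then show ?thesis using Cauchy_convergent convergent_def by blast
  qed
  then obtain u where "\<And>t. t \<in> {0..1} \<Longrightarrow> (\<lambda>k. primitive (v (r k)) t) \<longlonglongrightarrow> u t" by metis
  with r(1) show thesis using that by blast
qed

text \<open>
  The velocities converge only after passing to midpoints, so their energies are controlled only for
  midpoint convex integrands, whereas the primitives converge themselves. The limit \<open>w\<close> of
  the midpoints has the right primitive because midpoints of points of a ball stay in the ball.
\<close>

lemma compactness_of_nearly_finite_dimensional_sequence:
  fixes v :: "nat \<Rightarrow> real \<Rightarrow> 'a::banach"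
  assumes v: "\<And>k. v k \<in> L2" and R: "\<And>k. energy (\<lambda>x. (norm x)\<^sup>2) (v k) \<le> ennreal R" "0 \<le> R"
    and F: "\<And>n. finite (F n)"
    and small: "\<And>n k. n \<le> k \<Longrightarrow> energy (\<lambda>x. (infdist x (span (F n)))\<^sup>2) (v k) \<le> ennreal (\<theta> n)"
    and \<theta>: "\<And>n. 0 \<le> \<theta> n" "\<theta> \<longlonglongrightarrow> 0"
  obtains r w where "strict_mono (r::nat\<Rightarrow>nat)" "w \<in> L2"
    "\<And>t. t \<in> {0..1} \<Longrightarrow> (\<lambda>k. primitive (v (r k)) t) \<longlonglongrightarrow> primitive w t"
    "\<And>Q c. continuous_on UNIV Q \<Longrightarrow> (\<And>x. 0 \<le> Q x) \<Longrightarrow> midconvex Q \<Longrightarrow>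
      (\<forall>\<^sub>F k in sequentially. energy Q (v (r k)) \<le> c) \<Longrightarrow> energy Q w \<le> c"
proof -
  define p where "p n x = infdist x (span (F n))" for n and x :: 'a
  have p: "contractive_seminorm (p n)" for n
    unfolding p_def by (intro contractive_seminorm_infdist_subspace) simp
  have small_p: "energy (\<lambda>x. (p n x)\<^sup>2) (v k) \<le> ennreal (\<theta> n)" if "n \<le> k" for n k
    using small[OF that] by (simp add: p_def)
  obtain \<phi> :: "nat \<Rightarrow> 'a \<Rightarrow> real" and m where \<phi>: "\<And>i. contractive_functional (\<phi> i)"
    and norming: "\<And>n x. norm x \<le> 2 * (\<Sum>i<m n. \<bar>\<phi> i x\<bar>) + 3 * infdist x (span (F n))"
    by (rule norming_sequence_exists[of F, OF F]) blast
  have ctl: "norm x \<le> 2 * (\<Sum>i<m n. \<bar>\<phi> i x\<bar>) + 3 * p n x" for n x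
    unfolding p_def by (rule norming)
  obtain \<psi> :: "'a \<Rightarrow> real" where \<psi>: "continuous_on UNIV \<psi>" "\<And>x. 0 \<le> \<psi> x" "\<And>x. \<psi> x \<le> 2 * (norm x)\<^sup>2"
    "\<And>x y. \<psi> ((1/2) *\<^sub>R x + (1/2) *\<^sub>R y) + \<psi> (x - y) / 4 = \<psi> x / 2 + \<psi> y / 2"
    "\<And>n. \<exists>K\<ge>0. \<forall>x. (norm x)\<^sup>2 \<le> K * \<psi> x + 18 * (p n x)\<^sup>2"
    by (rule quadratic_control_exists[of \<phi> m p, OF \<phi> ctl contractive_seminorm_simps(3)[OF p]]) blast
  have "\<exists>r u. strict_mono (r::nat\<Rightarrow>nat) \<and> (\<forall>t\<in>{0..1}. (\<lambda>k. primitive (v (r k)) t) \<longlonglongrightarrow> u t)"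
    by (rule primitives_convergent_subsequence[of v R p \<theta> \<phi> m, OF v R p small_p \<theta> \<phi> ctl])
       (assumption, blast)
  then obtain r u where r: "strict_mono (r::nat\<Rightarrow>nat)"
    and u: "\<And>t. t \<in> {0..1} \<Longrightarrow> (\<lambda>k. primitive (v (r k)) t) \<longlonglongrightarrow> u t" by blast
  define V where "V k = v (r k)" for k
  have V: "V k \<in> L2" "energy (\<lambda>x. (norm x)\<^sup>2) (V k) \<le> ennreal R" for k
    using v R by (simp_all add: V_def)
  have small_V: "energy (\<lambda>x. (p n x)\<^sup>2) (V k) \<le> ennreal (\<theta> n)" if "n \<le> k" for n k
    using small_p[of n "r k"] seq_suble[OF r, of k] that by (simp add: V_def)
  have VL: "V ` {k..} \<subseteq> L2" for k using V by blast
  obtain y where y: "\<And>k. y k \<in> midpoint_hull (V ` {k..})"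
    and Cy: "\<And>e. e > 0 \<Longrightarrow> \<exists>K. \<forall>k\<ge>K. \<forall>l\<ge>k. energy (\<lambda>x. (norm x)\<^sup>2) (\<lambda>t. y k t - y l t) \<le> ennreal e"
    by (rule L2_Cauchy_midpoints[of V R p \<theta> \<psi>, OF V R(2) p small_V \<theta> \<psi>]) (assumption, blast)
  have yL: "y k \<in> L2" for k by (rule midpoint_hull_L2[OF VL y])
  obtain w s where w: "w \<in> L2" and s: "strict_mono (s::nat\<Rightarrow>nat)"
    and lim: "AE t in unit_lebesgue. (\<lambda>k. y (s k) t) \<longlonglongrightarrow> w t"
    and close: "\<And>e. e > 0 \<Longrightarrow> \<forall>\<^sub>F k in sequentially. energy (\<lambda>x. (norm x)\<^sup>2) (\<lambda>t. w t - y k t) \<le> ennreal e"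
  proof (rule L2_complete[of y])
    show "y k \<in> L2" for k by (rule yL)
    show "\<exists>K. \<forall>k\<ge>K. \<forall>l\<ge>k. energy (\<lambda>x. (norm x)\<^sup>2) (\<lambda>t. y k t - y l t) \<le> ennreal e" if "e > 0" for e
      by (rule Cy[OF that])
  qed (rule that)
  have prim: "primitive w t = u t" if t: "t \<in> {0..1}" for t
  proof -
    have "norm (primitive w t - u t) \<le> 0 + e" if e: "e > 0" for e
    proof -
      have "\<forall>\<^sub>F k in sequentially. dist (primitive (V k) t) (u t) < e / 2"
        using tendstoD[OF u[OF t], of "e / 2"] e by (simp add: V_def)
      then obtain K where K: "\<And>k. K \<le> k \<Longrightarrow> norm (primitive (V k) t - u t) \<le> e / 2"
        unfolding eventually_sequentially by (auto simp: dist_norm intro: less_imp_le)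
      have "\<forall>\<^sub>F k in sequentially. K \<le> k \<and> energy (\<lambda>x. (norm x)\<^sup>2) (\<lambda>t. w t - y k t) \<le> ennreal ((e / 2)\<^sup>2)"
        using e by (intro eventually_conj eventually_ge_at_top close) simp
      then obtain k where k: "K \<le> k" "energy (\<lambda>x. (norm x)\<^sup>2) (\<lambda>t. w t - y k t) \<le> ennreal ((e / 2)\<^sup>2)"
        using eventually_happens'[OF sequentially_bot] by blast
      have "norm (primitive (y k) t - u t) \<le> e / 2"
      proof (rule primitive_midpoint_hull[OF VL t _ y])
        show "norm (primitive x t - u t) \<le> e / 2" if "x \<in> V ` {k..}" for x
          using that K k(1) by auto
      qed
      moreover have "(norm (primitive (\<lambda>t. w t - y k t) t))\<^sup>2 \<le> (e / 2)\<^sup>2"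
        by (rule primitive_energy_le[OF contractive_seminorm_norm L2_diff[OF w yL] t k(2)]) simp
      then have "norm (primitive (\<lambda>t. w t - y k t) t) \<le> e / 2"
        by (rule power2_le_imp_le) (use e in simp)
      then have "norm (primitive w t - primitive (y k) t) \<le> e / 2"
        using primitive_linear_combination[OF w yL t, of 1 "-1" k] by simp
      ultimately show ?thesis
        using norm_triangle_ineq[of "primitive w t - primitive (y k) t" "primitive (y k) t - u t"] by simp
    qed
    then have "norm (primitive w t - u t) \<le> 0" by (rule field_le_epsilon)
    then show ?thesis by simp
  qed
  show thesis
  proof (rule that[OF r w])
    show "(\<lambda>k. primitive (v (r k)) t) \<longlonglongrightarrow> primitive w t" if "t \<in> {0..1}" for t
      using u[OF that] prim[OF that] by simp
    fix Q :: "'a \<Rightarrow> real" and c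
    assume Q: "continuous_on UNIV Q" "\<And>x. 0 \<le> Q x" "midconvex Q"
      and le: "\<forall>\<^sub>F k in sequentially. energy Q (v (r k)) \<le> c"
    obtain K where K: "\<And>k. K \<le> k \<Longrightarrow> energy Q (V k) \<le> c"
      using le unfolding eventually_sequentially V_def by blast
    show "energy Q w \<le> c"
    proof (rule energy_le_of_AE_limit[OF _ lim Q(1)])
      show "y (s k) \<in> L2" for k by (rule yL)
      have "energy Q (y (s k)) \<le> c" if k: "K \<le> k" for k
      proof (rule energy_midpoint_hull_le[OF Q VL _ y])
        show "energy Q x \<le> c" if "x \<in> V ` {s k..}" for x
          using that K k seq_suble[OF s, of k] by auto
      qed
      then show "\<forall>\<^sub>F k in sequentially. energy Q (y (s k)) \<le> c"
        unfolding eventually_sequentially by blast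
    qed
  qed
qed

section \<open>Perturbing the norm along a minimizing sequence\<close>

lemma energy_add:
  assumes v: "v \<in> L2" and A: "continuous_on UNIV A" "\<And>x. 0 \<le> A x" and B: "continuous_on UNIV B" "\<And>x. 0 \<le> B x"
  shows "energy (\<lambda>x. A x + B x) v = energy A v + energy B v"
proof -
  note [measurable] = borel_measurable_compose_L2[OF v A(1)] borel_measurable_compose_L2[OF v B(1)]
  show ?thesis
    unfolding energy_def using A(2) B(2) by (simp add: nn_integral_add)
qed

lemma energy_cmult:
  assumes v: "v \<in> L2" and A: "continuous_on UNIV A" and c: "0 \<le> c"
  shows "energy (\<lambda>x. c * A x) v = ennreal c * energy A v"
proof -
  note [measurable] = borel_measurable_compose_L2[OF v A(1)]
  show ?thesis
    unfolding energy_def using c by (simp add: ennreal_mult' nn_integral_cmult)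
qed

definition potential :: "('a::real_normed_vector \<Rightarrow> ennreal) \<Rightarrow> (real \<Rightarrow> 'a) \<Rightarrow> ennreal" where
  "potential h v = (\<integral>\<^sup>+t. h (primitive v t) \<partial>unit_lebesgue)"

definition total_cost :: "('a::real_normed_vector \<Rightarrow> real) \<Rightarrow> ('a \<Rightarrow> ennreal) \<Rightarrow> (real \<Rightarrow> 'a) \<Rightarrow> ennreal" where
  "total_cost Q h v = energy Q v + potential h v"

lemma closed_sublevels_borel_measurable:
  fixes h :: "'a::topological_space \<Rightarrow> ennreal"
  assumes "\<And>c. closed {x. h x \<le> c}"
  shows "h \<in> borel_measurable borel"
  by (rule borel_measurableI_le) (use assms in simp)

lemma potential_integrand_measurable:
  fixes v :: "real \<Rightarrow> 'a::banach"
  assumes v: "v \<in> L2" and h: "\<And>c. closed {x. h x \<le> (c::ennreal)}"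
  shows "(\<lambda>t. h (primitive v t)) \<in> borel_measurable unit_lebesgue"
proof (rule measurable_compose[OF _ closed_sublevels_borel_measurable[OF h]])
  have "primitive v \<in> borel_measurable (restrict_space borel {0..1})"
    by (rule borel_measurable_continuous_on_restrict[OF continuous_on_primitive[OF v]])
  note b = this
  show "primitive v \<in> borel_measurable unit_lebesgue"
  proof (rule measurableI)
    fix A :: "'a set" assume A: "A \<in> sets borel"
    have "primitive v -` A \<inter> {0..1} \<in> sets (restrict_space borel {0..1})"
      using measurable_sets[OF b A] by (simp add: space_restrict_space)
    then show "primitive v -` A \<inter> space unit_lebesgue \<in> sets unit_lebesgue"
      by (auto simp: sets_restrict_space)
  qed simp
qed

lemma closed_sublevels_le_liminf:
  fixes h :: "'a::topological_space \<Rightarrow> ennreal"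
  assumes h: "\<And>c. closed {x. h x \<le> c}" and lim: "x \<longlonglongrightarrow> y"
  shows "h y \<le> liminf (\<lambda>k. h (x k))"
  unfolding le_Liminf_iff
proof (intro allI impI)
  fix c assume c: "c < h y"
  have "open {z. c < h z}"
    using h[of c] by (simp add: closed_def Collect_neg_eq[symmetric] not_le)
  from topological_tendstoD[OF lim this] c show "\<forall>\<^sub>F k in sequentially. c < h (x k)" by simp
qed

lemma potential_le_liminf:
  fixes v :: "nat \<Rightarrow> real \<Rightarrow> 'a::banach"
  assumes h: "\<And>c. closed {x. h x \<le> (c::ennreal)}" and v: "\<And>k. v k \<in> L2"
    and lim: "\<And>t. t \<in> {0..1} \<Longrightarrow> (\<lambda>k. primitive (v k) t) \<longlonglongrightarrow> primitive w t"
  shows "potential h w \<le> liminf (\<lambda>k. potential h (v k))"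
proof -
  have "potential h w \<le> (\<integral>\<^sup>+t. liminf (\<lambda>k. h (primitive (v k) t)) \<partial>unit_lebesgue)"
    unfolding potential_def
    by (intro nn_integral_mono closed_sublevels_le_liminf[OF h] lim) simp
  also have "\<dots> \<le> liminf (\<lambda>k. potential h (v k))"
    unfolding potential_def by (intro nn_integral_liminf potential_integrand_measurable v h)
  finally show ?thesis .
qed

lemma zero_in_L2: "(\<lambda>_. 0) \<in> L2"
  by (simp add: L2_space_def simple_function_imp_strongly_measurable)

lemma total_cost_zero:
  fixes Q :: "'a::banach \<Rightarrow> real"
  assumes "Q 0 = 0"
  shows "total_cost Q h (\<lambda>_. 0) = h 0"
proof -
  have "primitive (\<lambda>_. 0 :: 'a) t = 0" if t: "t \<in> {0..1}" for t
    using primitive_linear_combination[OF zero_in_L2 zero_in_L2 t, of 0 0] by simp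
  then have "potential h (\<lambda>_. 0 :: 'a) = (\<integral>\<^sup>+t. h 0 \<partial>unit_lebesgue)"
    unfolding potential_def by (intro nn_integral_cong) simp
  then show ?thesis
    using assms emeasure_space_unit_lebesgue by (simp add: total_cost_def energy_def)
qed

lemma near_minimizer_exists:
  fixes Q :: "'a::banach \<Rightarrow> real"
  assumes Q: "Q 0 = 0" and h: "h 0 < \<infinity>" and \<tau>: "0 < \<tau>"
  obtains v where "v \<in> L2" "\<And>w. w \<in> L2 \<Longrightarrow> total_cost Q h v \<le> total_cost Q h w + ennreal \<tau>"
proof -
  define I where "I = (INF w\<in>L2. total_cost Q h w)"
  have "I \<le> h 0"
    unfolding I_def using zero_in_L2 by (rule INF_lower2) (simp add: total_cost_zero[of Q, OF Q])
  then have "I < I + ennreal \<tau>"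
    using h \<tau> by (cases I rule: ennreal_cases) (auto simp: top_unique ennreal_less_iff simp flip: ennreal_plus)
  then obtain v where v: "v \<in> L2" "total_cost Q h v < I + ennreal \<tau>"
    unfolding I_def by (auto simp: INF_less_iff)
  have "total_cost Q h v \<le> total_cost Q h w + ennreal \<tau>" if "w \<in> L2" for w
  proof -
    have "I \<le> total_cost Q h w" unfolding I_def using that by (rule INF_lower)
    then show ?thesis using v(2) by (meson add_right_mono less_imp_le order_trans)
  qed
  with v(1) show thesis using that by blast
qed

text \<open>
  The values of the simple functions that approximate \<open>v\<close> span subspaces whose distance to
  \<open>v t\<close> tends to zero for almost every \<open>t\<close>, dominated by the norm of \<open>v
  t\<close>.
\<close>

lemma finite_dimensional_approximation:
  fixes v :: "real \<Rightarrow> 'a::banach"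
  assumes v: "v \<in> L2" and F0: "finite F0" and \<tau>: "0 < \<tau>"
  obtains F where "finite F" "F0 \<subseteq> F" "energy (\<lambda>x. (infdist x (span F))\<^sup>2) v \<le> ennreal \<tau>"
proof -
  obtain s where s: "\<And>i::nat. simple_function unit_lebesgue (s i)"
    "AE t in unit_lebesgue. (\<lambda>i. s i t) \<longlonglongrightarrow> v t"
    using L2D(1)[OF v] unfolding strongly_measurable_def by blast
  define F where "F i = F0 \<union> s i ` {0..1}" for i
  have fin: "finite (F i)" for i
    using simple_functionD(1)[OF s(1)] F0 by (simp add: F_def)
  have p: "contractive_seminorm (\<lambda>x. infdist x (span (F i)))" for i
    by (intro contractive_seminorm_infdist_subspace) simp
  have "(\<lambda>i. energy (\<lambda>x. (infdist x (span (F i)))\<^sup>2) v) \<longlonglongrightarrow> (\<integral>\<^sup>+t. 0 \<partial>unit_lebesgue)"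
    unfolding energy_def
  proof (rule nn_integral_dominated_convergence[where w="\<lambda>t. ennreal ((norm (v t))\<^sup>2)"])
    show "(\<lambda>t. ennreal ((infdist (v t) (span (F i)))\<^sup>2)) \<in> borel_measurable unit_lebesgue" for i
      using borel_measurable_compose_L2[OF v midconvex_seminorm_square(2)[OF p]] by measurable
    show "(\<lambda>t. ennreal ((norm (v t))\<^sup>2)) \<in> borel_measurable unit_lebesgue"
      using borel_measurable_compose_L2[OF v midconvex_seminorm_square(2)[OF contractive_seminorm_norm]] by measurable
    show "AE t in unit_lebesgue. ennreal ((infdist (v t) (span (F i)))\<^sup>2) \<le> ennreal ((norm (v t))\<^sup>2)" for i
      by (intro AE_I2 ennreal_leI power_mono contractive_seminormD(3)[OF p] infdist_nonneg)
    show "(\<integral>\<^sup>+t. ennreal ((norm (v t))\<^sup>2) \<partial>unit_lebesgue) < \<infinity>"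
      using L2D(2)[OF v] by (simp add: energy_def)
    show "AE t in unit_lebesgue. (\<lambda>i. ennreal ((infdist (v t) (span (F i)))\<^sup>2)) \<longlonglongrightarrow> 0"
      using s(2) AE_space
    proof eventually_elim
      case (elim t)
      have le: "infdist (v t) (span (F i)) \<le> dist (v t) (s i t)" for i
        using elim(2) by (intro infdist_le span_base) (simp add: F_def)
      have "(\<lambda>i. dist (v t) (s i t)) \<longlonglongrightarrow> dist (v t) (v t)"
        by (intro tendsto_intros elim)
      then have d: "(\<lambda>i. dist (v t) (s i t)) \<longlonglongrightarrow> 0" by simp
      have "(\<lambda>i. infdist (v t) (span (F i))) \<longlonglongrightarrow> 0"
        by (rule tendsto_sandwich[OF _ _ tendsto_const d]) (simp_all add: le infdist_nonneg)
      then have "(\<lambda>i. (infdist (v t) (span (F i)))\<^sup>2) \<longlonglongrightarrow> 0\<^sup>2" by (rule tendsto_power)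
      then show ?case using tendsto_ennrealI by fastforce
    qed
  qed simp
  then have lim: "(\<lambda>i. energy (\<lambda>x. (infdist x (span (F i)))\<^sup>2) v) \<longlonglongrightarrow> 0" by simp
  have "\<forall>\<^sub>F i in sequentially. energy (\<lambda>x. (infdist x (span (F i)))\<^sup>2) v < ennreal \<tau>"
    by (rule order_tendstoD(2)[OF lim]) (simp add: \<tau>)
  then obtain i where "energy (\<lambda>x. (infdist x (span (F i)))\<^sup>2) v < ennreal \<tau>"
    using eventually_happens'[OF sequentially_bot] by blast
  then show thesis
    by (intro that[of "F i"] fin) (auto simp: F_def)
qed

definition perturbed :: "(nat \<Rightarrow> 'a::real_normed_vector set) \<Rightarrow> (nat \<Rightarrow> real) \<Rightarrow> nat \<Rightarrow> 'a \<Rightarrow> real" where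
  "perturbed F \<delta> n x = (norm x)\<^sup>2 + (\<Sum>j<n. \<delta> j * (infdist x (span (F j)))\<^sup>2)"

text \<open>
  Dependent choice of the near-minimizer \<open>v n\<close> for the current norm and then of a finite
  set \<open>F n\<close> that almost spans its values. The accuracies \<open>\<tau>\<close> are
  prescribed beforehand.
\<close>

lemma perturbation_sequence_exists:
  fixes h :: "'a::banach \<Rightarrow> ennreal"
  assumes h: "h 0 < \<infinity>" and \<tau>: "\<And>n. 0 < \<tau> n"
  obtains F :: "nat \<Rightarrow> 'a set" and v
  where "\<And>n. finite (F n)" "\<And>n. F n \<subseteq> F (Suc n)" "\<And>n. v n \<in> L2"
    "\<And>n. energy (\<lambda>x. (infdist x (span (F n)))\<^sup>2) (v n) \<le> ennreal (\<tau> n)"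
    "\<And>n w. w \<in> L2 \<Longrightarrow> total_cost (perturbed F \<delta> n) h (v n) \<le> total_cost (perturbed F \<delta> n) h w + ennreal (\<tau> n)"
proof -
  define P where "P n = (\<lambda>(q :: 'a \<Rightarrow> real, G :: 'a set, v :: real \<Rightarrow> 'a).
    q 0 = 0 \<and> (n = 0 \<longrightarrow> q = (\<lambda>x. (norm x)\<^sup>2)) \<and> finite G \<and> v \<in> L2 \<and>
    energy (\<lambda>x. (infdist x (span G))\<^sup>2) v \<le> ennreal (\<tau> n) \<and>
    (\<forall>w\<in>L2. total_cost q h v \<le> total_cost q h w + ennreal (\<tau> n)))" for n :: nat
  define S where "S n = (\<lambda>(q :: 'a \<Rightarrow> real, G :: 'a set, v :: real \<Rightarrow> 'a) (q', G', v' :: real \<Rightarrow> 'a).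
    q' = (\<lambda>x. q x + \<delta> n * (infdist x (span G))\<^sup>2) \<and> G \<subseteq> G')" for n :: nat
  have step: "\<exists>G v. finite G \<and> G0 \<subseteq> G \<and> v \<in> L2 \<and> energy (\<lambda>x. (infdist x (span G))\<^sup>2) v \<le> ennreal (\<tau> n) \<and>
      (\<forall>w\<in>L2. total_cost q h v \<le> total_cost q h w + ennreal (\<tau> n))"
    if q: "q 0 = 0" and G0: "finite G0" for q :: "'a \<Rightarrow> real" and G0 :: "'a set" and n
  proof -
    obtain v where v: "v \<in> L2" "\<And>w. w \<in> L2 \<Longrightarrow> total_cost q h v \<le> total_cost q h w + ennreal (\<tau> n)"
      by (rule near_minimizer_exists[of q h, OF q h \<tau>]) blast
    obtain G where "finite G" "G0 \<subseteq> G" "energy (\<lambda>x. (infdist x (span G))\<^sup>2) v \<le> ennreal (\<tau> n)"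
      by (rule finite_dimensional_approximation[OF v(1) G0 \<tau>])
    with v show ?thesis by blast
  qed
  have "\<exists>f. \<forall>n. P n (f n) \<and> S n (f n) (f (Suc n))"
  proof (rule dependent_nat_choice)
    obtain G v where "finite G" "v \<in> L2" "energy (\<lambda>x. (infdist x (span G))\<^sup>2) v \<le> ennreal (\<tau> 0)"
      "\<forall>w\<in>L2. total_cost (\<lambda>x. (norm x)\<^sup>2) h v \<le> total_cost (\<lambda>x. (norm x)\<^sup>2) h w + ennreal (\<tau> 0)"
      using step[of "\<lambda>x. (norm x)\<^sup>2" "{}" 0] by auto
    then show "\<exists>s. P 0 s"
      by (intro exI[of _ "(\<lambda>x. (norm x)\<^sup>2, G, v)"]) (simp add: P_def)
  next
    fix s n assume Ps: "P n s"
    obtain q G v where s: "s = (q, G, v)" by (cases s)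
    let ?q = "\<lambda>x. q x + \<delta> n * (infdist x (span G))\<^sup>2"
    have "finite G" "?q 0 = 0" using Ps by (simp_all add: P_def s span_zero)
    then obtain G' v' where "finite G'" "G \<subseteq> G'" "v' \<in> L2"
      "energy (\<lambda>x. (infdist x (span G'))\<^sup>2) v' \<le> ennreal (\<tau> (Suc n))"
      "\<forall>w\<in>L2. total_cost ?q h v' \<le> total_cost ?q h w + ennreal (\<tau> (Suc n))"
      using step[of ?q G "Suc n"] by auto
    with \<open>?q 0 = 0\<close> show "\<exists>s'. P (Suc n) s' \<and> S n s s'"
      by (intro exI[of _ "(?q, G', v')"]) (simp add: P_def S_def s)
  qed
  then obtain f where f: "\<And>n. P n (f n)" "\<And>n. S n (f n) (f (Suc n))" by blast
  define q where "q n = fst (f n)" for n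
  define F where "F n = fst (snd (f n))" for n
  define v where "v n = snd (snd (f n))" for n
  have P: "(n = 0 \<longrightarrow> q n = (\<lambda>x. (norm x)\<^sup>2)) \<and> finite (F n) \<and> v n \<in> L2 \<and>
    energy (\<lambda>x. (infdist x (span (F n)))\<^sup>2) (v n) \<le> ennreal (\<tau> n) \<and>
    (\<forall>w\<in>L2. total_cost (q n) h (v n) \<le> total_cost (q n) h w + ennreal (\<tau> n))" for n
    using f(1)[of n] by (simp add: P_def q_def F_def v_def case_prod_unfold)
  have S: "q (Suc n) = (\<lambda>x. q n x + \<delta> n * (infdist x (span (F n)))\<^sup>2)" "F n \<subseteq> F (Suc n)" for n
    using f(2)[of n] by (simp_all add: S_def q_def F_def v_def case_prod_unfold)
  have "q n = perturbed F \<delta> n" for n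
  proof (induction n)
    case 0
    then show ?case using P[of 0] by (simp add: perturbed_def[abs_def])
  next
    case (Suc n)
    then show ?case by (simp add: S(1) perturbed_def[abs_def] fun_eq_iff)
  qed
  with P S(2) show thesis by (intro that[of F v]) auto
qed

lemma sqrt_suminf_square_triangle:
  fixes a b c :: "nat \<Rightarrow> real"
  assumes c: "\<And>i. \<bar>c i\<bar> \<le> \<bar>a i + b i\<bar>"
    and summ: "summable (\<lambda>i. (a i)\<^sup>2)" "summable (\<lambda>i. (b i)\<^sup>2)" "summable (\<lambda>i. (c i)\<^sup>2)"
  shows "sqrt (\<Sum>i. (c i)\<^sup>2) \<le> sqrt (\<Sum>i. (a i)\<^sup>2) + sqrt (\<Sum>i. (b i)\<^sup>2)"
proof (rule LIMSEQ_le)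
  show "(\<lambda>n. sqrt (\<Sum>i<n. (c i)\<^sup>2)) \<longlonglongrightarrow> sqrt (\<Sum>i. (c i)\<^sup>2)"
    by (intro tendsto_real_sqrt summable_LIMSEQ summ)
  show "(\<lambda>n. sqrt (\<Sum>i<n. (a i)\<^sup>2) + sqrt (\<Sum>i<n. (b i)\<^sup>2)) \<longlonglongrightarrow> sqrt (\<Sum>i. (a i)\<^sup>2) + sqrt (\<Sum>i. (b i)\<^sup>2)"
    by (intro tendsto_add tendsto_real_sqrt summable_LIMSEQ summ)
  have "sqrt (\<Sum>i<n. (c i)\<^sup>2) \<le> sqrt (\<Sum>i<n. (a i)\<^sup>2) + sqrt (\<Sum>i<n. (b i)\<^sup>2)" for n
  proof -
    have "(c i)\<^sup>2 \<le> (a i + b i)\<^sup>2" for i using c[of i] by (simp add: abs_le_square_iff)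
    then have "sqrt (\<Sum>i<n. (c i)\<^sup>2) \<le> sqrt (\<Sum>i<n. (a i + b i)\<^sup>2)"
      by (intro real_sqrt_le_mono sum_mono)
    also have "\<dots> \<le> sqrt (\<Sum>i<n. (a i)\<^sup>2) + sqrt (\<Sum>i<n. (b i)\<^sup>2)"
      using L2_set_triangle_ineq[of a b "{..<n}"] by (simp add: L2_set_def)
    finally show ?thesis .
  qed
  then show "\<exists>N. \<forall>n\<ge>N. sqrt (\<Sum>i<n. (c i)\<^sup>2) \<le> sqrt (\<Sum>i<n. (a i)\<^sup>2) + sqrt (\<Sum>i<n. (b i)\<^sup>2)"
    by blast
qed

text \<open>
  The perturbed norm is an \<open>l\<^sup>2\<close> combination of seminorms, hence a norm. Continuity
  and midpoint convexity of its square follow from the case of a seminorm bounded by the norm, after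
  scaling by \<open>1 + \<epsilon>\<close>.
\<close>

lemma perturbed_norm:
  fixes p :: "nat \<Rightarrow> 'a::real_normed_vector \<Rightarrow> real"
  assumes p: "\<And>n. contractive_seminorm (p n)" and \<delta>: "\<And>n. 0 \<le> \<delta> n" "\<delta> sums \<epsilon>"
  defines "Q \<equiv> \<lambda>x. (norm x)\<^sup>2 + (\<Sum>j. \<delta> j * (p j x)\<^sup>2)"
  defines "N \<equiv> \<lambda>x. sqrt (Q x)"
  shows "summable (\<lambda>j. \<delta> j * (p j x)\<^sup>2)"
    "\<And>x. (N x)\<^sup>2 = Q x" "\<And>x. norm x \<le> N x" "\<And>x. N x \<le> (1 + \<epsilon>) * norm x" "is_norm N"
    "continuous_on UNIV Q" "midconvex Q"
proof -
  have le: "\<delta> j * (p j x)\<^sup>2 \<le> \<delta> j * (norm x)\<^sup>2" for j x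
    by (intro mult_left_mono power_mono contractive_seminormD(3)[OF p] contractive_seminorm_simps(3)[OF p] \<delta>)
  have gs: "(\<lambda>j. \<delta> j * (norm x)\<^sup>2) sums (\<epsilon> * (norm x)\<^sup>2)" for x :: 'a
    by (intro sums_mult2 \<delta>)
  show summ: "summable (\<lambda>j. \<delta> j * (p j x)\<^sup>2)" for x
    by (rule summable_comparison_test'[OF sums_summable[OF gs[of x]], of 0]) (use le \<delta> in simp)
  have nn: "0 \<le> (\<Sum>j. \<delta> j * (p j x)\<^sup>2)" for x
    by (intro suminf_nonneg summ) (simp add: \<delta>)
  have \<epsilon>: "0 \<le> \<epsilon>" using sums_le[OF _ sums_zero \<delta>(2)] \<delta>(1) by simp
  have Q0: "0 \<le> Q x" for x using nn[of x] by (simp add: Q_def)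
  show NQ: "(N x)\<^sup>2 = Q x" for x using Q0[of x] by (simp add: N_def)
  have N0: "0 \<le> N x" for x by (simp add: N_def Q0)
  show lower: "norm x \<le> N x" for x
    using nn[of x] by (simp add: N_def Q_def real_le_rsqrt)
  have "Q x \<le> ((1 + \<epsilon>) * norm x)\<^sup>2" for x
  proof -
    have "(\<Sum>j. \<delta> j * (p j x)\<^sup>2) \<le> \<epsilon> * (norm x)\<^sup>2"
      unfolding sums_unique[OF gs] by (intro suminf_le le summ sums_summable[OF gs])
    then have "Q x \<le> (1 + \<epsilon>) * (norm x)\<^sup>2" by (simp add: Q_def algebra_simps)
    also have "\<dots> \<le> (1 + \<epsilon>)\<^sup>2 * (norm x)\<^sup>2"
      using \<epsilon> by (intro mult_right_mono) (simp_all add: power2_eq_square)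
    finally show ?thesis by (simp add: power_mult_distrib)
  qed
  then show upper: "N x \<le> (1 + \<epsilon>) * norm x" for x
    unfolding N_def using \<epsilon> by (intro real_le_lsqrt) (simp_all add: Q0)
  \<comment> \<open>The norm itself is the term with index zero.\<close>
  define a where "a x i = (case i of 0 \<Rightarrow> norm x | Suc j \<Rightarrow> sqrt (\<delta> j) * p j x)" for x :: 'a and i
  have "(\<lambda>j. (a x (Suc j))\<^sup>2) = (\<lambda>j. \<delta> j * (p j x)\<^sup>2)" for x
    by (simp add: a_def power_mult_distrib \<delta>)
  then have "(\<lambda>j. (a x (Suc j))\<^sup>2) sums (\<Sum>j. \<delta> j * (p j x)\<^sup>2)" for x
    using summable_sums[OF summ] by simp
  then have "(\<lambda>i. (a x i)\<^sup>2) sums ((\<Sum>j. \<delta> j * (p j x)\<^sup>2) + (a x 0)\<^sup>2)" for x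
    by (rule sums_Suc)
  then have a: "(\<lambda>i. (a x i)\<^sup>2) sums Q x" for x
    by (simp add: Q_def a_def add.commute)
  have tri: "N (x + y) \<le> N x + N y" for x y
    unfolding N_def sums_unique[OF a]
  proof (rule sqrt_suminf_square_triangle)
    fix i
    have "0 \<le> a z i" for z
      by (auto simp: a_def \<delta> contractive_seminorm_simps(3)[OF p] split: nat.split)
    moreover have "a (x + y) i \<le> a x i + a y i"
    proof (cases i)
      case (Suc j)
      have "sqrt (\<delta> j) * p j (x + y) \<le> sqrt (\<delta> j) * (p j x + p j y)"
        by (intro mult_left_mono contractive_seminormD(1)[OF p]) (simp add: \<delta>)
      then show ?thesis by (simp add: a_def Suc distrib_left)
    qed (simp add: a_def norm_triangle_ineq)
    ultimately show "\<bar>a (x + y) i\<bar> \<le> \<bar>a x i + a y i\<bar>" by simp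
  qed (use sums_summable[OF a] in auto)
  have scale: "N (c *\<^sub>R x) = \<bar>c\<bar> * N x" for c x
  proof -
    have "(\<lambda>j. \<delta> j * (p j (c *\<^sub>R x))\<^sup>2) = (\<lambda>j. c\<^sup>2 * (\<delta> j * (p j x)\<^sup>2))"
      by (simp add: contractive_seminormD(2)[OF p] power_mult_distrib algebra_simps)
    then have "Q (c *\<^sub>R x) = c\<^sup>2 * Q x"
      using suminf_mult[OF summ, of "c\<^sup>2" x] by (simp add: Q_def power_mult_distrib distrib_left)
    then show ?thesis by (simp add: N_def real_sqrt_mult)
  qed
  have zero: "N x = 0 \<longleftrightarrow> x = 0" for x
    using lower[of x] upper[of x] by (auto simp: N0 antisym)
  show "is_norm N"
    unfolding is_norm_def using N0 zero scale tri by blast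
  define q where "q x = N x / (1 + \<epsilon>)" for x
  have q: "contractive_seminorm q"
    unfolding contractive_seminorm_def q_def
  proof (intro conjI allI)
    fix x y :: 'a and c :: real
    show "N (x + y) / (1 + \<epsilon>) \<le> N x / (1 + \<epsilon>) + N y / (1 + \<epsilon>)"
      using tri[of x y] \<epsilon> by (simp add: divide_right_mono flip: add_divide_distrib)
    show "N (c *\<^sub>R x) / (1 + \<epsilon>) = \<bar>c\<bar> * (N x / (1 + \<epsilon>))" by (simp add: scale)
    show "N x / (1 + \<epsilon>) \<le> norm x" using upper[of x] \<epsilon> by (simp add: field_simps)
  qed
  have Qq: "Q = (\<lambda>x. (1 + \<epsilon>)\<^sup>2 * (q x)\<^sup>2)"
    using \<epsilon> by (auto simp: q_def power_divide NQ)
  show "continuous_on UNIV Q"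
    unfolding Qq by (intro continuous_intros midconvex_seminorm_square(2)[OF q])
  show "midconvex Q"
    using midconvex_seminorm_square(1)[OF q] mult_left_mono[OF _ zero_le_power2[of "1 + \<epsilon>"]]
    unfolding Qq midconvex_def by (metis distrib_left times_divide_eq_right)
qed

section \<open>Existence of a minimizer\<close>

text \<open>
  The variational argument, for a nonnegative potential. The sequence of accuracies is \<open>\<tau> n =
  4\<^sup>-\<^sup>n\<close> against \<open>\<delta> n = \<epsilon>
  2\<^sup>-\<^sup>n\<^sup>-\<^sup>1\<close>, so that \<open>\<tau> n / \<delta> n\<close> tends to zero.
\<close>

lemma minimizer_exists_after_renorming:
  fixes h :: "'a::banach \<Rightarrow> ennreal"
  assumes h: "\<And>c. closed {x. h x \<le> c}" and h0: "h 0 < \<infinity>" and \<epsilon>: "0 < \<epsilon>" "\<epsilon> \<le> 1"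
  obtains N w where "is_norm N" "\<And>x. norm x \<le> N x" "\<And>x. N x \<le> (1 + \<epsilon>) * norm x"
    "continuous_on UNIV (\<lambda>x. (N x)\<^sup>2)" "w \<in> L2"
    "\<And>v. v \<in> L2 \<Longrightarrow> total_cost (\<lambda>x. (N x)\<^sup>2) h w \<le> total_cost (\<lambda>x. (N x)\<^sup>2) h v"
proof -
  define \<delta> where "\<delta> j = \<epsilon> * (1/2) ^ Suc j" for j :: nat
  define \<tau> where "\<tau> n = (1/4 :: real) ^ n" for n :: nat
  have \<delta>: "0 < \<delta> n" for n using \<epsilon> by (simp add: \<delta>_def)
  have \<delta>_sums: "\<delta> sums \<epsilon>"
    unfolding \<delta>_def using sums_mult[OF power_half_series, of \<epsilon>] by simp
  have \<tau>: "0 < \<tau> n" for n by (simp add: \<tau>_def)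
  obtain F :: "nat \<Rightarrow> 'a set" and v where F: "\<And>n. finite (F n)" "\<And>n. F n \<subseteq> F (Suc n)"
    and v: "\<And>n. v n \<in> L2" and approx: "\<And>n. energy (\<lambda>x. (infdist x (span (F n)))\<^sup>2) (v n) \<le> ennreal (\<tau> n)"
    and near: "\<And>n w. w \<in> L2 \<Longrightarrow> total_cost (perturbed F \<delta> n) h (v n) \<le> total_cost (perturbed F \<delta> n) h w + ennreal (\<tau> n)"
    by (rule perturbation_sequence_exists[of h \<tau> \<delta>, OF h0 \<tau>]) blast
  define p where "p n x = infdist x (span (F n))" for n x
  have p: "contractive_seminorm (p n)" for n
    unfolding p_def by (intro contractive_seminorm_infdist_subspace) simp
  have p_mono: "p k x \<le> p n x" if "n \<le> k" for n k x
    unfolding p_def using lift_Suc_mono_le[of F, OF F(2) that]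
    by (intro infdist_mono span_mono) (auto intro: span_zero)
  define Q where "Q x = (norm x)\<^sup>2 + (\<Sum>j. \<delta> j * (p j x)\<^sup>2)" for x
  define N where "N x = sqrt (Q x)" for x
  note ren = perturbed_norm[of p \<delta> \<epsilon>, OF p less_imp_le[OF \<delta>] \<delta>_sums, folded Q_def, folded N_def]
  have summ: "summable (\<lambda>j. \<delta> j * (p j x)\<^sup>2)" for x by (rule ren(1))
  define q where "q n x = (norm x)\<^sup>2 + (\<Sum>j<n. \<delta> j * (p j x)\<^sup>2)" for n x
  have pq: "perturbed F \<delta> n = q n" for n
    by (simp add: perturbed_def[abs_def] q_def[abs_def] p_def)
  have cp: "continuous_on UNIV (\<lambda>x. (p n x)\<^sup>2)" for n
    by (rule midconvex_seminorm_square(2)[OF p])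
  have cq: "continuous_on UNIV (q n)" for n
    unfolding q_def by (intro continuous_intros cp)
  have q0: "0 \<le> q n x" for n x
    unfolding q_def by (intro add_nonneg_nonneg sum_nonneg mult_nonneg_nonneg less_imp_le[OF \<delta>] zero_le_power2)
  have q_le: "q n x + \<delta> n * (p n x)\<^sup>2 \<le> Q x" for n x
  proof -
    have "(\<Sum>j<Suc n. \<delta> j * (p j x)\<^sup>2) \<le> (\<Sum>j. \<delta> j * (p j x)\<^sup>2)"
      using less_imp_le[OF \<delta>] by (intro sum_le_suminf summ) auto
    then show ?thesis by (simp add: q_def Q_def)
  qed
  \<comment> \<open>As the subspaces increase, each later seminorm is at most \<open>p n\<close>, and the weights sum to at most one.\<close>
  have Q_le: "Q x \<le> q n x + (p n x)\<^sup>2" for n x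
  proof -
    have s1: "summable (\<lambda>j. \<delta> (j + n) * (p (j + n) x)\<^sup>2)" by (rule summable_ignore_initial_segment[OF summ])
    have s2: "summable (\<lambda>j. \<delta> (j + n))" by (rule summable_ignore_initial_segment[OF sums_summable[OF \<delta>_sums]])
    have "(\<Sum>j. \<delta> (j + n) * (p (j + n) x)\<^sup>2) \<le> (\<Sum>j. \<delta> (j + n) * (p n x)\<^sup>2)"
      using less_imp_le[OF \<delta>]
      by (intro suminf_le s1 summable_mult2 s2 mult_left_mono power_mono p_mono contractive_seminorm_simps(3)[OF p]) auto
    also have "\<dots> = (\<Sum>j. \<delta> (j + n)) * (p n x)\<^sup>2" by (rule suminf_mult2[OF s2, symmetric])
    also have "(\<Sum>j. \<delta> (j + n)) \<le> 1"
    proof -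
      have "(\<Sum>j. \<delta> j) = (\<Sum>j. \<delta> (j + n)) + (\<Sum>j<n. \<delta> j)"
        by (rule suminf_split_initial_segment[OF sums_summable[OF \<delta>_sums]])
      moreover have "0 \<le> (\<Sum>j<n. \<delta> j)" using less_imp_le[OF \<delta>] by (intro sum_nonneg) auto
      ultimately show ?thesis using \<epsilon>(2) sums_unique[OF \<delta>_sums] by simp
    qed
    finally have "(\<Sum>j. \<delta> (j + n) * (p (j + n) x)\<^sup>2) \<le> (p n x)\<^sup>2"
      by (simp add: mult_right_mono)
    then show ?thesis
      using suminf_split_initial_segment[OF summ, of x n] by (simp add: Q_def q_def)
  qed
  have Q0: "0 \<le> Q x" for x using ren(2)[of x] by (metis zero_le_power2)
  \<comment> \<open>Every competitor pays for leaving the subspace that nearly contains the values of \<open>v n\<close>.\<close>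
  have key: "total_cost Q h (v n) + ennreal (\<delta> n) * energy (\<lambda>x. (p n x)\<^sup>2) w \<le> total_cost Q h w + ennreal (2 * \<tau> n)"
    if w: "w \<in> L2" for n w
  proof -
    have "energy Q (v n) \<le> energy (\<lambda>x. q n x + (p n x)\<^sup>2) (v n)" by (intro energy_mono Q_le)
    also have "\<dots> = energy (q n) (v n) + energy (\<lambda>x. (p n x)\<^sup>2) (v n)"
      by (intro energy_add v cq cp q0 zero_le_power2)
    also have "\<dots> \<le> energy (q n) (v n) + ennreal (\<tau> n)"
      using approx[of n] by (simp add: p_def add_left_mono)
    finally have 1: "total_cost Q h (v n) \<le> total_cost (q n) h (v n) + ennreal (\<tau> n)"
      by (simp add: total_cost_def add_right_mono add.assoc add.commute[of _ "potential h (v n)"] add_left_mono)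
    have 2: "total_cost (q n) h (v n) \<le> total_cost (q n) h w + ennreal (\<tau> n)"
      using near[OF w, of n] by (simp add: pq)
    have "energy (q n) w + ennreal (\<delta> n) * energy (\<lambda>x. (p n x)\<^sup>2) w =
        energy (\<lambda>x. q n x + \<delta> n * (p n x)\<^sup>2) w"
      using energy_add[OF w cq q0, of "\<lambda>x. \<delta> n * (p n x)\<^sup>2" n] energy_cmult[OF w cp less_imp_le[OF \<delta>], of n n] \<delta>[of n] cp[of n]
      by (simp add: continuous_on_mult_left)
    also have "\<dots> \<le> energy Q w" by (intro energy_mono q_le)
    finally have 3: "total_cost (q n) h w + ennreal (\<delta> n) * energy (\<lambda>x. (p n x)\<^sup>2) w \<le> total_cost Q h w"
      by (simp add: total_cost_def add.assoc add.commute[of "potential h w"])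
    have "total_cost Q h (v n) + ennreal (\<delta> n) * energy (\<lambda>x. (p n x)\<^sup>2) w \<le>
        ((total_cost (q n) h w + ennreal (\<tau> n)) + ennreal (\<tau> n)) + ennreal (\<delta> n) * energy (\<lambda>x. (p n x)\<^sup>2) w"
      using 1 2 by (intro add_right_mono) (meson add_right_mono order_trans)
    also have "\<dots> = (total_cost (q n) h w + ennreal (\<delta> n) * energy (\<lambda>x. (p n x)\<^sup>2) w) + (ennreal (\<tau> n) + ennreal (\<tau> n))"
      by (simp add: ac_simps)
    also have "\<dots> \<le> total_cost Q h w + (ennreal (\<tau> n) + ennreal (\<tau> n))"
      by (intro add_right_mono 3)
    also have "ennreal (\<tau> n) + ennreal (\<tau> n) = ennreal (2 * \<tau> n)"
      using \<tau>[of n] by (simp flip: ennreal_plus)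
    finally show ?thesis .
  qed
  have min: "total_cost Q h (v n) \<le> total_cost Q h w + ennreal (2 * \<tau> n)" if "w \<in> L2" for n w
    using key[OF that, of n] by (meson add_increasing2 order_refl order_trans zero_le le_add_same_cancel1)
  have \<tau>_le: "\<tau> k \<le> \<tau> n" if "n \<le> k" for n k
    unfolding \<tau>_def using that by (intro power_decreasing) auto
  define R where "R = enn2real (h 0) + 2"
  have R: "0 \<le> R" by (simp add: R_def)
  have total_cost_le: "total_cost Q h (v n) \<le> ennreal R" for n
  proof -
    have "Q 0 = 0" using contractive_seminorm_simps(1)[OF p] by (simp add: Q_def)
    then have "total_cost Q h (v n) \<le> h 0 + ennreal (2 * \<tau> n)"
      using min[OF zero_in_L2, of n] by (simp add: total_cost_zero[of Q])
    also have "\<dots> \<le> h 0 + ennreal 2"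
      using \<tau>_le[of 0 n] by (intro add_left_mono ennreal_leI) (simp add: \<tau>_def)
    also have "\<dots> = ennreal R"
      using h0 by (simp add: R_def ennreal_plus less_top)
    finally show ?thesis .
  qed
  have energy_R: "energy Q (v n) \<le> ennreal R" for n
    using total_cost_le[of n] unfolding total_cost_def by (meson add_increasing2 order_refl order_trans zero_le le_add_same_cancel1)
  have norm_R: "energy (\<lambda>x. (norm x)\<^sup>2) (v n) \<le> ennreal R" for n
  proof (rule order_trans[OF energy_mono energy_R])
    show "(norm x)\<^sup>2 \<le> Q x" for x :: 'a
      using power_mono[OF ren(3)[of x], of 2] ren(2)[of x] by simp
  qed
  define \<theta> where "\<theta> n = 4 * \<tau> n / \<delta> n" for n
  have \<theta>0: "0 \<le> \<theta> n" for n using \<tau>[of n] \<delta>[of n] by (simp add: \<theta>_def)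
  have "\<theta> = (\<lambda>n. (8 / \<epsilon>) * (1/2) ^ n)"
  proof
    fix n
    have "(4::real) ^ n = 2 ^ n * 2 ^ n" by (simp flip: power_mult_distrib)
    then show "\<theta> n = (8 / \<epsilon>) * (1/2) ^ n"
      using \<epsilon>(1) by (simp add: \<theta>_def \<tau>_def \<delta>_def power_divide field_simps)
  qed
  moreover have "(\<lambda>n. (8 / \<epsilon>) * (1/2) ^ n) \<longlonglongrightarrow> (8 / \<epsilon>) * 0"
    by (intro tendsto_intros LIMSEQ_realpow_zero) auto
  ultimately have \<theta>: "\<theta> \<longlonglongrightarrow> 0" by simp
  have small: "energy (\<lambda>x. (p n x)\<^sup>2) (v k) \<le> ennreal (\<theta> n)" if "n \<le> k" for n k
  proof -
    have "total_cost Q h (v n) + ennreal (\<delta> n) * energy (\<lambda>x. (p n x)\<^sup>2) (v k) \<le> total_cost Q h (v k) + ennreal (2 * \<tau> n)"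
      by (rule key[OF v])
    also have "\<dots> \<le> (total_cost Q h (v n) + ennreal (2 * \<tau> k)) + ennreal (2 * \<tau> n)"
      by (intro add_right_mono min v)
    also have "\<dots> \<le> (total_cost Q h (v n) + ennreal (2 * \<tau> n)) + ennreal (2 * \<tau> n)"
      using \<tau>_le[OF that] by (intro add_right_mono add_left_mono ennreal_leI) simp
    also have "\<dots> = total_cost Q h (v n) + ennreal (4 * \<tau> n)"
      using \<tau>[of n] by (simp add: add.assoc flip: ennreal_plus)
    finally have "ennreal (\<delta> n) * energy (\<lambda>x. (p n x)\<^sup>2) (v k) \<le> ennreal (4 * \<tau> n)"
      using total_cost_le[of n] by (auto simp: ennreal_add_left_cancel_le top_unique)
    moreover have "energy (\<lambda>x. (p n x)\<^sup>2) (v k) \<le> energy (\<lambda>x. (norm x)\<^sup>2) (v k)"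
      by (intro energy_mono power_mono contractive_seminormD(3)[OF p] contractive_seminorm_simps(3)[OF p])
    then have "energy (\<lambda>x. (p n x)\<^sup>2) (v k) < top"
      using norm_R[of k] ennreal_less_top[of R] by (meson le_less_trans order_trans)
    then obtain e where e: "0 \<le> e" "energy (\<lambda>x. (p n x)\<^sup>2) (v k) = ennreal e"
      by (cases "energy (\<lambda>x. (p n x)\<^sup>2) (v k)" rule: ennreal_cases) auto
    ultimately have "\<delta> n * e \<le> 4 * \<tau> n"
      using \<delta>[of n] \<tau>[of n] by (simp add: ennreal_le_iff flip: ennreal_mult)
    then show ?thesis using \<delta>[of n] e by (simp add: \<theta>_def field_simps ennreal_leI)
  qed
  define a where "a k = enn2real (energy Q (v k))" for k
  have a: "energy Q (v k) = ennreal (a k)" for k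
    using energy_R[of k] by (simp add: a_def le_less_trans[OF _ ennreal_less_top])
  have a_range: "a k \<in> {0..R}" for k
    using energy_R[of k] R by (simp add: a ennreal_le_iff) (simp add: a_def)
  \<comment> \<open>Energies that converge make the lower limits of energy and potential add up.\<close>
  obtain l \<rho> where \<rho>: "strict_mono (\<rho>::nat\<Rightarrow>nat)" and "l \<in> {0..R}" and l: "(a \<circ> \<rho>) \<longlonglongrightarrow> l"
    using seq_compactE[OF compact_imp_seq_compact[OF compact_Icc], of a 0 R] a_range by metis
  then have l0: "0 \<le> l" by simp
  define V where "V k = v (\<rho> k)" for k
  have small_V: "energy (\<lambda>x. (infdist x (span (F n)))\<^sup>2) (V k) \<le> ennreal (\<theta> n)" if "n \<le> k" for n k
    using small[of n "\<rho> k"] that seq_suble[OF \<rho>, of k] by (simp add: V_def p_def)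
  obtain r w where r: "strict_mono (r::nat\<Rightarrow>nat)" and w: "w \<in> L2"
    and prim: "\<And>t. t \<in> {0..1} \<Longrightarrow> (\<lambda>k. primitive (V (r k)) t) \<longlonglongrightarrow> primitive w t"
    and lsc: "\<And>Q c. continuous_on UNIV Q \<Longrightarrow> (\<And>x. 0 \<le> Q x) \<Longrightarrow> midconvex Q \<Longrightarrow>
      (\<forall>\<^sub>F k in sequentially. energy Q (V (r k)) \<le> c) \<Longrightarrow> energy Q w \<le> c"
  proof (rule compactness_of_nearly_finite_dimensional_sequence[of V R F \<theta>])
    show "V k \<in> L2" "energy (\<lambda>x. (norm x)\<^sup>2) (V k) \<le> ennreal R" for k
      unfolding V_def by (rule v norm_R)+
    show "energy (\<lambda>x. (infdist x (span (F n)))\<^sup>2) (V k) \<le> ennreal (\<theta> n)" if "n \<le> k" for n k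
      by (rule small_V[OF that])
    show "0 \<le> R" "\<theta> \<longlonglongrightarrow> 0" and "\<And>n. finite (F n)" "\<And>n. 0 \<le> \<theta> n"
      by (fact R \<theta> F(1) \<theta>0)+
    fix r w
    assume r: "strict_mono (r::nat\<Rightarrow>nat)" and w: "w \<in> L2"
      and prim: "\<And>t. t \<in> {0..1} \<Longrightarrow> (\<lambda>k. primitive (V (r k)) t) \<longlonglongrightarrow> primitive w t"
      and lsc: "\<And>Q c. continuous_on UNIV Q \<Longrightarrow> (\<And>x. 0 \<le> Q x) \<Longrightarrow> midconvex Q \<Longrightarrow>
        (\<forall>\<^sub>F k in sequentially. energy Q (V (r k)) \<le> c) \<Longrightarrow> energy Q w \<le> c"
    show thesis
      by (rule that[OF r w prim]) (assumption, rule lsc)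
  qed
  have a_lim: "(\<lambda>k. a (\<rho> (r k))) \<longlonglongrightarrow> l"
    using LIMSEQ_subseq_LIMSEQ[OF l r] by (simp add: o_def)
  have close: "\<forall>\<^sub>F k in sequentially. \<bar>a (\<rho> (r k)) - l\<bar> < e" if "0 < e" for e
    using tendstoD[OF a_lim that] by (simp add: dist_real_def)
  have energy_w: "energy Q w \<le> ennreal l"
  proof (rule ennreal_le_epsilon)
    fix e :: real assume e: "0 < e"
    show "energy Q w \<le> ennreal l + ennreal e"
    proof (rule lsc[OF ren(6) Q0 ren(7)])
      show "\<forall>\<^sub>F k in sequentially. energy Q (V (r k)) \<le> ennreal l + ennreal e"
        using close[OF e]
      proof eventually_elim
        case (elim k)
        then show ?case using l0 e by (simp add: V_def a ennreal_leI flip: ennreal_plus)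
      qed
    qed
  qed
  have opt: "total_cost Q h w \<le> total_cost Q h y" if y: "y \<in> L2" for y
  proof (rule ennreal_le_epsilon)
    fix e :: real assume e: "0 < e"
    have "\<forall>\<^sub>F k in sequentially. \<tau> k < e / 4"
      unfolding \<tau>_def using e by (intro order_tendstoD(2)[OF LIMSEQ_realpow_zero]) auto
    then have ev: "\<forall>\<^sub>F k in sequentially. ennreal l + potential h (V (r k)) \<le> total_cost Q h y + ennreal e"
      using close[OF half_gt_zero[OF e]]
    proof eventually_elim
      case (elim k)
      have "k \<le> \<rho> (r k)" using seq_suble[OF r, of k] seq_suble[OF \<rho>, of "r k"] by simp
      then have \<tau>k: "2 * \<tau> (\<rho> (r k)) \<le> e / 2" using \<tau>_le elim(1) by fastforce
      have "l \<le> a (\<rho> (r k)) + e / 2" using elim(2) unfolding abs_less_iff by simp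
      then have "ennreal l \<le> energy Q (V (r k)) + ennreal (e / 2)"
        using a_range[of "\<rho> (r k)"] e by (simp add: V_def a ennreal_leI flip: ennreal_plus)
      then have "ennreal l + potential h (V (r k)) \<le> total_cost Q h (V (r k)) + ennreal (e / 2)"
        unfolding total_cost_def by (metis add.assoc add.commute add_right_mono)
      also have "\<dots> \<le> (total_cost Q h y + ennreal (2 * \<tau> (\<rho> (r k)))) + ennreal (e / 2)"
        unfolding V_def by (intro add_right_mono min y)
      also have "\<dots> \<le> (total_cost Q h y + ennreal (e / 2)) + ennreal (e / 2)"
        by (intro add_right_mono add_left_mono ennreal_leI \<tau>k)
      also have "\<dots> = total_cost Q h y + ennreal e"
        using e by (simp add: add.assoc flip: ennreal_plus)
      finally show ?case .
    qed
    have "total_cost Q h w \<le> ennreal l + liminf (\<lambda>k. potential h (V (r k)))"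
      unfolding total_cost_def using prim v
      by (intro add_mono energy_w potential_le_liminf[OF h]) (simp_all add: V_def)
    also have "\<dots> = liminf (\<lambda>k. ennreal l + potential h (V (r k)))"
      by (simp add: Liminf_const_add)
    also have "\<dots> \<le> total_cost Q h y + ennreal e"
      using ev by (rule Liminf_le[rotated]) simp
    finally show "total_cost Q h w \<le> total_cost Q h y + ennreal e" .
  qed
  have NQ: "(\<lambda>x. (N x)\<^sup>2) = Q" using ren(2) by (rule ext)
  show thesis
    by (rule that[of N w]) (use ren w opt in \<open>simp_all add: NQ\<close>)
qed

text \<open>
  The positive part of the integrand plus \<open>c\<close> is the shifted, nonnegative integrand plus
  the negative part. The negative part is at most \<open>c\<close>, so its integral over the unit
  interval, which has measure one, is finite and can be subtracted.
\<close>

lemma ereal_integral_shift: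
  assumes Q: "(\<lambda>t. Q (v t)) \<in> borel_measurable unit_lebesgue" "\<And>x. 0 \<le> Q x"
    and h: "(\<lambda>t. h (u t)) \<in> borel_measurable unit_lebesgue"
    and f: "\<And>x. f x = enn2ereal (h x) - ereal c" and c: "0 \<le> c"
  shows "ereal_integral unit_lebesgue (\<lambda>t. ereal (Q (v t)) + f (u t)) =
    enn2ereal (\<integral>\<^sup>+t. ennreal (Q (v t)) + h (u t) \<partial>unit_lebesgue) - ereal c"
proof -
  note [measurable] = Q(1) h
  define g where "g t = ereal (Q (v t)) + f (u t)" for t
  have [measurable]: "g \<in> borel_measurable unit_lebesgue"
    unfolding g_def f by measurable
  have pt: "e2ennreal (g t) + ennreal c = (ennreal (Q (v t)) + h (u t)) + e2ennreal (- g t)" for t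
  proof (cases "h (u t)" rule: ennreal_cases)
    case (real y)
    define z where "z = Q (v t) + y - c"
    have "g t = ereal z" using real Q(2) by (simp add: g_def f z_def)
    moreover have "ennreal z + ennreal c = ennreal (Q (v t)) + ennreal y + ennreal (- z)"
      using real(1) Q(2)[of "v t"] c
      by (cases "0 \<le> z") (auto simp: z_def ennreal_neg simp flip: ennreal_plus)
    ultimately show ?thesis using real by simp
  next
    case top
    then show ?thesis by (simp add: g_def f)
  qed
  have bound: "e2ennreal (- g t) \<le> ennreal c" for t
  proof -
    have "- g t \<le> ereal c"
      using Q(2)[of "v t"] enn2ereal_nonneg[of "h (u t)"]
      by (cases "enn2ereal (h (u t))") (auto simp: g_def f)
    then show ?thesis by (metis e2ennreal_mono e2ennreal_ereal)
  qed
  define X where "X = (\<integral>\<^sup>+t. e2ennreal (g t) \<partial>unit_lebesgue)"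
  define Y where "Y = (\<integral>\<^sup>+t. e2ennreal (- g t) \<partial>unit_lebesgue)"
  define T where "T = (\<integral>\<^sup>+t. ennreal (Q (v t)) + h (u t) \<partial>unit_lebesgue)"
  have const: "(\<integral>\<^sup>+t. ennreal c \<partial>unit_lebesgue) = ennreal c"
    using emeasure_space_unit_lebesgue by simp
  have "Y \<le> (\<integral>\<^sup>+t. ennreal c \<partial>unit_lebesgue)"
    unfolding Y_def by (intro nn_integral_mono bound)
  then have "Y \<le> ennreal c" by (simp only: const)
  moreover have "X + ennreal c = T + Y"
  proof -
    have "X + (\<integral>\<^sup>+t. ennreal c \<partial>unit_lebesgue) = (\<integral>\<^sup>+t. e2ennreal (g t) + ennreal c \<partial>unit_lebesgue)"
      unfolding X_def by (rule nn_integral_add[symmetric]) measurable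
    then have "X + ennreal c = (\<integral>\<^sup>+t. e2ennreal (g t) + ennreal c \<partial>unit_lebesgue)"
      by (simp only: const)
    also have "\<dots> = (\<integral>\<^sup>+t. (ennreal (Q (v t)) + h (u t)) + e2ennreal (- g t) \<partial>unit_lebesgue)"
      by (simp only: pt)
    also have "\<dots> = T + Y"
      unfolding T_def Y_def by (rule nn_integral_add) measurable
    finally show ?thesis .
  qed
  ultimately have "enn2ereal X - enn2ereal Y = enn2ereal T - ereal c"
    using c
    by (cases X rule: ennreal_cases; cases Y rule: ennreal_cases; cases T rule: ennreal_cases)
       (auto simp: top_unique enn2ereal_ennreal simp flip: ennreal_plus)
  then show ?thesis
    by (simp add: ereal_integral_def X_def Y_def T_def g_def)
qed

lemma lower_semicontinuous_closed_sublevel: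
  assumes "lower_semicontinuous f"
  shows "closed {x. f x \<le> ereal r}"
proof -
  have "closed ((\<lambda>x. (x, r)) -` {(x, r). f x \<le> ereal r})"
    using assms unfolding lower_semicontinuous_def
    by (intro closed_vimage) (auto intro!: continuous_intros)
  then show ?thesis by (simp add: vimage_def)
qed

theorem theorem6p1:
  fixes f :: "'a::banach \<Rightarrow> ereal" and \<epsilon> :: real
  assumes "\<And>x. f x \<noteq> -\<infinity>"
    and "lower_semicontinuous f"
    and "\<exists>m::real. \<forall>x. ereal m \<le> f x"
    and "f 0 < \<infinity>"
    and "\<epsilon> > 0"
  shows "\<exists>N :: 'a \<Rightarrow> real. equivalent_norm N \<and>
      (\<forall>x. norm x \<le> N x \<and> N x \<le> (1 + \<epsilon>) * norm x) \<and>
      (\<exists>v. is_solution N f v)"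
proof -
  obtain m :: real where m: "\<And>x. ereal m \<le> f x" using assms(3) by blast
  \<comment> \<open>Shifting by \<open>c\<close> makes the potential nonnegative; the absolute value keeps \<open>c\<close> itself nonnegative.\<close>
  define c where "c = \<bar>m\<bar>"
  define h where "h x = e2ennreal (f x + ereal c)" for x
  have nn: "0 \<le> f x + ereal c" for x
    using m[of x] by (cases "f x") (auto simp: c_def)
  have eh: "enn2ereal (h x) = f x + ereal c" for x
    unfolding h_def by (rule enn2ereal_e2ennreal[OF nn])
  have fh: "f x = enn2ereal (h x) - ereal c" for x
    unfolding eh by (cases "f x") auto
  have h_closed: "closed {x. h x \<le> d}" for d
  proof (cases d rule: ennreal_cases)
    case (real r)
    have "h x \<le> ennreal r \<longleftrightarrow> f x \<le> ereal (r - c)" for x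
      using real by (cases "f x") (auto simp: less_eq_ennreal.rep_eq eh enn2ereal_ennreal)
    then show ?thesis
      using lower_semicontinuous_closed_sublevel[OF assms(2), of "r - c"] by (simp add: real)
  qed simp
  have h0: "h 0 < \<infinity>"
    using assms(4) by (simp add: less_ennreal.rep_eq eh)
  have \<epsilon>: "0 < min \<epsilon> 1" "min \<epsilon> 1 \<le> 1" using assms(5) by auto
  obtain N :: "'a \<Rightarrow> real" and w where N: "is_norm N" "\<And>x. norm x \<le> N x" "\<And>x. N x \<le> (1 + min \<epsilon> 1) * norm x"
    "continuous_on UNIV (\<lambda>x. (N x)\<^sup>2)" and w: "w \<in> L2"
    and opt: "\<And>v. v \<in> L2 \<Longrightarrow> total_cost (\<lambda>x. (N x)\<^sup>2) h w \<le> total_cost (\<lambda>x. (N x)\<^sup>2) h v"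
    by (rule minimizer_exists_after_renorming[of h, OF h_closed h0 \<epsilon>]) blast
  have N_le: "N x \<le> (1 + \<epsilon>) * norm x" for x
    using N(3)[of x] mult_right_mono[of "1 + min \<epsilon> 1" "1 + \<epsilon>" "norm x"] by simp
  have cost: "cost N f v = enn2ereal (total_cost (\<lambda>x. (N x)\<^sup>2) h v) - ereal c" if v: "v \<in> L2" for v
  proof -
    note meas = borel_measurable_compose_L2[OF v N(4)] potential_integrand_measurable[OF v h_closed]
    have "cost N f v = enn2ereal (\<integral>\<^sup>+t. ennreal ((N (v t))\<^sup>2) + h (primitive v t) \<partial>unit_lebesgue) - ereal c"
      unfolding cost_def
      by (rule ereal_integral_shift[where Q="\<lambda>x. (N x)\<^sup>2" and v=v and h=h and u="primitive v" and f=f and c=c, OF meas(1) _ meas(2) fh]) (simp_all add: c_def)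
    also have "(\<integral>\<^sup>+t. ennreal ((N (v t))\<^sup>2) + h (primitive v t) \<partial>unit_lebesgue) = total_cost (\<lambda>x. (N x)\<^sup>2) h v"
      unfolding total_cost_def energy_def potential_def 
      by (rule nn_integral_add[OF measurable_compose[OF meas(1) measurable_ennreal] meas(2)])
    finally show ?thesis .
  qed
  have "is_solution N f w"
    unfolding is_solution_def
  proof (intro conjI w antisym)
    show "cost N f w \<le> (INF v\<in>L2. cost N f v)"
    proof (rule INF_greatest)
      fix v :: "real \<Rightarrow> 'a" assume v: "v \<in> L2"
      then show "cost N f w \<le> cost N f v"
        using opt[OF v] by (simp add: cost w ereal_minus_mono less_eq_ennreal.rep_eq)
    qed
    show "(INF v\<in>L2. cost N f v) \<le> cost N f w" using w by (rule INF_lower)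
  qed
  moreover have "equivalent_norm N"
    unfolding equivalent_norm_def using N(1,2) N_le assms(5)
    by (intro conjI exI[of _ 1] exI[of _ "1 + \<epsilon>"]) auto
  ultimately show ?thesis using N(2) N_le by blast
qed

end
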